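(* Let $Q=(\mathbb{R}/2\pi\mathbb{Z})^d$, $T>0$, $Q_T=Q\times[0,T)$, $\overline{Q}_T=Q\times[0,T]$. Consider $\partial_tv+\mathrm{div}_xf(v)=0$, $v\in\mathbb{R}^n$, with $f\in C^2$, endowed with a $C^2$ entropy–entropy flux pair $(\eta,q)$ satisfying $\frac{\partial\eta}{\partial v_j}\frac{\partial f_{j\alpha}}{\partial v_i}=\frac{\partial q_\alpha}{\partial v_i}$, where $\eta$ is positive and strictly convex with $D^2\eta\ge\gamma_0>0$, $\alpha_0(|\lambda|^p+1)-A\le\eta(\lambda)\le C(|\lambda|^p+1)$ for all $\lambda\in\mathbb{R}^n$ (some $p\in[2,\infty)$ and constants $\alpha_0,A,C>0$), and $|f(\lambda)|/\eta(\lambda)\to0$ as $|\lambda|\to\infty$. Let $(v,\nu,\gamma)$ be a dissipative measure-valued solution with concentration: there are sequences $v^\epsilon$ (bounded in $L^\infty(L^p)$) and initial data $v_0^\epsilon$ such that $g(v^\epsilon)\rightharpoonup\langle\nu_{x,t},g\rangle$ and $g(v_0^\epsilon)\rightharpoonup\langle\mu_x,g\rangle$ for all continuous $g$ with $g/\eta\to0$ at infinity, and $\eta(v^\epsilon)dx\,dt\rightharpoonup\langle\nu_{x,t},\eta\rangle dx\,dt+\gamma(dx\,dt)$, $\eta(v_0^\epsilon)dx\rightharpoonup\langle\mu_x,\eta\rangle dx+\zeta(dx)$, where $\nu=(\nu_{x,t})$, $\mu=(\mu_x)$ are Young measures and $\gamma\ge0$, $\zeta\ge0$ Radon measures; $v=\langle\nu,\lambda\rangle\in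 L^\infty(L^p)$, $v_0=\langle\mu_x,\lambda\rangle$; and $$\iint\langle\nu_{x,t},\lambda\rangle\psi_t+\langle\nu_{x,t},f(\lambda)\rangle\psi_x\,dx\,dt+\int v_0(x)\psi(x,0)dx=0\quad\forall\psi\in C^1_c(Q\times[0,T)),$$ $$\iint\dot\theta\big(\langle\nu_{x,t},\eta\rangle dx\,dt+\gamma(dx\,dt)\big)+\int\theta(0)\big(\langle\mu_x,\eta\rangle dx+\zeta(dx)\big)\ge0\quad\forall\theta\in C^1_c([0,T)),\ \theta\ge0.$$ Suppose $\bar v\in W^{1,\infty}(\overline{Q}_T)$, with $\bar v_0=\bar v(\cdot,0)$, satisfies $\iint[\partial_t\psi_i\bar v_i+\partial_{x_\alpha}\psi_if_{i\alpha}(\bar v)]dx\,dt+\int\psi_i(x,0)\bar v_{0,i}dx=0$ for all $\psi\in C^1_c(Q_T)$ and $\iint\dot\theta\,\eta(\bar v)dx\,dt+\int\theta(0)\eta(\bar v_0)dx=0$ for all $\theta\in C^1_c([0,T))$, $\theta\ge0$. If $\zeta=0$ and $\mu_x=\delta_{\bar v_0(x)}$, then $\nu=\delta_{\bar v}$ and $v=\bar v$ almost everywhere on $Q_T$.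
   Context: Summation convention over repeated indices; $\psi_x$ terms are understood as $\partial_{x_\alpha}\psi_i\,\langle\nu,f_{i\alpha}\rangle$ summed. *)

theory Defs
  imports "HOL-Probability.Probability"
begin

definition C1_map :: "('a::euclidean_space \<Rightarrow> 'b::real_normed_vector) \<Rightarrow> bool" where
  "C1_map g \<longleftrightarrow> (\<exists>D. (\<forall>x. (g has_derivative blinfun_apply (D x)) (at x)) \<and> continuous_on UNIV D)"

definition C2_map :: "('a::euclidean_space \<Rightarrow> 'b::real_normed_vector) \<Rightarrow> bool" where
  "C2_map g \<longleftrightarrow> (\<exists>D D2. (\<forall>x. (g has_derivative blinfun_apply (D x)) (at x)) \<and>
                       (\<forall>x. (D has_derivative blinfun_apply (D2 x)) (at x)) \<and>
                       continuous_on UNIV D2)"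

definition strictly_convex :: "('a::real_vector \<Rightarrow> real) \<Rightarrow> bool" where
  "strictly_convex g \<longleftrightarrow> (\<forall>x y u. x \<noteq> y \<and> 0 < u \<and> u < 1 \<longrightarrow>
      g (u *\<^sub>R x + (1 - u) *\<^sub>R y) < u * g x + (1 - u) * g y)"

text \<open>The torus Q = (R/2piZ)^d is represented by the fundamental cell [0,2pi)^d;
  functions on the torus are 2pi-periodic functions on R^d.\<close>
definition Qcell :: "(real^'d) set" where
  "Qcell = {x. \<forall>i. 0 \<le> x $ i \<and> x $ i < 2 * pi}"

definition QT :: "real \<Rightarrow> ((real^'d) \<times> real) set" where
  "QT T = Qcell \<times> {0..<T}"

definition periodic_x :: "((real^'d) \<times> real \<Rightarrow> 'b) \<Rightarrow> bool" where
  "periodic_x \<phi> \<longleftrightarrow> (\<forall>x t i. \<phi> (x + axis i (2 * pi), t) = \<phi> (x, t))"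

definition periodic_sp :: "(real^'d \<Rightarrow> 'b) \<Rightarrow> bool" where
  "periodic_sp \<phi> \<longleftrightarrow> (\<forall>x i. \<phi> (x + axis i (2 * pi)) = \<phi> x)"

definition Cc_QT :: "real \<Rightarrow> ((real^'d) \<times> real \<Rightarrow> real) \<Rightarrow> bool" where
  "Cc_QT T \<phi> \<longleftrightarrow> continuous_on UNIV \<phi> \<and> periodic_x \<phi> \<and>
     (\<exists>s<T. \<forall>x t. s \<le> t \<longrightarrow> \<phi> (x, t) = 0)"

definition C1c_QT :: "real \<Rightarrow> ((real^'d) \<times> real \<Rightarrow> 'b::euclidean_space) \<Rightarrow> bool" where
  "C1c_QT T \<psi> \<longleftrightarrow> C1_map \<psi> \<and> periodic_x \<psi> \<and>
     (\<exists>s<T. \<forall>x t. s \<le> t \<longrightarrow> \<psi> (x, t) = 0)"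

definition C1c_T :: "real \<Rightarrow> (real \<Rightarrow> real) \<Rightarrow> bool" where
  "C1c_T T \<theta> \<longleftrightarrow> C1_map \<theta> \<and> (\<exists>s<T. \<forall>t. s \<le> t \<longrightarrow> \<theta> t = 0)"

definition d_t :: "((real^'d) \<times> real \<Rightarrow> 'b::real_normed_vector) \<Rightarrow> (real^'d) \<times> real \<Rightarrow> 'b" where
  "d_t \<psi> z = frechet_derivative \<psi> (at z) (0, 1)"

definition d_x :: "'d \<Rightarrow> ((real^'d) \<times> real \<Rightarrow> 'b::real_normed_vector) \<Rightarrow> (real^'d) \<times> real \<Rightarrow> 'b" where
  "d_x \<alpha> \<psi> z = frechet_derivative \<psi> (at z) (axis \<alpha> 1, 0)"

definition young_measure :: "('a::euclidean_space) set \<Rightarrow> ('a \<Rightarrow> ('b::euclidean_space) measure) \<Rightarrow> bool" where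
  "young_measure S \<nu> \<longleftrightarrow>
     (\<forall>z\<in>S. prob_space (\<nu> z) \<and> sets (\<nu> z) = sets borel) \<and>
     (\<forall>g::'b \<Rightarrow> real. continuous_on UNIV g \<and> bounded (range g) \<longrightarrow>
        set_borel_measurable lborel S (\<lambda>z. \<integral>l. g l \<partial>(\<nu> z)))"

definition admissible :: "('n::euclidean_space \<Rightarrow> real) \<Rightarrow> ('n \<Rightarrow> real) \<Rightarrow> bool" where
  "admissible \<eta> g \<longleftrightarrow> continuous_on UNIV g \<and> ((\<lambda>l. g l / \<eta> l) \<longlongrightarrow> 0) at_infinity"

end

theory Submission
  imports Defs
begin

text \<open>The proof compares the two solutions through the relative entropy
  \<open>\<eta>(\<lambda>|u) = \<eta>(\<lambda>) - \<eta>(u) - D\<eta>(u)(\<lambda> - u)\<close>, which dominates \<open>|\<lambda> - u|\<^sup>2\<close> and, for bounded \<open>u\<close>, the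
  relative flux \<open>f(\<lambda>) - f(u) - Df(u)(\<lambda> - u)\<close>. The difference of the two weak formulations is
  tested with \<open>\<theta>(t) D\<eta>(v\<^sub>k)\<close>, where the \<open>v\<^sub>k\<close> are mollifications of the Lipschitz solution with the
  same Lipschitz constant. No almost everywhere differentiability is needed:
  \<open>\<partial>\<^sub>t v\<^sub>k + Df(v\<^sub>k) \<partial>\<^sub>x v\<^sub>k\<close> is uniformly bounded and tends to zero when integrated against smooth
  functions, hence against \<open>L\<^sup>1\<close> functions, and the symmetry of \<open>D\<^sup>2\<eta> Df\<close> turns the linear part of the
  flux into this residual. The concentration measure has a favourable sign when \<open>\<theta>\<close> is decreasing,
  and the choice \<open>\<theta>(t) = exp(-Kt) max(0, s - t)\<^sup>2\<close> replaces Gronwall's inequality.\<close>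

section \<open>Continuously differentiable maps\<close>

text \<open>Three obstacles shape the argument. The gradients of the \<open>v k\<close> are bounded
  but not known to converge, so their defect vanishes only weakly. It is paired with the difference
  between the mean of \<open>\<nu>\<close> and the Lipschitz solution, about which only
  integrability is used; hence the passage from smooth to L^1 densities, which rests on a bound
  uniform in \<open>k\<close>. Secondly, \<open>\<eta>\<close> is not an admissible integrand for
  Young measure convergence, so integrability of its mean is extracted from truncations. The
  cut-offs vanish before \<open>T\<close>, which gives bounds only on strips \<open>[0, s]\<close>
  with \<open>s < T\<close>; every estimate lives on such a strip and \<open>s\<close> tends to
  \<open>T\<close> at the end. Thirdly, the limit in \<open>k\<close> must be taken in an expression
  free of derivatives of \<open>v k\<close>: beforehand the spatial gradient is replaced by its
  Lipschitz bound, at the cost of a flux penalty. The weight in time is built so that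
  \<open>- \<theta>'\<close> exceeds \<open>K * \<theta>\<close> by a continuous function that is
  positive exactly before \<open>s\<close>. A nonnegative integrand with nonpositive integral then
  vanishes almost everywhere.\<close>

lemma C1_mapI:
  fixes g :: "'a::euclidean_space \<Rightarrow> 'b::real_normed_vector"
  assumes "\<And>x. (g has_derivative g' x) (at x)" "\<And>h. continuous_on UNIV (\<lambda>x. g' x h)"
  shows "C1_map g"
proof -
  have bl: "bounded_linear (g' x)" for x
    using assms(1) has_derivative_bounded_linear by blast
  \<comment> \<open>The domain is finite-dimensional, so continuity in operator norm can be checked
    one direction at a time.\<close>
  have "continuous_on UNIV (\<lambda>x. Blinfun (g' x))"
    by (rule continuous_on_blinfun_componentwise) (simp add: bounded_linear_Blinfun_apply[OF bl] assms(2))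
  then show ?thesis
    unfolding C1_map_def
    by (intro exI[of _ "\<lambda>x. Blinfun (g' x)"]) (simp add: bounded_linear_Blinfun_apply[OF bl] assms(1))
qed

lemma C1_map_has_derivative:
  assumes "C1_map g"
  shows "(g has_derivative frechet_derivative g (at x)) (at x)"
  using assms unfolding C1_map_def by (metis differentiableI frechet_derivative_works)

lemma C1_map_continuous_derivative:
  assumes "C1_map g"
  shows "continuous_on S (\<lambda>x. frechet_derivative g (at x) h)"
proof -
  obtain D where D: "\<And>x. (g has_derivative blinfun_apply (D x)) (at x)" "continuous_on UNIV D"
    using assms unfolding C1_map_def by blast
  have "frechet_derivative g (at x) = blinfun_apply (D x)" for x
    using D(1) frechet_derivative_at by metis
  moreover have "continuous_on S (\<lambda>x. blinfun_apply (D x) h)"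
    by (intro continuous_intros continuous_on_subset[OF D(2)]) auto
  ultimately show ?thesis by simp
qed

lemma C1_map_continuous:
  assumes "C1_map g"
  shows "continuous_on S g"
  using C1_map_has_derivative[OF assms]
  by (meson continuous_at_imp_continuous_on has_derivative_continuous)

lemma C1_map_const: "C1_map (\<lambda>x. c)"
  by (rule C1_mapI[where g' = "\<lambda>x h. 0"]) auto

lemma C1_map_bounded_linear:
  assumes "bounded_linear g" "C1_map h"
  shows "C1_map (\<lambda>x. g (h x))"
  by (rule C1_mapI[where g' = "\<lambda>x k. g (frechet_derivative h (at x) k)"])
     (auto intro!: bounded_linear.has_derivative[OF assms(1)] C1_map_has_derivative
       bounded_linear.continuous_on[OF assms(1)] C1_map_continuous_derivative assms(2))

lemma C1_map_id: "C1_map (\<lambda>x. x)"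
  by (rule C1_mapI[where g' = "\<lambda>x k. k"]) auto

lemma C1_map_linear: "bounded_linear g \<Longrightarrow> C1_map g"
  by (rule C1_map_bounded_linear[OF _ C1_map_id])

lemma C1_map_add:
  assumes "C1_map g" "C1_map h"
  shows "C1_map (\<lambda>x. g x + h x)"
  by (rule C1_mapI[where g' = "\<lambda>x k. frechet_derivative g (at x) k + frechet_derivative h (at x) k"])
     (auto intro!: has_derivative_add C1_map_has_derivative continuous_on_add
       C1_map_continuous_derivative assms)

lemma C1_map_sum:
  assumes "\<And>i. i \<in> I \<Longrightarrow> C1_map (g i)"
  shows "C1_map (\<lambda>x. \<Sum>i\<in>I. g i x)"
  using assms by (induction I rule: infinite_finite_induct) (auto intro: C1_map_const C1_map_add)

lemma C1_map_scaleR: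
  assumes "C1_map g" "C1_map h"
  shows "C1_map (\<lambda>x. g x *\<^sub>R h x)"
  by (rule C1_mapI[where g' = "\<lambda>x k. g x *\<^sub>R frechet_derivative h (at x) k + frechet_derivative g (at x) k *\<^sub>R h x"])
     (intro has_derivative_scaleR C1_map_has_derivative continuous_on_add continuous_on_scaleR
       C1_map_continuous C1_map_continuous_derivative assms)+

lemma C1_map_mult:
  fixes g h :: "'a::euclidean_space \<Rightarrow> real"
  assumes "C1_map g" "C1_map h"
  shows "C1_map (\<lambda>x. g x * h x)"
  using C1_map_scaleR[OF assms] by simp

lemma C1_map_prod:
  fixes g :: "'i \<Rightarrow> 'a::euclidean_space \<Rightarrow> real"
  assumes "\<And>i. i \<in> I \<Longrightarrow> C1_map (g i)"
  shows "C1_map (\<lambda>x. \<Prod>i\<in>I. g i x)"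
  using assms by (induction I rule: infinite_finite_induct) (auto intro: C1_map_const C1_map_mult)

lemma C1_map_compose:
  fixes g :: "'b::euclidean_space \<Rightarrow> 'c::real_normed_vector"
  assumes "C1_map g" "C1_map h"
  shows "C1_map (\<lambda>x. g (h x))"
proof -
  obtain D where D: "\<And>x. (g has_derivative blinfun_apply (D x)) (at x)" "continuous_on UNIV D"
    using assms(1) unfolding C1_map_def by blast
  show ?thesis
  proof (rule C1_mapI[where g' = "\<lambda>x k. blinfun_apply (D (h x)) (frechet_derivative h (at x) k)"])
    show "((\<lambda>x. g (h x)) has_derivative (\<lambda>k. blinfun_apply (D (h x)) (frechet_derivative h (at x) k))) (at x)" for x
      by (rule has_derivative_compose[OF C1_map_has_derivative[OF assms(2)] D(1)])
    show "continuous_on UNIV (\<lambda>x. blinfun_apply (D (h x)) (frechet_derivative h (at x) k))" for k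
      by (intro continuous_intros continuous_on_compose2[OF D(2) C1_map_continuous[OF assms(2)]]
          C1_map_continuous_derivative assms) auto
  qed
qed

lemma C1_map_vecI:
  fixes g :: "'a::euclidean_space \<Rightarrow> real^'n"
  assumes "\<And>i. C1_map (\<lambda>x. g x $ i)"
  shows "C1_map g"
proof -
  have eq: "g = (\<lambda>x. \<Sum>i\<in>UNIV. (g x $ i) *\<^sub>R axis i 1)"
    by (auto simp: vec_eq_iff axis_def if_distrib[of "\<lambda>a. _ * a"] cong: if_cong)
  show ?thesis
    by (subst eq) (intro C1_map_sum C1_map_scaleR assms C1_map_const)
qed

text \<open>Squaring removes the kink of the positive part at zero and leaves a C1 function. It is
  the source of all cut-offs: the mollifier, the periodic bumps and the weight in time.\<close>

definition posq :: "real \<Rightarrow> real" where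
  "posq y = (max 0 y)\<^sup>2"

lemma posq_nonneg [simp]: "0 \<le> posq y"
  by (simp add: posq_def)

lemma posq_pos_iff [simp]: "0 < posq y \<longleftrightarrow> 0 < y"
  by (auto simp: posq_def max_def)

lemma posq_eq_0_iff [simp]: "posq y = 0 \<longleftrightarrow> y \<le> 0"
  by (auto simp: posq_def max_def)

lemma posq_has_real_derivative: "(posq has_real_derivative 2 * max 0 y) (at y)"
proof (cases y "0::real" rule: linorder_cases)
  case less
  have "((\<lambda>y. 0) has_real_derivative 2 * max 0 y) (at y)"
    using less by simp
  then show ?thesis
    by (rule has_field_derivative_transform_within_open[of _ _ _ "{..<0}"]) (use less in auto)
next
  case equal
  have "((\<lambda>y. max 0 y) \<longlongrightarrow> max 0 0) (at (0::real))"
    by (intro tendsto_intros)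
  \<comment> \<open>Away from zero the difference quotient at zero is the positive part itself, so
    its limit is the value of a continuous function.\<close>
  moreover have "eventually (\<lambda>y::real. max 0 y = (posq y - posq 0) / (y - 0)) (at 0)"
    by (auto simp: eventually_at_filter posq_def max_def power2_eq_square)
  ultimately have "((\<lambda>y. (posq y - posq 0) / (y - 0)) \<longlongrightarrow> max 0 0) (at (0::real))"
    by (rule Lim_transform_eventually)
  then show ?thesis
    using equal by (simp add: has_field_derivative_iff)
next
  case greater
  have "((\<lambda>y. y\<^sup>2) has_real_derivative 2 * max 0 y) (at y)"
    using greater by (auto intro!: derivative_eq_intros)
  then show ?thesis
    by (rule has_field_derivative_transform_within_open[of _ _ _ "{0<..}"])
       (use greater in \<open>auto simp: posq_def\<close>)
qed

lemma C1_map_DERIV: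
  fixes g :: "real \<Rightarrow> real"
  assumes "\<And>x. (g has_real_derivative g' x) (at x)" "continuous_on UNIV g'"
  shows "C1_map g"
  by (rule C1_mapI[where g' = "\<lambda>x h. g' x * h"])
     (use assms in \<open>auto simp: has_field_derivative_def intro!: continuous_intros\<close>)

lemma C1_map_posq: "C1_map posq"
  by (rule C1_map_DERIV[OF posq_has_real_derivative]) (intro continuous_intros)

text \<open>The derivative along a sequence of steps, the form that dominated convergence requires
  later.\<close>

lemma has_derivative_difference_quotient:
  fixes g :: "'a::real_normed_vector \<Rightarrow> 'b::real_normed_vector"
  assumes g: "(g has_derivative g') (at x)" and e: "e \<longlonglongrightarrow> 0" "\<And>n. e n > (0::real)"
  shows "(\<lambda>n. (g (x + e n *\<^sub>R h) - g x) /\<^sub>R e n) \<longlonglongrightarrow> g' h"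
proof (cases "h = 0")
  case True
  then show ?thesis using has_derivative_bounded_linear[OF g] by (simp add: linear_simps)
next
  case False
  have bl: "bounded_linear g'" using g by (rule has_derivative_bounded_linear)
  have lim: "filterlim (\<lambda>n. e n *\<^sub>R h) (at 0) sequentially"
    unfolding filterlim_at
    using tendsto_scaleR[OF e(1) tendsto_const[of h]] e(2) False
    by (auto simp: less_imp_neq[THEN not_sym])
  have "(\<lambda>n. norm (g (x + e n *\<^sub>R h) - g x - g' (e n *\<^sub>R h)) / norm (e n *\<^sub>R h)) \<longlonglongrightarrow> 0"
    using filterlim_compose[OF _ lim, of "\<lambda>k. norm (g (x + k) - g x - g' k) / norm k"] g
    unfolding has_derivative_at by blast
  then have "(\<lambda>n. norm (g (x + e n *\<^sub>R h) - g x - g' (e n *\<^sub>R h)) / norm (e n *\<^sub>R h) * norm h) \<longlonglongrightarrow> 0"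
    by (rule tendsto_mult_left_zero)
  moreover have "norm (g (x + e n *\<^sub>R h) - g x - g' (e n *\<^sub>R h)) / norm (e n *\<^sub>R h) * norm h
     = norm ((g (x + e n *\<^sub>R h) - g x) /\<^sub>R e n - g' h)" for n
  proof -
    have "(g (x + e n *\<^sub>R h) - g x) /\<^sub>R e n - g' h
       = (g (x + e n *\<^sub>R h) - g x - g' (e n *\<^sub>R h)) /\<^sub>R e n"
      using e(2)[of n] by (simp add: linear_simps[OF bl] algebra_simps)
    then show ?thesis using e(2)[of n] False by (simp add: divide_simps)
  qed
  ultimately show ?thesis
    by (simp add: tendsto_norm_zero_iff LIM_zero_iff)
qed

lemma norm_derivative_le_lipschitz:
  fixes g :: "'a::real_normed_vector \<Rightarrow> 'b::real_normed_vector"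
  assumes g: "(g has_derivative g') (at x)" and L: "L-lipschitz_on UNIV g"
  shows "norm (g' h) \<le> L * norm h"
proof -
  define e where "e n = inverse (real (Suc n))" for n
  have e: "e \<longlonglongrightarrow> 0" unfolding e_def by (rule LIMSEQ_inverse_real_of_nat)
  have e0: "e n > 0" for n by (simp add: e_def)
  have "norm ((g (x + e n *\<^sub>R h) - g x) /\<^sub>R e n) \<le> L * norm h" for n
    using lipschitz_on_normD[OF L, of "x + e n *\<^sub>R h" x] e0[of n]
    by (simp add: divide_simps mult_ac flip: divide_inverse_commute)
  then show ?thesis
    by (intro Lim_norm_ubound[OF _ has_derivative_difference_quotient[OF g e e0]]) auto
qed

section \<open>Lipschitz maps and mollification\<close>

text \<open>For convolutions a single compact box contains the support of the integrand only while
  the point stays in a given ball, so differentiation under the integral is available ball by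
  ball.\<close>

lemma C1_map_local:
  fixes g :: "'a::euclidean_space \<Rightarrow> 'b::real_normed_vector"
  assumes "\<And>R. \<exists>D. (\<forall>z\<in>ball 0 R. (g has_derivative blinfun_apply (D z)) (at z)) \<and> continuous_on (ball 0 R) D"
  shows "C1_map g"
proof (rule C1_mapI)
  show "(g has_derivative frechet_derivative g (at x)) (at x)" for x
  proof -
    have "x \<in> ball 0 (norm x + 1)" by simp
    then show ?thesis
      using assms[of "norm x + 1"] by (metis differentiableI frechet_derivative_works)
  qed
  show "continuous_on UNIV (\<lambda>x. frechet_derivative g (at x) h)" for h
  proof (rule continuous_at_imp_continuous_on, rule ballI)
    fix x :: 'a
    let ?B = "ball (0::'a) (norm x + 1)"
    obtain D where D: "\<forall>z\<in>?B. (g has_derivative blinfun_apply (D z)) (at z)" "continuous_on ?B D"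
      using assms by blast
    have "continuous_on ?B (\<lambda>x. blinfun_apply (D x) h)"
      by (intro continuous_intros D(2))
    moreover have "blinfun_apply (D z) h = frechet_derivative g (at z) h" if "z \<in> ?B" for z
      using D(1) that frechet_derivative_at by metis
    ultimately have "continuous_on ?B (\<lambda>x. frechet_derivative g (at x) h)"
      by (rule continuous_on_eq)
    then show "continuous (at x) (\<lambda>x. frechet_derivative g (at x) h)"
      by (simp add: continuous_on_eq_continuous_at)
  qed
qed

text \<open>The normalised profile \<open>posq (\<delta>\<^sup>2 - w \<bullet> w)\<close> is as
  smooth as its use demands: a C1 kernel produces C1 convolutions.\<close>

lemma exists_C1_mollifier:
  assumes "\<delta> > (0::real)"
  obtains \<rho> :: "'a::euclidean_space \<Rightarrow> real" where
    "C1_map \<rho>" "\<And>w. 0 \<le> \<rho> w" "\<And>w. \<delta> \<le> norm w \<Longrightarrow> \<rho> w = 0"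
    "integrable lborel \<rho>" "(LBINT w. \<rho> w) = 1"
proof -
  define \<rho>0 where "\<rho>0 w = posq (\<delta>\<^sup>2 - w \<bullet> w)" for w :: 'a
  have "C1_map (\<lambda>w::'a. \<delta>\<^sup>2 - w \<bullet> w)"
    by (rule C1_mapI[where g' = "\<lambda>w h. - (w \<bullet> h + h \<bullet> w)"])
       (auto intro!: derivative_eq_intros continuous_intros)
  then have C1: "C1_map \<rho>0"
    unfolding \<rho>0_def by (rule C1_map_compose[OF C1_map_posq])
  have zero: "\<rho>0 w = 0" if "\<delta> \<le> norm w" for w
    using power_mono[OF that, of 2] assms by (simp add: \<rho>0_def power2_norm_eq_inner)
  have "integrable lborel (\<lambda>w. indicator (cball 0 \<delta>) w *\<^sub>R \<rho>0 w)"
    by (rule borel_integrable_compact[OF compact_cball C1_map_continuous[OF C1]])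
  moreover have "(\<lambda>w. indicator (cball 0 \<delta>) w *\<^sub>R \<rho>0 w) = \<rho>0"
    using zero by (auto simp: fun_eq_iff indicator_def)
  ultimately have int: "integrable lborel \<rho>0" by simp
  define c where "c = (LBINT w. \<rho>0 w)"
  \<comment> \<open>A nonnegative profile with integral zero would vanish almost everywhere, yet it
    is positive on an open ball.\<close>
  have "c \<noteq> 0"
  proof
    assume "c = 0"
    then have "AE w in lborel. \<rho>0 w = 0"
      using integral_nonneg_eq_0_iff_AE[OF int] by (simp add: c_def \<rho>0_def[abs_def])
    moreover have "\<rho>0 w \<noteq> 0" if "w \<in> ball 0 \<delta>" for w
      using power_strict_mono[of "norm w" \<delta> 2] that by (simp add: \<rho>0_def power2_norm_eq_inner)
    ultimately have "AE w in lborel. w \<notin> ball (0::'a) \<delta>"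
      by (auto elim!: eventually_mono)
    then have "ball (0::'a) \<delta> \<in> null_sets lborel"
      by (simp add: AE_iff_null_sets)
    then have "negligible (ball (0::'a) \<delta>)"
      by (simp add: negligible_iff_null_sets null_sets_completionI)
    then show False
      using open_not_negligible[of "ball (0::'a) \<delta>"] assms by auto
  qed
  moreover have "0 \<le> c" by (simp add: c_def \<rho>0_def)
  ultimately have "c > 0" by simp
  show thesis
  proof
    show "C1_map (\<lambda>w. \<rho>0 w * inverse c)"
      by (intro C1_map_mult C1 C1_map_const)
  qed (use \<open>c > 0\<close> zero int in \<open>auto simp: \<rho>0_def[abs_def] c_def\<close>)
qed

lemma norm_integral_le_integral:
  fixes f :: "'a \<Rightarrow> 'b::{banach, second_countable_topology}"
  assumes "integrable M f" "integrable M g" "\<And>x. norm (f x) \<le> g x"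
  shows "norm (integral\<^sup>L M f) \<le> integral\<^sup>L M g"
  by (rule order_trans[OF integral_norm_bound integral_mono]) (use assms in auto)

lemma lborel_integral_reflect:
  fixes f :: "'a::euclidean_space \<Rightarrow> 'b::euclidean_space"
  assumes [measurable]: "f \<in> borel_measurable borel"
  shows "(LBINT w. f (z - w)) = (LBINT w. f w)"
proof -
  have "lborel = distr lborel borel (\<lambda>w::'a. z - w)"
    using lborel_affine[of "-1" z] by (simp add: density_1)
  then have "(LBINT w. f w) = (\<integral>w. f w \<partial>distr lborel borel (\<lambda>w::'a. z - w))"
    by simp
  also have "\<dots> = (LBINT w. f (z - w))"
    by (rule integral_distr) auto
  finally show ?thesis ..
qed

text \<open>The derivative falls on the kernel, so continuity of \<open>u\<close> is enough. For
  \<open>z\<close> in the ball of radius \<open>R\<close> the integrand is supported in a box that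
  covers the ball of radius \<open>R + \<delta>\<close>, and Leibniz's rule applies there.\<close>

lemma C1_map_convolution:
  fixes u :: "'a::euclidean_space \<Rightarrow> 'b::euclidean_space"
  assumes \<rho>: "C1_map \<rho>" "\<And>w. \<delta> \<le> norm w \<Longrightarrow> \<rho> w = 0" and u: "continuous_on UNIV u"
  shows "C1_map (\<lambda>z. LBINT w. \<rho> (z - w) *\<^sub>R u w)" (is "C1_map ?g")
proof (rule C1_map_local)
  fix R :: real
  obtain a where a: "cball (0::'a) (R + \<delta>) \<subseteq> cbox (-a) a"
    using bounded_subset_cbox_symmetric[OF bounded_cball] by blast
  obtain D\<rho> where D: "\<And>x. (\<rho> has_derivative blinfun_apply (D\<rho> x)) (at x)" "continuous_on UNIV D\<rho>"
    using \<rho>(1) unfolding C1_map_def by blast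
  define F where "F z w = \<rho> (z - w) *\<^sub>R u w" for z w
  define DF where "DF z w = blinfun_scaleR_left (u w) o\<^sub>L D\<rho> (z - w)" for z w
  have F0: "F z w = 0" if "z \<in> ball 0 R" "w \<notin> cbox (-a) a" for z w
  proof -
    have "norm w > R + \<delta>" using that a by force
    then have "\<delta> \<le> norm (z - w)"
      using norm_triangle_ineq2[of w z] that(1) by (simp add: norm_minus_commute)
    then show ?thesis by (simp add: F_def \<rho>(2))
  qed
  have cont: "continuous_on S (F z)" for S z
    unfolding F_def
    by (intro continuous_intros continuous_on_compose2[OF C1_map_continuous[OF \<rho>(1), of UNIV]]
        continuous_on_subset[OF u]) auto
  have int: "integrable lborel (F z)" if "z \<in> ball 0 R" for z
  proof -
    have "integrable lborel (\<lambda>w. indicator (cbox (-a) a) w *\<^sub>R F z w)"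
      by (rule borel_integrable_compact[OF compact_cbox cont])
    moreover have "(\<lambda>w. indicator (cbox (-a) a) w *\<^sub>R F z w) = F z"
      using F0[OF that] by (auto simp: fun_eq_iff indicator_def)
    ultimately show ?thesis by simp
  qed
  have g: "?g z = integral (cbox (-a) a) (F z)" if "z \<in> ball 0 R" for z
  proof -
    have "?g z = integral UNIV (F z)"
      using integral_lborel[OF int[OF that]] by (simp add: F_def)
    also have "F z = (\<lambda>w. if w \<in> cbox (-a) a then F z w else 0)"
      using F0[OF that] by auto
    finally show ?thesis by (simp only: integral_restrict_UNIV)
  qed
  have contD: "continuous_on (ball 0 R \<times> cbox (-a) a) (\<lambda>(z, w). DF z w)"
    unfolding DF_def case_prod_beta
    by (intro continuous_intros continuous_on_compose2[OF D(2)] continuous_on_compose2[OF u]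
       bounded_linear.continuous_on[OF bounded_linear_blinfun_scaleR_left]) auto
  have der: "((\<lambda>z. integral (cbox (-a) a) (F z)) has_derivative integral (cbox (-a) a) (DF z0)) (at z0 within ball 0 R)"
    if "z0 \<in> ball 0 R" for z0
  proof (rule leibniz_rule[OF _ _ contD that])
    show "((\<lambda>z. F z w) has_derivative blinfun_apply (DF z w)) (at z within ball 0 R)" for z w
      unfolding F_def DF_def
      by (rule has_derivative_at_withinI)
         (auto intro!: derivative_eq_intros has_derivative_compose[OF _ D(1)])
    show "F z integrable_on cbox (-a) a" for z
      by (rule integrable_continuous[OF cont])
  qed auto
  have "(?g has_derivative blinfun_apply (integral (cbox (-a) a) (DF z))) (at z)" if z: "z \<in> ball 0 R" for z
  proof (rule has_derivative_transform_within_open[OF _ open_ball z])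
    show "((\<lambda>z. integral (cbox (-a) a) (F z)) has_derivative blinfun_apply (integral (cbox (-a) a) (DF z))) (at z)"
      using der[OF z] by (simp add: at_within_open[OF z open_ball])
  qed (simp add: g)
  then show "\<exists>D. (\<forall>z\<in>ball 0 R. (?g has_derivative blinfun_apply (D z)) (at z)) \<and> continuous_on (ball 0 R) D"
    by (intro exI[of _ "\<lambda>z. integral (cbox (-a) a) (DF z)"]) (auto intro!: integral_continuous_on_param contD)
qed

text \<open>\<open>g z\<close> is a weighted average of the values \<open>u (z - w)\<close> with
  \<open>norm w < \<delta>\<close>. Averages of translates keep the Lipschitz constant and all
  periods, and differ from \<open>u z\<close> by at most the oscillation of \<open>u\<close> over
  distance \<open>\<delta>\<close>.\<close>

lemma lipschitz_C1_approximation: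
  fixes u :: "'a::euclidean_space \<Rightarrow> 'b::euclidean_space"
  assumes u: "L-lipschitz_on UNIV u" and "\<delta> > 0"
  obtains g where "C1_map g" "L-lipschitz_on UNIV g" "\<And>z. norm (g z - u z) \<le> L * \<delta>"
    "\<And>z h. (\<And>z. u (z + h) = u z) \<Longrightarrow> g (z + h) = g z"
proof -
  obtain \<rho> :: "'a \<Rightarrow> real" where \<rho>:
    "C1_map \<rho>" "\<And>w. 0 \<le> \<rho> w" "\<And>w. \<delta> \<le> norm w \<Longrightarrow> \<rho> w = 0"
    "integrable lborel \<rho>" "(LBINT w. \<rho> w) = 1"
    using exists_C1_mollifier[OF assms(2)] by blast
  have L0: "0 \<le> L" using u by (rule lipschitz_on_nonneg)
  have uc: "continuous_on UNIV u"
    using u lipschitz_on_continuous_on by blast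
  define g where "g z = (LBINT w. \<rho> (z - w) *\<^sub>R u w)" for z
  have C1: "C1_map g"
    unfolding g_def by (rule C1_map_convolution[OF \<rho>(1,3) uc])
  have meas [measurable]: "\<rho> \<in> borel_measurable borel" "u \<in> borel_measurable borel"
    using C1_map_continuous[OF \<rho>(1)] uc by (auto intro: borel_measurable_continuous_onI)
  \<comment> \<open>The first form puts the variable into the kernel and gives smoothness; this one
    puts it into \<open>u\<close> and gives the estimates.\<close>
  have g2: "g z = (LBINT w. \<rho> w *\<^sub>R u (z - w))" for z
    unfolding g_def
    using lborel_integral_reflect[of "\<lambda>w. \<rho> w *\<^sub>R u (z - w)" z] by simp
  have int: "integrable lborel (\<lambda>w. \<rho> w *\<^sub>R u (z - w))" for z
  proof -
    have "integrable lborel (\<lambda>w. indicator (cball 0 \<delta>) w *\<^sub>R (\<rho> w *\<^sub>R u (z - w)))"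
      by (rule borel_integrable_compact[OF compact_cball])
         (intro continuous_intros C1_map_continuous[OF \<rho>(1)] continuous_on_compose2[OF uc], auto)
    moreover have "(\<lambda>w. indicator (cball 0 \<delta>) w *\<^sub>R (\<rho> w *\<^sub>R u (z - w))) = (\<lambda>w. \<rho> w *\<^sub>R u (z - w))"
      using \<rho>(3) linear by (auto simp: fun_eq_iff indicator_def)
    ultimately show ?thesis by simp
  qed
  show thesis
  proof
    show "C1_map g" by fact
    show "L-lipschitz_on UNIV g"
    proof (rule lipschitz_onI[OF _ L0])
      fix x y :: 'a
      have "g x - g y = (LBINT w. \<rho> w *\<^sub>R (u (x - w) - u (y - w)))"
        unfolding g2 by (simp add: scaleR_diff_right int)
      also have "norm \<dots> \<le> (LBINT w. \<rho> w * (L * dist x y))"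
      proof (rule norm_integral_le_integral)
        show "integrable lborel (\<lambda>w. \<rho> w *\<^sub>R (u (x - w) - u (y - w)))"
          by (simp add: scaleR_diff_right int)
        show "norm (\<rho> w *\<^sub>R (u (x - w) - u (y - w))) \<le> \<rho> w * (L * dist x y)" for w
          using \<rho>(2)[of w] lipschitz_onD[OF u, of "x - w" "y - w"]
          by (auto simp: dist_norm intro!: mult_left_mono)
      qed (simp add: \<rho>(4))
      finally show "dist (g x) (g y) \<le> L * dist x y" by (simp add: dist_norm \<rho>(5))
    qed
    show "norm (g z - u z) \<le> L * \<delta>" for z
    proof -
      have "g z - u z = (LBINT w. \<rho> w *\<^sub>R (u (z - w) - u z))"
        unfolding g2 by (simp add: scaleR_diff_right int \<rho>(4,5))
      also have "norm \<dots> \<le> (LBINT w. \<rho> w * (L * \<delta>))"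
      proof (rule norm_integral_le_integral)
        show "integrable lborel (\<lambda>w. \<rho> w *\<^sub>R (u (z - w) - u z))"
          by (simp add: scaleR_diff_right int \<rho>(4))
        show "norm (\<rho> w *\<^sub>R (u (z - w) - u z)) \<le> \<rho> w * (L * \<delta>)" for w
        proof (cases "\<delta> \<le> norm w")
          case False
          have "norm (u (z - w) - u z) \<le> L * norm w"
            using lipschitz_onD[OF u, of "z - w" z] by (simp add: dist_norm)
          also have "\<dots> \<le> L * \<delta>" using False L0 by (intro mult_left_mono) auto
          finally show ?thesis using \<rho>(2)[of w] by (auto intro!: mult_left_mono)
        qed (simp add: \<rho>(3))
      qed (simp add: \<rho>(4))
      finally show ?thesis by (simp add: \<rho>(5))
    qed
    show "g (z + h) = g z" if "\<And>z. u (z + h) = u z" for z h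
    proof -
      have "u (z + h - w) = u (z - w)" for w
        using that[of "z - w"] by (simp add: algebra_simps)
      then show ?thesis unfolding g2 by simp
    qed
  qed
qed

section \<open>Second derivatives and relative quantities\<close>

lemma has_real_derivative_along_line:
  fixes g :: "'a::real_normed_vector \<Rightarrow> real"
  assumes g: "(g has_derivative g') (at (x + s *\<^sub>R h))"
  shows "((\<lambda>s. g (x + s *\<^sub>R h)) has_real_derivative g' h) (at s)"
proof -
  have "((\<lambda>s. x + s *\<^sub>R h) has_derivative (\<lambda>s. s *\<^sub>R h)) (at s)"
    by (auto intro!: derivative_eq_intros)
  from has_derivative_compose[OF this g]
  show ?thesis
    by (simp add: has_field_derivative_def linear_simps[OF has_derivative_bounded_linear[OF g]] mult_commute_abs)
qed

text \<open>The mixed second difference is an increment along \<open>k\<close> of an increment along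
  \<open>h\<close>: the mean value theorem is applied first in the parameter of \<open>h\<close>,
  then in that of \<open>k\<close>.\<close>

lemma second_difference_mvt:
  fixes g :: "'a::real_normed_vector \<Rightarrow> real"
  assumes g: "\<And>x. (g has_derivative D x) (at x)"
    and D: "\<And>x. ((\<lambda>x. D x h) has_derivative D2 x) (at x)" and t: "t > 0"
  obtains s r where "0 < s" "s < t" "0 < r" "r < t"
    "g (x + t *\<^sub>R h + t *\<^sub>R k) - g (x + t *\<^sub>R h) - g (x + t *\<^sub>R k) + g x
      = t\<^sup>2 * D2 (x + s *\<^sub>R h + r *\<^sub>R k) k"
proof -
  have d1: "((\<lambda>s. g (y + s *\<^sub>R h)) has_real_derivative D (y + s *\<^sub>R h) h) (at s)" for y s
    by (rule has_real_derivative_along_line[OF g])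
  have d2: "((\<lambda>r. D (y + r *\<^sub>R k) h) has_real_derivative D2 (y + r *\<^sub>R k) k) (at r)" for y r
    by (rule has_real_derivative_along_line[OF D])
  obtain s where s: "0 < s" "s < t"
    "(g (x + t *\<^sub>R k + t *\<^sub>R h) - g (x + t *\<^sub>R h)) - (g (x + t *\<^sub>R k + 0 *\<^sub>R h) - g (x + 0 *\<^sub>R h))
       = (t - 0) * (D (x + t *\<^sub>R k + s *\<^sub>R h) h - D (x + s *\<^sub>R h) h)"
    using MVT2[OF t, of "\<lambda>s. g (x + t *\<^sub>R k + s *\<^sub>R h) - g (x + s *\<^sub>R h)"
        "\<lambda>s. D (x + t *\<^sub>R k + s *\<^sub>R h) h - D (x + s *\<^sub>R h) h"] DERIV_diff[OF d1 d1]
    by blast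
  obtain r where r: "0 < r" "r < t"
    "D (x + s *\<^sub>R h + t *\<^sub>R k) h - D (x + s *\<^sub>R h + 0 *\<^sub>R k) h = (t - 0) * D2 (x + s *\<^sub>R h + r *\<^sub>R k) k"
    using MVT2[OF t, of "\<lambda>r. D (x + s *\<^sub>R h + r *\<^sub>R k) h" "\<lambda>r. D2 (x + s *\<^sub>R h + r *\<^sub>R k) k"] d2
    by blast
  show thesis
    by (rule that[OF s(1,2) r(1,2)])
       (use s(3) r(3) in \<open>simp add: add_ac power2_eq_square algebra_simps\<close>)
qed

text \<open>The second difference does not see the order of \<open>h\<close> and \<open>k\<close>;
  divided by the squared step it tends to either mixed derivative, because the intermediate points
  shrink to \<open>x\<close>.\<close>

lemma second_derivative_symmetric_real:
  fixes g :: "'a::real_normed_vector \<Rightarrow> real"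
  assumes g: "\<And>x. (g has_derivative D x) (at x)"
    and D: "\<And>x h. ((\<lambda>x. D x h) has_derivative D2 x h) (at x)"
    and cont: "\<And>h k. continuous_on UNIV (\<lambda>x. D2 x h k)"
  shows "D2 x h k = D2 x k h"
proof -
  define e where "e n = inverse (real (Suc n))" for n
  have e: "e \<longlonglongrightarrow> 0" unfolding e_def by (rule LIMSEQ_inverse_real_of_nat)
  have e0: "e n > 0" for n by (simp add: e_def)
  define F where "F h k n = (g (x + e n *\<^sub>R h + e n *\<^sub>R k) - g (x + e n *\<^sub>R h) - g (x + e n *\<^sub>R k) + g x) / (e n)\<^sup>2" for h k n
  have F: "F h k \<longlonglongrightarrow> D2 x h k" for h k
  proof -
    have "\<exists>s r. 0 < s \<and> s < e n \<and> 0 < r \<and> r < e n \<and> F h k n = D2 (x + s *\<^sub>R h + r *\<^sub>R k) h k" for n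
    proof -
      obtain s r where "0 < s" "s < e n" "0 < r" "r < e n"
        "g (x + e n *\<^sub>R h + e n *\<^sub>R k) - g (x + e n *\<^sub>R h) - g (x + e n *\<^sub>R k) + g x
          = (e n)\<^sup>2 * D2 (x + s *\<^sub>R h + r *\<^sub>R k) h k"
        using second_difference_mvt[OF g D e0[of n]] by blast
      then show ?thesis
        using e0[of n] unfolding F_def by (intro exI[of _ s] exI[of _ r]) simp
    qed
    then obtain s r where sr: "\<And>n. 0 < s n \<and> s n < e n \<and> 0 < r n \<and> r n < e n \<and> F h k n = D2 (x + s n *\<^sub>R h + r n *\<^sub>R k) h k"
      by metis
    have "s \<longlonglongrightarrow> 0" "r \<longlonglongrightarrow> 0"
      using sr by (auto intro!: tendsto_sandwich[OF _ _ tendsto_const e] always_eventually less_imp_le)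
    then have "(\<lambda>n. x + s n *\<^sub>R h + r n *\<^sub>R k) \<longlonglongrightarrow> x + 0 *\<^sub>R h + 0 *\<^sub>R k"
      by (intro tendsto_intros)
    moreover have "isCont (\<lambda>x. D2 x h k) x" using cont[of h k] by (simp add: continuous_on_eq_continuous_at)
    ultimately have "(\<lambda>n. D2 (x + s n *\<^sub>R h + r n *\<^sub>R k) h k) \<longlonglongrightarrow> D2 x h k"
      using isCont_tendsto_compose by fastforce
    moreover have "F h k = (\<lambda>n. D2 (x + s n *\<^sub>R h + r n *\<^sub>R k) h k)" using sr by auto
    ultimately show ?thesis by simp
  qed
  have "F h k = F k h" unfolding F_def by (auto simp: fun_eq_iff algebra_simps)
  then show ?thesis using F[of h k] F[of k h] LIMSEQ_unique by metis
qed

lemma second_derivative_symmetric: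
  fixes g :: "'a::real_normed_vector \<Rightarrow> 'b::euclidean_space"
  assumes g: "\<And>x. (g has_derivative blinfun_apply (D x)) (at x)"
    and D: "\<And>x. (D has_derivative blinfun_apply (D2 x)) (at x)"
    and cont: "continuous_on UNIV D2"
  shows "blinfun_apply (blinfun_apply (D2 x) h) k = blinfun_apply (blinfun_apply (D2 x) k) h"
proof (rule euclidean_eqI)
  fix b :: 'b
  show "blinfun_apply (blinfun_apply (D2 x) h) k \<bullet> b = blinfun_apply (blinfun_apply (D2 x) k) h \<bullet> b"
  proof (rule second_derivative_symmetric_real[of "\<lambda>x. g x \<bullet> b" "\<lambda>x h. blinfun_apply (D x) h \<bullet> b"
          "\<lambda>x k h. blinfun_apply (blinfun_apply (D2 x) h) k \<bullet> b", symmetric])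
    show "((\<lambda>x. g x \<bullet> b) has_derivative (\<lambda>h. blinfun_apply (D x) h \<bullet> b)) (at x)" for x
      by (rule has_derivative_inner_left[OF g])
    show "((\<lambda>x. blinfun_apply (D x) h \<bullet> b) has_derivative (\<lambda>k. blinfun_apply (blinfun_apply (D2 x) k) h \<bullet> b)) (at x)" for x h
      by (rule has_derivative_inner_left[OF bounded_linear.has_derivative[OF blinfun.bounded_linear_left D]])
    show "continuous_on UNIV (\<lambda>x. blinfun_apply (blinfun_apply (D2 x) k) h \<bullet> b)" for h k
      by (intro continuous_on_inner continuous_on_const bounded_linear.continuous_on[OF blinfun.bounded_linear_left] cont)
  qed
qed

text \<open>Along the segment, subtract the tangent and the parabola
  \<open>c / 2 * (norm h)\<^sup>2 * s\<^sup>2\<close>. What is left has zero slope at the start and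
  nonnegative second derivative, so it does not decrease.\<close>

lemma quadratic_lower_bound_of_hessian:
  fixes g :: "'a::real_normed_vector \<Rightarrow> real"
  assumes g: "\<And>x. (g has_derivative blinfun_apply (D x)) (at x)"
    and D: "\<And>x. (D has_derivative blinfun_apply (D2 x)) (at x)"
    and H: "\<And>x h. c * (norm h)\<^sup>2 \<le> blinfun_apply (blinfun_apply (D2 x) h) h"
  shows "c / 2 * (norm (y - x))\<^sup>2 \<le> g y - g x - blinfun_apply (D x) (y - x)"
proof -
  define h where "h = y - x"
  define \<phi> where "\<phi> s = g (x + s *\<^sub>R h) - s * D x h - c / 2 * (norm h)\<^sup>2 * s\<^sup>2" for s
  define \<phi>' where "\<phi>' s = D (x + s *\<^sub>R h) h - D x h - c * (norm h)\<^sup>2 * s" for s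
  have Dh: "((\<lambda>x. blinfun_apply (D x) h) has_derivative (\<lambda>k. blinfun_apply (D2 x k) h)) (at x)" for x
    by (rule bounded_linear.has_derivative[OF blinfun.bounded_linear_left D])
  have d2: "(\<phi>' has_real_derivative D2 (x + s *\<^sub>R h) h h - c * (norm h)\<^sup>2) (at s)" for s
    unfolding \<phi>'_def
    by (rule derivative_eq_intros has_real_derivative_along_line[OF Dh] refl)+ simp
  have d1: "(\<phi> has_real_derivative \<phi>' s) (at s)" for s
    unfolding \<phi>_def \<phi>'_def
    by (rule derivative_eq_intros has_real_derivative_along_line[OF g] refl)+ simp
  have "0 \<le> \<phi>' s" if "0 \<le> s" for s
  proof -
    have "\<phi>' 0 \<le> \<phi>' s"
    proof (rule DERIV_nonneg_imp_nondecreasing[OF that])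
      fix r show "\<exists>l. (\<phi>' has_real_derivative l) (at r) \<and> 0 \<le> l"
        using d2[of r] H[of h "x + r *\<^sub>R h"] by (intro exI[of _ "D2 (x + r *\<^sub>R h) h h - c * (norm h)\<^sup>2"]) simp
    qed
    then show ?thesis by (simp add: \<phi>'_def)
  qed
  then have "\<phi> 0 \<le> \<phi> 1"
    using d1 by (intro DERIV_nonneg_imp_nondecreasing[of 0 1 \<phi>]) (simp, blast)
  then show ?thesis by (simp add: \<phi>_def h_def)
qed

section \<open>Relative flux against relative entropy\<close>

lemma continuous_on_bounded_cball:
  fixes g :: "'a::euclidean_space \<Rightarrow> 'b::real_normed_vector"
  assumes "continuous_on UNIV g"
  obtains B where "0 \<le> B" "\<And>x. norm x \<le> M \<Longrightarrow> norm (g x) \<le> B"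
proof -
  have "compact (g ` cball 0 M)"
    by (intro compact_continuous_image continuous_on_subset[OF assms]) auto
  then obtain B where "\<And>x. x \<in> cball 0 M \<Longrightarrow> norm (g x) \<le> B"
    using compact_imp_bounded bounded_iff by (metis imageI)
  then show thesis by (intro that[of "max 0 B"]) (auto simp: le_max_iff_disj)
qed

text \<open>Two regimes. Near \<open>x\<close> both sides are quadratic: Taylor's bound on the flux
  meets the lower bound \<open>quad\<close>. At distance at least one, the growth condition bounds
  the flux by the entropy, and terms linear in the distance are absorbed by its square. The
  constants depend on \<open>x\<close> only through the bound \<open>M\<close>.\<close>

lemma relative_flux_le_relative_entropy:
  fixes f :: "'a::euclidean_space \<Rightarrow> 'b::real_normed_vector" and \<eta> :: "'a \<Rightarrow> real"
  assumes f: "\<And>x. (f has_derivative blinfun_apply (Df x)) (at x)"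
    and Df: "\<And>x. (Df has_derivative blinfun_apply (D2f x)) (at x)"
    and D2f: "continuous_on UNIV D2f"
    and \<eta>: "continuous_on UNIV \<eta>" "continuous_on UNIV D\<eta>"
    and quad: "\<And>x y. c * (norm (y - x))\<^sup>2 \<le> \<eta> y - \<eta> x - blinfun_apply (D\<eta> x) (y - x)"
    and c: "c > 0"
    and growth: "\<And>y. norm (f y) \<le> B + \<eta> y"
  obtains K where "0 \<le> K" "\<And>x y. norm x \<le> M \<Longrightarrow>
    norm (f y - f x - blinfun_apply (Df x) (y - x)) \<le> K * (\<eta> y - \<eta> x - blinfun_apply (D\<eta> x) (y - x))"
proof -
  have cf: "continuous_on UNIV f" "continuous_on UNIV Df"
    by (auto intro!: continuous_at_imp_continuous_on has_derivative_continuous[OF f] has_derivative_continuous[OF Df])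
  \<comment> \<open>Radius \<open>M + 1\<close>, since the segment from \<open>x\<close> to a point
    at distance at most one stays in that ball.\<close>
  obtain b where b: "0 \<le> b" "\<And>x. norm x \<le> M + 1 \<Longrightarrow> norm (D2f x) \<le> b"
    using continuous_on_bounded_cball[OF D2f] by blast
  obtain a1 where a1: "0 \<le> a1" "\<And>x. norm x \<le> M \<Longrightarrow> norm (f x) \<le> a1"
    using continuous_on_bounded_cball[OF cf(1)] by blast
  obtain a2 where a2: "0 \<le> a2" "\<And>x. norm x \<le> M \<Longrightarrow> norm (Df x) \<le> a2"
    using continuous_on_bounded_cball[OF cf(2)] by blast
  obtain a3 where a3: "0 \<le> a3" "\<And>x. norm x \<le> M \<Longrightarrow> norm (\<eta> x) \<le> a3"
    using continuous_on_bounded_cball[OF \<eta>(1)] by blast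
  obtain a4 where a4: "0 \<le> a4" "\<And>x. norm x \<le> M \<Longrightarrow> norm (D\<eta> x) \<le> a4"
    using continuous_on_bounded_cball[OF \<eta>(2)] by blast
  \<comment> \<open>\<open>S\<close> gathers the constants of the far regime; \<open>K\<close> adds
    \<open>b / c\<close> from the near regime and \<open>1 + S / c\<close> from the far one, so that
    it serves both.\<close>
  define S where "S = \<bar>B\<bar> + a1 + a2 + a3 + a4"
  define K where "K = b / c + 1 + S / c"
  have S0: "0 \<le> S" unfolding S_def using a1 a2 a3 a4 by auto
  show thesis
  proof
    show "0 \<le> K" unfolding K_def using b S0 c by auto
    fix x y :: 'a assume x: "norm x \<le> M"
    let ?r = "\<eta> y - \<eta> x - D\<eta> x (y - x)" and ?d = "norm (y - x)"
    let ?f = "norm (f y - f x - Df x (y - x))"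
    have r: "c * ?d\<^sup>2 \<le> ?r" by (rule quad)
    have r0: "0 \<le> ?r" by (rule order_trans[OF _ r]) (use c in simp)
    have dr: "?d\<^sup>2 \<le> ?r / c" using r c by (simp add: pos_le_divide_eq mult.commute)
    consider "?d \<le> 1" | "1 \<le> ?d" by linarith
    then show "?f \<le> K * ?r"
    proof cases
      case 1
      have ball: "norm z \<le> M + 1" if "z \<in> closed_segment x y" for z
      proof -
        have "norm (z - x) \<le> ?d" using that segment_bound1 by (metis norm_minus_commute)
        then show ?thesis using x 1 norm_triangle_ineq2[of z x] by linarith
      qed
      have "norm (Df z - Df x) \<le> b * ?d" if z: "z \<in> closed_segment x y" for z
      proof -
        have "norm (Df z - Df x) \<le> b * norm (z - x)"
        proof (rule differentiable_bound[OF convex_closed_segment[of x y]])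
          show "(Df has_derivative blinfun_apply (D2f w)) (at w within closed_segment x y)" for w
            by (rule has_derivative_at_withinI[OF Df])
          show "onorm (blinfun_apply (D2f w)) \<le> b" if "w \<in> closed_segment x y" for w
            using b(2)[OF ball[OF that]] by (simp add: norm_blinfun.rep_eq)
        qed (use z in auto)
        also have "\<dots> \<le> b * ?d"
          using segment_bound1[of z x y] z b(1) by (intro mult_left_mono) (auto simp: norm_minus_commute)
        finally show ?thesis .
      qed
      then have on: "onorm (\<lambda>v. blinfun_apply (Df z) v - blinfun_apply (Df x) v) \<le> b * ?d"
        if "z \<in> closed_segment x y" for z
        using that by (simp add: norm_blinfun.rep_eq blinfun.diff_left[abs_def])
      \<comment> \<open>A Lipschitz bound on \<open>Df\<close> along the segment turns into a
        quadratic bound on the first-order Taylor remainder of \<open>f\<close>.\<close>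
      have "?f \<le> ?d * (b * ?d)"
      proof (rule differentiable_bound_linearization[where S = "closed_segment x y" and f = f and f' = "\<lambda>z. blinfun_apply (Df z)"])
        show "x + t *\<^sub>R (y - x) \<in> closed_segment x y" if "t \<in> {0..1}" for t
          using that by (auto simp: closed_segment_def algebra_simps intro!: exI[of _ t])
        show "(f has_derivative blinfun_apply (Df z)) (at z within closed_segment x y)" for z
          by (rule has_derivative_at_withinI[OF f])
        have "blinfun_apply (Df z) - blinfun_apply (Df x) = (\<lambda>v. blinfun_apply (Df z) v - blinfun_apply (Df x) v)" for z
          by (simp add: fun_eq_iff)
        then show "onorm (blinfun_apply (Df z) - blinfun_apply (Df x)) \<le> b * ?d" if "z \<in> closed_segment x y" for z
          using on[OF that] by simp
      qed simp
      also have "\<dots> = b * ?d\<^sup>2" by (simp add: power2_eq_square)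
      also have "\<dots> \<le> b * (?r / c)" using dr b by (intro mult_left_mono) auto
      also have "\<dots> \<le> K * ?r"
      proof -
        have "0 \<le> (1 + S / c) * ?r" using r0 c S0 by simp
        moreover have "K * ?r = b * (?r / c) + (1 + S / c) * ?r"
          unfolding K_def by (simp only: distrib_right times_divide_eq_left times_divide_eq_right add.assoc)
        ultimately show ?thesis by linarith
      qed
      finally show ?thesis .
    next
      case 2
      have n1: "norm (Df x (y - x)) \<le> a2 * ?d"
        by (rule order_trans[OF norm_blinfun mult_right_mono[OF a2(2)[OF x]]]) simp
      have n2: "\<bar>D\<eta> x (y - x)\<bar> \<le> a4 * ?d"
        using order_trans[OF norm_blinfun mult_right_mono[OF a4(2)[OF x]], of "y - x"] by simp
      have "?f \<le> norm (f y) + norm (f x) + norm (Df x (y - x))"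
        using norm_triangle_ineq4[of "f y - f x" "Df x (y - x)"] norm_triangle_ineq4[of "f y" "f x"]
        by simp
      \<comment> \<open>\<open>\<eta> y\<close> is rewritten as the relative entropy plus
        \<open>\<eta> x\<close> plus the linear term, which costs \<open>a3\<close> and
        \<open>a4 * ?d\<close>.\<close>
      also have "\<dots> \<le> \<bar>B\<bar> + a1 + a3 + ?r + (a2 + a4) * ?d"
        using growth[of y] a1(2)[OF x] a3(2)[OF x] n1 n2 unfolding distrib_right real_norm_def by linarith
      also have "\<dots> \<le> ?r + S * ?d"
      proof -
        have "(\<bar>B\<bar> + a1 + a3) * 1 \<le> (\<bar>B\<bar> + a1 + a3) * ?d"
          using 2 a1 a3 by (intro mult_left_mono) auto
        then show ?thesis unfolding S_def distrib_right mult_1_right by linarith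
      qed
      also have "\<dots> \<le> ?r + S * ?d\<^sup>2"
        using 2 S0 self_le_power[of ?d 2] by (intro add_left_mono mult_left_mono) auto
      also have "\<dots> \<le> ?r + S * (?r / c)"
        using dr S0 by (intro add_left_mono mult_left_mono) auto
      also have "\<dots> \<le> K * ?r"
      proof -
        have "0 \<le> b / c * ?r" using r0 c b by simp
        moreover have "K * ?r = b / c * ?r + (?r + S * (?r / c))"
          unfolding K_def by (simp only: distrib_right times_divide_eq_left times_divide_eq_right add.assoc mult_1)
        ultimately show ?thesis by linarith
      qed
      finally show ?thesis .
    qed
  qed
qed

section \<open>Integration over the torus\<close>

lemma lborel_integrable_translate:
  fixes f :: "'a::euclidean_space \<Rightarrow> 'b::euclidean_space"
  assumes "integrable lborel f"
  shows "integrable lborel (\<lambda>z. f (c + z))"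
proof -
  have "integrable (distr lborel borel ((+) c)) f"
    using assms by (simp add: lborel_distr_plus)
  then show ?thesis by (subst (asm) integrable_distr_eq) (use assms in auto)
qed

lemma lborel_integral_translate:
  fixes f :: "'a::euclidean_space \<Rightarrow> 'b::euclidean_space"
  assumes [measurable]: "f \<in> borel_measurable borel"
  shows "(LBINT z. f (c + z)) = (LBINT z. f z)"
proof -
  have "(LBINT z. f z) = (\<integral>z. f z \<partial>distr lborel borel ((+) c))"
    by (simp add: lborel_distr_plus)
  also have "\<dots> = (LBINT z. f (c + z))"
    by (rule integral_distr) auto
  finally show ?thesis ..
qed

lemma Qcell_borel [measurable]: "(Qcell :: (real^'d) set) \<in> sets borel"
  unfolding Qcell_def by measurable

lemma Qcell_strip_borel [measurable]:
  "A \<in> sets borel \<Longrightarrow> ((Qcell :: (real^'d) set) \<times> (A :: real set)) \<in> sets borel"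
  by (simp add: borel_Times)

lemma norm_Qcell_le:
  assumes "x \<in> (Qcell :: (real^'d) set)"
  shows "norm x \<le> 2 * pi * CARD('d)"
proof -
  have "norm x \<le> (\<Sum>i\<in>UNIV. \<bar>x $ i\<bar>)" by (rule norm_le_l1_cart)
  also have "\<dots> \<le> (\<Sum>i\<in>(UNIV::'d set). 2 * pi)"
    using assms by (intro sum_mono) (auto simp: Qcell_def less_imp_le)
  finally show ?thesis by (simp add: mult.commute)
qed

lemma Qcell_strip_bounded: "bounded ((Qcell :: (real^'d) set) \<times> {a..b::real})"
proof (rule bounded_Times)
  show "bounded (Qcell :: (real^'d) set)"
    using norm_Qcell_le by (auto simp: bounded_iff)
qed simp

lemma emeasure_Qcell_strip_finite: "emeasure lborel ((Qcell :: (real^'d) set) \<times> {a..b::real}) < \<infinity>"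
  using emeasure_bounded_finite[OF Qcell_strip_bounded] by (simp add: less_top)

text \<open>A shifted cell is again a fundamental cell: what leaves through one face re-enters, one
  period away, through the opposite face.\<close>

lemma Qcell_integral_shift:
  fixes g :: "(real^'d) \<times> real \<Rightarrow> real"
  assumes [measurable]: "g \<in> borel_measurable borel" and per: "periodic_x g"
    and int: "integrable lborel (\<lambda>z. indicator (Qcell \<times> UNIV) z * g z)"
    and h: "0 \<le> h" "h \<le> 2 * pi"
  shows "(LBINT z. indicator (Qcell \<times> UNIV) z * g (z + h *\<^sub>R (axis i 1, 0)))
       = (LBINT z. indicator (Qcell \<times> UNIV) z * g z)"
proof -
  define e :: "(real^'d) \<times> real" where "e = (axis i 1, 0)"
  define S where "S = (Qcell :: (real^'d) set) \<times> (UNIV :: real set)"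
  define A where "A = {z \<in> S. h \<le> fst z $ i}"
  define C where "C = {z \<in> S. fst z $ i < h}"
  have [measurable]: "S \<in> sets borel" unfolding S_def by measurable
  have [measurable]: "A \<in> sets borel" "C \<in> sets borel"
    unfolding A_def C_def borel_prod[symmetric] using \<open>S \<in> sets borel\<close> by (simp_all add: borel_prod[symmetric]) measurable
  have per': "g (z + (2 * pi) *\<^sub>R e) = g z" for z
  proof -
    have "(2 * pi) *\<^sub>R axis i 1 = (axis i (2 * pi) :: real^'d)" by (simp add: vec_eq_iff axis_def)
    then have "z + (2 * pi) *\<^sub>R e = (fst z + axis i (2 * pi), snd z)"
      unfolding e_def by (cases z) simp
    then show ?thesis using per by (simp add: periodic_x_def)
  qed
  have intA: "integrable lborel (\<lambda>z. indicator A z * g z)"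
    by (rule Bochner_Integration.integrable_bound[OF int], measurable)
       (auto simp: A_def S_def indicator_def)
  have intC: "integrable lborel (\<lambda>z. indicator C z * g z)"
    by (rule Bochner_Integration.integrable_bound[OF int], measurable)
       (auto simp: C_def S_def indicator_def)
  \<comment> \<open>In direction \<open>i\<close> the shifted cell covers
    \<open>[h, 2 * pi + h)\<close>. \<open>A\<close> is its part below \<open>2 * pi\<close>, and
    the remainder is \<open>C\<close> moved by one period.\<close>
  have split: "indicator S (z - h *\<^sub>R e) * g z = indicator A z * g z + indicator C (z - (2 * pi) *\<^sub>R e) * g (z - (2 * pi) *\<^sub>R e)" for z
  proof -
    have S: "z \<in> S \<longleftrightarrow> (\<forall>j. 0 \<le> fst z $ j \<and> fst z $ j < 2 * pi)" for z by (cases z) (simp add: S_def Qcell_def)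
    have fi: "fst e $ i = 1"
      by (simp add: e_def)
    have "indicator S (z - h *\<^sub>R e) = (indicator A z + indicator C (z - (2 * pi) *\<^sub>R e) :: real)"
    proof (cases "\<forall>j. j \<noteq> i \<longrightarrow> 0 \<le> fst z $ j \<and> fst z $ j < 2 * pi")
      case True
      then have "z - r *\<^sub>R e \<in> S \<longleftrightarrow> 0 \<le> fst z $ i - r \<and> fst z $ i - r < 2 * pi" for r
        unfolding S
      proof (intro iffI allI)
        fix j assume "0 \<le> fst z $ i - r \<and> fst z $ i - r < 2 * pi"
        then show "0 \<le> fst (z - r *\<^sub>R e) $ j \<and> fst (z - r *\<^sub>R e) $ j < 2 * pi"
          using True by (cases "j = i") (auto simp: e_def axis_def)
      qed (auto simp: e_def axis_def dest: spec[of _ i])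
      from this[of h] this[of "2 * pi"] this[of 0, simplified] show ?thesis
        using h by (auto simp: A_def C_def fi indicator_def)
    next
      case False
      then obtain j where j: "j \<noteq> i" "\<not> (0 \<le> fst z $ j \<and> fst z $ j < 2 * pi)" by blast
      then have "z - r *\<^sub>R e \<notin> S" for r
        unfolding S by (auto simp: e_def axis_def intro!: exI[of _ j])
      from this[of h] this[of "2 * pi"] this[of 0, simplified] show ?thesis
        by (auto simp: A_def C_def indicator_def)
    qed
    then show ?thesis using per'[of "z - (2 * pi) *\<^sub>R e"] by (simp add: distrib_right)
  qed
  have "(LBINT z. indicator S z * g (z + h *\<^sub>R e)) = (LBINT z. indicator S (z - h *\<^sub>R e) * g z)"
    using lborel_integral_translate[of "\<lambda>z. indicator S (z - h *\<^sub>R e) * g z" "h *\<^sub>R e"]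
    by (simp add: add.commute)
  also have "\<dots> = (LBINT z. indicator A z * g z + indicator C (z - (2 * pi) *\<^sub>R e) * g (z - (2 * pi) *\<^sub>R e))"
    by (simp only: split)
  also have "\<dots> = (LBINT z. indicator A z * g z) + (LBINT z. indicator C (z - (2 * pi) *\<^sub>R e) * g (z - (2 * pi) *\<^sub>R e))"
    using lborel_integrable_translate[OF intC, of "- (2 * pi) *\<^sub>R e"]
    by (intro Bochner_Integration.integral_add intA) simp
  also have "(LBINT z. indicator C (z - (2 * pi) *\<^sub>R e) * g (z - (2 * pi) *\<^sub>R e)) = (LBINT z. indicator C z * g z)"
    using lborel_integral_translate[of "\<lambda>z. indicator C z * g z" "- (2 * pi) *\<^sub>R e"] by simp
  also have "(LBINT z. indicator A z * g z) + (LBINT z. indicator C z * g z) = (LBINT z. indicator A z * g z + indicator C z * g z)"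
    by (rule Bochner_Integration.integral_add[OF intA intC, symmetric])
  also have "\<dots> = (LBINT z. indicator S z * g z)"
    by (rule Bochner_Integration.integral_cong) (auto simp: A_def C_def indicator_def)
  finally show ?thesis unfolding S_def e_def .
qed

text \<open>Translation along \<open>e\<close> leaves the integral of \<open>w\<close> unchanged, by
  periodicity in space and by integration over all times in the time direction. Hence all difference
  quotients have integral zero, and dominated convergence passes this on to the derivative.\<close>

lemma torus_integral_derivative_eq_0:
  fixes w :: "(real^'d) \<times> real \<Rightarrow> real"
  assumes w: "C1_map w" and per: "periodic_x w" and supp: "\<And>x t. t \<notin> {0..s} \<Longrightarrow> w (x, t) = 0"
    and e: "e = (axis i 1, 0) \<or> e = (0, 1)"
  shows "(LINT z:Qcell \<times> UNIV|lborel. frechet_derivative w (at z) e) = 0"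
proof -
  define S where "S = (Qcell :: (real^'d) set) \<times> (UNIV :: real set)"
  \<comment> \<open>Steps have length at most one, so enlarging the support in time by one on either
    side accommodates every difference quotient.\<close>
  define S1 where "S1 = (Qcell :: (real^'d) set) \<times> {-1..s + 1}"
  have [measurable]: "S \<in> sets borel" "S1 \<in> sets borel" unfolding S_def S1_def by measurable
  have norm_e: "norm e = 1" using e by (auto simp: norm_Pair)
  have cw: "continuous_on UNIV w" using w by (rule C1_map_continuous)
  then have [measurable]: "w \<in> borel_measurable borel" by (rule borel_measurable_continuous_onI)
  obtain R where R: "\<And>z. z \<in> S1 \<Longrightarrow> norm z \<le> R"
    using Qcell_strip_bounded[of "-1" "s + 1"] unfolding bounded_iff S1_def by blast
  obtain B where B: "0 \<le> B" "\<And>z. norm z \<le> R + 1 \<Longrightarrow> norm (frechet_derivative w (at z) e) \<le> B"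
    using continuous_on_bounded_cball[OF C1_map_continuous_derivative[OF w]] by blast
  obtain Bw where Bw: "0 \<le> Bw" "\<And>z. norm z \<le> R + 1 \<Longrightarrow> norm (w z) \<le> Bw"
    using continuous_on_bounded_cball[OF cw] by blast
  have w0: "w z = 0" if "snd z \<notin> {0..s}" for z using supp that by (cases z) auto
  have S1_int: "integrable lborel (\<lambda>z. indicator S1 z * c)" for c :: real
    using emeasure_Qcell_strip_finite[of "-1" "s + 1", where 'd = 'd] by (simp add: S1_def)
  have int: "integrable lborel (\<lambda>z. indicator S z * w z)"
  proof (rule Bochner_Integration.integrable_bound[OF S1_int[of Bw]])
    show "AE z in lborel. norm (indicator S z * w z) \<le> norm (indicator S1 z * Bw)"
    proof (rule AE_I2)
      fix z
      show "norm (indicator S z * w z) \<le> norm (indicator S1 z * Bw)"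
        using w0[of z] Bw R[of z] by (cases z) (auto simp: S_def S1_def indicator_def)
    qed
  qed simp
  have shift: "(LBINT z. indicator S z * w (z + h *\<^sub>R e)) = (LBINT z. indicator S z * w z)"
    if h: "0 \<le> h" "h \<le> 2 * pi" for h
    using e
  proof
    assume "e = (axis i 1, 0)"
    then show ?thesis
      using Qcell_integral_shift[OF _ per _ h] int by (simp add: S_def)
  next
    assume e: "e = (0, 1)"
    have "indicator S (h *\<^sub>R e + z) = (indicator S z :: real)" for z
      by (cases z) (auto simp: S_def e indicator_def)
    then show ?thesis
      using lborel_integral_translate[of "\<lambda>z. indicator S z * w z" "h *\<^sub>R e"] by (simp add: add.commute)
  qed
  define \<epsilon> where "\<epsilon> n = inverse (real (Suc n))" for n
  have \<epsilon>: "\<epsilon> \<longlonglongrightarrow> 0" unfolding \<epsilon>_def by (rule LIMSEQ_inverse_real_of_nat)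
  have \<epsilon>0: "0 < \<epsilon> n" and \<epsilon>1: "\<epsilon> n \<le> 1" for n by (simp_all add: \<epsilon>_def inverse_le_1_iff)
  define Q where "Q n z = indicator S z * ((w (z + \<epsilon> n *\<^sub>R e) - w z) /\<^sub>R \<epsilon> n)" for n z
  have "(\<lambda>n. LBINT z. Q n z) \<longlonglongrightarrow> (LBINT z. indicator S z * frechet_derivative w (at z) e)"
  proof (rule integral_dominated_convergence[where w = "\<lambda>z. indicator S1 z * B"])
    show "(\<lambda>z. indicator S z * frechet_derivative w (at z) e) \<in> borel_measurable lborel"
      using borel_measurable_continuous_onI[OF C1_map_continuous_derivative[OF w]] by measurable
    show "Q n \<in> borel_measurable lborel" for n unfolding Q_def by measurable
    show "AE z in lborel. (\<lambda>n. Q n z) \<longlonglongrightarrow> indicator S z * frechet_derivative w (at z) e"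
      unfolding Q_def
      by (intro AE_I2 tendsto_mult_left has_derivative_difference_quotient C1_map_has_derivative w \<epsilon> \<epsilon>0)
    show "AE z in lborel. norm (Q n z) \<le> indicator S1 z * B" for n
    proof (rule AE_I2)
      fix z :: "(real^'d) \<times> real"
      consider "z \<in> S1" | "z \<notin> S" | "z \<in> S" "snd z \<notin> {-1..s + 1}"
        by (cases z) (auto simp: S_def S1_def)
      then show "norm (Q n z) \<le> indicator S1 z * B"
      proof cases
        case 1
        \<comment> \<open>The quotient equals a derivative at an intermediate point at most one unit
          away, which makes the bound independent of \<open>n\<close>.\<close>
        obtain r where r: "0 < r" "r < \<epsilon> n"
          "w (z + \<epsilon> n *\<^sub>R e) - w (z + 0 *\<^sub>R e) = (\<epsilon> n - 0) * frechet_derivative w (at (z + r *\<^sub>R e)) e"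
          using MVT2[OF \<epsilon>0[of n], of "\<lambda>r. w (z + r *\<^sub>R e)" "\<lambda>r. frechet_derivative w (at (z + r *\<^sub>R e)) e"]
            has_real_derivative_along_line[OF C1_map_has_derivative[OF w]] by blast
        have "norm (z + r *\<^sub>R e) \<le> R + 1"
          using norm_triangle_ineq[of z "r *\<^sub>R e"] R[OF 1] r \<epsilon>1[of n] norm_e by simp
        moreover have "(w (z + \<epsilon> n *\<^sub>R e) - w z) /\<^sub>R \<epsilon> n = frechet_derivative w (at (z + r *\<^sub>R e)) e"
          using r(3) \<epsilon>0[of n] by simp
        ultimately show ?thesis
          using B 1 by (simp add: Q_def indicator_def)
      next
        case 2
        then show ?thesis using B(1) by (simp add: Q_def)
      next
        case 3
        have "snd (z + \<epsilon> n *\<^sub>R e) \<notin> {0..s}" "snd z \<notin> {0..s}"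
          using 3 e \<epsilon>0[of n] \<epsilon>1[of n] by auto
        then show ?thesis using B(1) by (simp add: Q_def w0)
      qed
    qed
    show "integrable lborel (\<lambda>z. indicator S1 z * B)" by (rule S1_int)
  qed
  moreover have "(LBINT z. Q n z) = 0" for n
  proof -
    have h: "0 \<le> \<epsilon> n" "\<epsilon> n \<le> 2 * pi" using \<epsilon>0[of n] \<epsilon>1[of n] pi_gt3 by auto
    have int2: "integrable lborel (\<lambda>z. indicator S z * w (z + \<epsilon> n *\<^sub>R e))"
    proof (rule Bochner_Integration.integrable_bound[OF S1_int[of Bw]])
      show "AE z in lborel. norm (indicator S z * w (z + \<epsilon> n *\<^sub>R e)) \<le> norm (indicator S1 z * Bw)"
      proof (rule AE_I2)
        fix z :: "(real^'d) \<times> real"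
        show "norm (indicator S z * w (z + \<epsilon> n *\<^sub>R e)) \<le> norm (indicator S1 z * Bw)"
        proof (cases "z \<in> S1")
          case True
          have "norm (z + \<epsilon> n *\<^sub>R e) \<le> R + 1"
            using norm_triangle_ineq[of z "\<epsilon> n *\<^sub>R e"] R[OF True] \<epsilon>0[of n] \<epsilon>1[of n] norm_e by simp
          then show ?thesis using True Bw by (auto simp: indicator_def)
        next
          case False
          then have "z \<notin> S \<or> snd (z + \<epsilon> n *\<^sub>R e) \<notin> {0..s}"
            using e \<epsilon>0[of n] \<epsilon>1[of n] by (cases z) (auto simp: S_def S1_def)
          then show ?thesis
          proof
            assume "snd (z + \<epsilon> n *\<^sub>R e) \<notin> {0..s}"
            from w0[OF this] show ?thesis by simp
          qed simp
        qed
      qed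
    qed simp
    have "(LBINT z. Q n z) = (LBINT z. (indicator S z * w (z + \<epsilon> n *\<^sub>R e) - indicator S z * w z) / \<epsilon> n)"
      by (rule Bochner_Integration.integral_cong) (auto simp: Q_def field_simps)
    also have "\<dots> = 0"
      using int int2 shift[OF h] by simp
    finally show ?thesis .
  qed
  ultimately have "(LBINT z. indicator S z * frechet_derivative w (at z) e) = 0"
    by (simp add: LIMSEQ_const_iff)
  then show ?thesis by (simp add: set_lebesgue_integral_def S_def)
qed

section \<open>Weak convergence tested against periodic bumps\<close>

text \<open>On the circle, the cosine of the angle to the midpoint exceeds its value at the
  endpoints exactly on the open arc from \<open>a\<close> to \<open>b\<close>. Periodicity is
  inherited from the cosine.\<close>

definition cos_bump :: "real \<Rightarrow> real \<Rightarrow> real \<Rightarrow> real" where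
  "cos_bump a b y = posq (cos (y - (a + b) / 2) - cos ((b - a) / 2))"

lemma cos_bump_pos_iff:
  assumes "0 \<le> a" "a < b" "b \<le> 2 * pi" "0 \<le> y" "y \<le> 2 * pi"
  shows "0 < cos_bump a b y \<longleftrightarrow> a < y \<and> y < b"
proof -
  define d where "d = \<bar>y - (a + b) / 2\<bar>"
  define \<rho> where "\<rho> = (b - a) / 2"
  have \<rho>: "0 < \<rho>" "\<rho> \<le> pi" using assms by (auto simp: \<rho>_def)
  have d: "0 \<le> d" "d \<le> 2 * pi - \<rho>" using assms by (auto simp: d_def \<rho>_def abs_le_iff field_simps)
  have "cos \<rho> < cos d \<longleftrightarrow> d < \<rho>"
  proof (cases "d \<le> pi")
    case True
    then show ?thesis
      using cos_monotone_0_pi[of d \<rho>] cos_monotone_0_pi_le[of \<rho> d] d(1) \<rho> by linarith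
  next
    case False
    \<comment> \<open>Beyond \<open>pi\<close> the angle is reflected; the bound
      \<open>d \<le> 2 * pi - \<rho>\<close> keeps the reflected angle at least
      \<open>\<rho>\<close>.\<close>
    have "cos d = cos (2 * pi - d)" by (simp add: cos_diff)
    also have "\<dots> \<le> cos \<rho>" using False d \<rho> by (intro cos_monotone_0_pi_le) auto
    finally show ?thesis using False \<rho> by auto
  qed
  moreover have "cos (y - (a + b) / 2) = cos d" by (simp add: d_def)
  moreover have "d < \<rho> \<longleftrightarrow> a < y \<and> y < b"
    by (auto simp: d_def \<rho>_def abs_less_iff field_simps)
  ultimately show ?thesis unfolding cos_bump_def by (simp add: \<rho>_def)
qed

lemma C1_map_cos_bump: "C1_map (cos_bump a b)"
  unfolding cos_bump_def
proof (rule C1_map_compose[OF C1_map_posq])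
  show "C1_map (\<lambda>y. cos (y - (a + b) / 2) - cos ((b - a) / 2))"
    by (rule C1_map_DERIV[where g' = "\<lambda>y. - sin (y - (a + b) / 2)"])
       (auto intro!: derivative_eq_intros continuous_intros)
qed

lemma cos_bump_periodic: "cos_bump a b (y + 2 * pi) = cos_bump a b y"
  using cos_periodic[of "y - (a + b) / 2"] by (simp add: cos_bump_def algebra_simps)

definition box_bump :: "(real^'d) \<Rightarrow> (real^'d) \<Rightarrow> real \<Rightarrow> real \<Rightarrow> (real^'d) \<times> real \<Rightarrow> real" where
  "box_bump a b \<alpha> \<beta> z =
     posq (snd z - \<alpha>) * posq (\<beta> - snd z) * (\<Prod>i\<in>UNIV. cos_bump (a $ i) (b $ i) (fst z $ i))"

lemma C1_map_box_bump:
  fixes a b :: "real^'d"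
  shows "C1_map (box_bump a b \<alpha> \<beta>)"
proof -
  have "C1_map (\<lambda>z :: (real^'d) \<times> real. fst z $ i)" for i
    by (rule C1_map_linear[OF bounded_linear_compose[OF bounded_linear_vec_nth bounded_linear_fst]])
  moreover have "C1_map (\<lambda>z :: (real^'d) \<times> real. snd z - \<alpha>)" "C1_map (\<lambda>z :: (real^'d) \<times> real. \<beta> - snd z)"
    by (rule C1_mapI[where g' = "\<lambda>z h. snd h"] C1_mapI[where g' = "\<lambda>z h. - snd h"],
        auto intro!: derivative_eq_intros)+
  ultimately show ?thesis
    unfolding box_bump_def
    by (intro C1_map_mult C1_map_prod C1_map_compose[OF C1_map_posq] C1_map_compose[OF C1_map_cos_bump])
qed

lemma box_bump_nonneg: "0 \<le> box_bump a b \<alpha> \<beta> z"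
  unfolding box_bump_def by (intro mult_nonneg_nonneg prod_nonneg) (auto simp: cos_bump_def)

lemma periodic_box_bump:
  fixes a b :: "real^'d"
  shows "periodic_x (box_bump a b \<alpha> \<beta>)"
  unfolding periodic_x_def
proof (intro allI)
  fix x :: "real^'d" and t :: real and i :: 'd
  have "cos_bump (a $ j) (b $ j) ((x + axis i (2 * pi)) $ j) = cos_bump (a $ j) (b $ j) (x $ j)" for j :: 'd
    using cos_bump_periodic by (simp add: axis_def)
  then show "box_bump a b \<alpha> \<beta> (x + axis i (2 * pi), t) = box_bump a b \<alpha> \<beta> (x, t)"
    by (simp add: box_bump_def)
qed

lemma box_bump_pos_iff:
  fixes a b :: "real^'d"
  assumes "x \<in> Qcell" "\<And>i. 0 \<le> a $ i \<and> a $ i < b $ i \<and> b $ i \<le> 2 * pi"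
  shows "0 < box_bump a b \<alpha> \<beta> (x, t) \<longleftrightarrow> (\<forall>i. a $ i < x $ i \<and> x $ i < b $ i) \<and> \<alpha> < t \<and> t < \<beta>"
proof -
  have pos: "0 < cos_bump (a $ i) (b $ i) (x $ i) \<longleftrightarrow> a $ i < x $ i \<and> x $ i < b $ i" for i
    using assms by (intro cos_bump_pos_iff) (auto simp: Qcell_def less_imp_le)
  have nn: "0 \<le> cos_bump (a $ i) (b $ i) (x $ i)" for i by (simp add: cos_bump_def)
  have "0 < (\<Prod>i\<in>UNIV. cos_bump (a $ i) (b $ i) (x $ i)) \<longleftrightarrow> (\<forall>i. 0 < cos_bump (a $ i) (b $ i) (x $ i))"
  proof
    assume *: "0 < (\<Prod>i\<in>UNIV. cos_bump (a $ i) (b $ i) (x $ i))"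
    have "cos_bump (a $ i) (b $ i) (x $ i) \<noteq> 0" for i
    proof
      assume "cos_bump (a $ i) (b $ i) (x $ i) = 0"
      then have "(\<Prod>i\<in>UNIV. cos_bump (a $ i) (b $ i) (x $ i)) = 0" by (intro prod_zero) auto
      from *[unfolded this] show False by simp
    qed
    then show "\<forall>i. 0 < cos_bump (a $ i) (b $ i) (x $ i)"
      using nn by (simp add: less_le)
  qed (simp add: prod_pos)
  moreover have "0 \<le> (\<Prod>i\<in>UNIV. cos_bump (a $ i) (b $ i) (x $ i))" by (intro prod_nonneg nn)
  ultimately show ?thesis
    unfolding box_bump_def using pos by (auto simp: zero_less_mult_iff not_less[THEN iffD2, OF posq_nonneg])
qed

text \<open>Because the \<open>r k\<close> are uniformly bounded, replacing \<open>f\<close> by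
  \<open>s j\<close> changes the integral by at most a multiple of the L^1 distance, uniformly in
  \<open>k\<close>. So \<open>j\<close> can be fixed first and \<open>k\<close> sent to infinity
  afterwards.\<close>

lemma weak_null_closed:
  fixes r :: "nat \<Rightarrow> 'a::euclidean_space \<Rightarrow> real"
  assumes [measurable]: "\<And>k. r k \<in> borel_measurable lborel"
    and r: "\<And>k z. \<bar>r k z\<bar> \<le> K"
    and s: "\<And>j. integrable lborel (s j)" "\<And>j. (\<lambda>k. LBINT z. r k z * s j z) \<longlonglongrightarrow> 0"
    and lim: "AE z in lborel. (\<lambda>j. s j z) \<longlonglongrightarrow> f z"
    and dom: "integrable lborel g" "\<And>j. AE z in lborel. \<bar>s j z\<bar> \<le> g z"
    and f[measurable]: "f \<in> borel_measurable lborel"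
  shows "(\<lambda>k. LBINT z. r k z * f z) \<longlonglongrightarrow> 0"
proof (rule LIMSEQ_I)
  fix \<epsilon> :: real assume \<epsilon>: "0 < \<epsilon>"
  have K: "0 \<le> K" using r[of 0 0] by (meson abs_ge_zero order_trans)
  note [measurable] = borel_measurable_integrable[OF s(1)] borel_measurable_integrable[OF dom(1)]
  have fint: "integrable lborel f"
    by (rule integrable_dominated_convergence[OF f _ dom(1) lim]) (use dom(2) in auto)
  have "AE z in lborel. \<forall>j. \<bar>s j z\<bar> \<le> g z" using dom(2) by (simp add: AE_all_countable)
  then have fg: "AE z in lborel. \<bar>f z\<bar> \<le> g z"
    using lim by eventually_elim (rule LIMSEQ_le_const2[OF tendsto_rabs], auto)
  have "(\<lambda>j. LBINT z. \<bar>s j z - f z\<bar>) \<longlonglongrightarrow> (\<integral>z. 0 \<partial>(lborel :: 'a measure))"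
  proof (rule integral_dominated_convergence[where w = "\<lambda>z. 2 * g z"])
    show "AE z in lborel. (\<lambda>j. \<bar>s j z - f z\<bar>) \<longlonglongrightarrow> 0"
      using lim by eventually_elim (simp add: tendsto_rabs_zero_iff LIM_zero)
    show "AE z in lborel. norm \<bar>s j z - f z\<bar> \<le> 2 * g z" for j
      using fg dom(2)[of j] by eventually_elim auto
  qed (use dom(1) in auto)
  then have "(\<lambda>j. (K + 1) * (LBINT z. \<bar>s j z - f z\<bar>)) \<longlonglongrightarrow> (K + 1) * 0"
    by (intro tendsto_mult_left) simp
  then have "eventually (\<lambda>j. (K + 1) * (LBINT z. \<bar>s j z - f z\<bar>) < \<epsilon> / 2) sequentially"
    by (rule order_tendstoD) (use \<epsilon> in simp)
  then obtain j where j: "(K + 1) * (LBINT z. \<bar>s j z - f z\<bar>) < \<epsilon> / 2"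
    using eventually_happens'[OF sequentially_bot] by blast
  obtain N where N: "\<And>k. N \<le> k \<Longrightarrow> \<bar>LBINT z. r k z * s j z\<bar> < \<epsilon> / 2"
    using LIMSEQ_D[OF s(2)[of j], of "\<epsilon> / 2"] \<epsilon> by auto
  have ri: "integrable lborel (\<lambda>z. r k z * h z)" if "integrable lborel h" for h k
  proof (rule Bochner_Integration.integrable_bound[where f = "\<lambda>z. K * h z"])
    show "AE z in lborel. norm (r k z * h z) \<le> norm (K * h z)"
      using r K by (auto simp: abs_mult intro!: mult_right_mono)
  qed (use that borel_measurable_integrable[OF that] in auto)
  have "norm ((LBINT z. r k z * f z) - 0) < \<epsilon>" if k: "N \<le> k" for k
  proof -
    have "(LBINT z. r k z * s j z) - (LBINT z. r k z * f z) = (LBINT z. r k z * (s j z - f z))"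
      using ri[OF s(1), of k j] ri[OF fint, of k] by (simp add: right_diff_distrib)
    moreover have "\<bar>LBINT z. r k z * (s j z - f z)\<bar> \<le> (LBINT z. (K + 1) * \<bar>s j z - f z\<bar>)"
    proof -
      have "norm (LBINT z. r k z * (s j z - f z)) \<le> (LBINT z. (K + 1) * \<bar>s j z - f z\<bar>)"
      proof (rule norm_integral_le_integral)
        show "norm (r k z * (s j z - f z)) \<le> (K + 1) * \<bar>s j z - f z\<bar>" for z
          unfolding real_norm_def abs_mult using r[of k z] by (intro mult_right_mono) auto
      qed (use ri s(1) fint in auto)
      then show ?thesis by simp
    qed
    ultimately show ?thesis using j N[OF k] by simp
  qed
  then show "\<exists>no. \<forall>n\<ge>no. norm ((LBINT z. r n z * f z) - 0) < \<epsilon>" by blast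
qed

lemma box_Pair_eq: "box (a, b) (c, d) = box a c \<times> box b d"
  by (force simp: box_def Basis_prod_def)

text \<open>The class of densities against which the sequence vanishes is closed under dominated limits.
  It contains the indicators of boxes, because \<open>1 - exp(-n \<Phi>)\<close> is an admissible test function that
  increases to the indicator of \<open>{\<Phi> > 0}\<close>; Dynkin's theorem then yields all Borel sets.\<close>
lemma weak_null_L1:
  fixes r :: "nat \<Rightarrow> (real^'d) \<times> real \<Rightarrow> real"
  assumes s: "0 < s" and r_meas: "\<And>k. r k \<in> borel_measurable lborel"
    and r: "\<And>k z. z \<in> Qcell \<times> {0..s} \<Longrightarrow> \<bar>r k z\<bar> \<le> K"
    and test: "\<And>\<Phi>. C1_map \<Phi> \<Longrightarrow> periodic_x \<Phi> \<Longrightarrow> (\<And>x t. t \<le> 0 \<or> s \<le> t \<Longrightarrow> \<Phi> (x, t) = 0) \<Longrightarrow>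
      (\<lambda>k. LBINT z. indicator (Qcell \<times> {0..s}) z * r k z * \<Phi> z) \<longlonglongrightarrow> 0"
    and \<phi>: "integrable lborel \<phi>"
  shows "(\<lambda>k. LBINT z. indicator (Qcell \<times> {0..s}) z * r k z * \<phi> z) \<longlonglongrightarrow> 0"
proof -
  define \<Omega> where "\<Omega> = (Qcell :: (real^'d) set) \<times> {0..s}"
  define rr where "rr k z = indicator \<Omega> z * r k z" for k z
  define P where "P f \<longleftrightarrow> (\<lambda>k. LBINT z. rr k z * f z) \<longlonglongrightarrow> 0" for f
  have \<Omega>_meas [measurable]: "\<Omega> \<in> sets borel" unfolding \<Omega>_def by measurable
  note [measurable] = r_meas
  have rr_meas: "rr k \<in> borel_measurable lborel" for k unfolding rr_def by measurable
  have "(0, 0) \<in> \<Omega>" using s by (simp add: \<Omega>_def Qcell_def)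
  then have K: "0 \<le> K" using r[of "(0, 0)" 0] by (auto simp: \<Omega>_def)
  have rr: "\<bar>rr k z\<bar> \<le> K" for k z
    using r[of z k] K by (simp add: rr_def \<Omega>_def indicator_def)
  have rr_int: "integrable lborel (\<lambda>z. rr k z * f z)" if "integrable lborel f" for f k
  proof (rule Bochner_Integration.integrable_bound[where f = "\<lambda>z. K * f z"])
    show "AE z in lborel. norm (rr k z * f z) \<le> norm (K * f z)"
      using rr K by (auto simp: abs_mult intro!: mult_right_mono)
  qed (use that borel_measurable_integrable[OF that] rr_meas in auto)
  have \<Omega>_int: "integrable lborel (\<lambda>z. indicator \<Omega> z :: real)"
    using emeasure_Qcell_strip_finite[of 0 s, where 'd = 'd] by (simp add: \<Omega>_def)
  \<comment> \<open>Periodic test functions need not be integrable on the whole space. Since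
    \<open>rr k\<close> already carries the indicator of \<open>\<Omega>\<close>, inserting it into
    the density changes nothing and restores integrability.\<close>
  have P_cong: "P f \<longleftrightarrow> P (\<lambda>z. indicator \<Omega> z * f z)" for f
    unfolding P_def rr_def
    by (rule arg_cong[where f = "\<lambda>g. g \<longlonglongrightarrow> 0"]) (auto simp: fun_eq_iff indicator_def intro!: Bochner_Integration.integral_cong)
  have closed: "P f"
    if "\<And>j. integrable lborel (g j)" "\<And>j. P (g j)" "AE z in lborel. (\<lambda>j. g j z) \<longlonglongrightarrow> f z"
      "integrable lborel G" "\<And>j. AE z in lborel. \<bar>g j z\<bar> \<le> G z" "f \<in> borel_measurable lborel" for f g G
    unfolding P_def
    by (rule weak_null_closed[OF rr_meas rr that(1) _ that(3-6)]) (use that(2) in \<open>simp add: P_def\<close>)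
  \<comment> \<open>The bumps are positive only inside the open cell, whereas
    \<open>\<Omega>\<close> contains some of its faces; those faces are null sets.\<close>
  have interior: "AE z in lborel. z \<in> \<Omega> \<longrightarrow> (\<forall>i. 0 < fst z $ i) \<and> 0 < snd z \<and> snd z < s"
  proof -
    define l :: "(real^'d) \<times> real" where "l = (0, 0)"
    define u :: "(real^'d) \<times> real" where "u = ((\<chi> i. 2 * pi), s)"
    have "AE z in lborel. z \<notin> cbox l u - box l u"
    proof (rule AE_not_in)
      show "cbox l u - box l u \<in> null_sets lborel"
        using negligible_frontier_interval[of l u]
        by (simp add: negligible_iff_null_sets null_sets_completion_iff)
    qed
    then show ?thesis
    proof eventually_elim
      case (elim z)
      show ?case
      proof
        assume "z \<in> \<Omega>"
        then have "z \<in> cbox l u"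
          by (cases z) (auto simp: \<Omega>_def Qcell_def l_def u_def cbox_Pair_eq mem_box_cart less_imp_le)
        then have "z \<in> box l u" using elim by blast
        then show "(\<forall>i. 0 < fst z $ i) \<and> 0 < snd z \<and> snd z < s"
          by (cases z) (auto simp: l_def u_def box_Pair_eq mem_box_cart)
      qed
    qed
  qed
  have boxes: "P (indicator (box l u))" for l u :: "(real^'d) \<times> real"
  proof (cases "\<exists>z\<in>\<Omega>. z \<in> box l u")
    case False
    then have "(\<lambda>z. rr k z * indicator (box l u) z) = (\<lambda>z. 0)" for k
      by (auto simp: rr_def indicator_def)
    then show ?thesis by (simp only: P_def) simp
  next
    case True
    \<comment> \<open>Clipping the box to the cell meets the hypotheses of
      \<open>cos_bump_pos_iff\<close>, and clipping the time interval to \<open>[0, s]\<close> makes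
      the bump vanish where \<open>test\<close> asks for it. A common point of
      \<open>\<Omega>\<close> and the box guarantees \<open>a $ i < b $ i\<close>.\<close>
    define a b where "a = (\<chi> i. max 0 (fst l $ i))" and "b = (\<chi> i. min (2 * pi) (fst u $ i))"
    define \<alpha> \<beta> where "\<alpha> = max 0 (snd l)" and "\<beta> = min s (snd u)"
    have box: "z \<in> box l u \<longleftrightarrow> (\<forall>i. fst l $ i < fst z $ i \<and> fst z $ i < fst u $ i) \<and> snd l < snd z \<and> snd z < snd u" for z
      by (cases z; cases l; cases u) (simp add: box_Pair_eq mem_box_cart)
    have ab: "0 \<le> a $ i \<and> a $ i < b $ i \<and> b $ i \<le> 2 * pi" for i
    proof -
      obtain z where z: "z \<in> \<Omega>" "z \<in> box l u" using True by blast
      have "0 \<le> fst z $ i" "fst z $ i < 2 * pi"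
        using z(1) by (auto simp: \<Omega>_def Qcell_def)
      moreover have "fst l $ i < fst z $ i" "fst z $ i < fst u $ i"
        using z(2) unfolding box by auto
      ultimately show ?thesis by (auto simp: a_def b_def)
    qed
    define \<Phi> where "\<Phi> = box_bump a b \<alpha> \<beta>"
    define g where "g n z = 1 - exp (- (real n * \<Phi> z))" for n z
    have \<Phi>0: "0 \<le> \<Phi> z" for z unfolding \<Phi>_def by (rule box_bump_nonneg)
    have g01: "0 \<le> g n z" "g n z \<le> 1" for n z using \<Phi>0[of z] by (auto simp: g_def)
    have C1_exp: "C1_map (\<lambda>y::real. 1 - exp (- (c * y)))" for c
      by (rule C1_map_DERIV[where g' = "\<lambda>y. c * exp (- (c * y))"])
         (auto intro!: derivative_eq_intros continuous_intros)
    have C1g: "C1_map (g n)" for n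
      unfolding g_def using C1_map_compose[OF C1_exp C1_map_box_bump] by (simp add: \<Phi>_def)
    have per: "periodic_x (g n)" for n
      using periodic_box_bump[of a b \<alpha> \<beta>] by (simp add: g_def periodic_x_def \<Phi>_def)
    have supp: "g n (x, t) = 0" if "t \<le> 0 \<or> s \<le> t" for n x t
      using that by (auto simp: g_def \<Phi>_def box_bump_def \<alpha>_def \<beta>_def)
    have g_meas [measurable]: "g n \<in> borel_measurable borel" for n
      by (rule borel_measurable_continuous_onI[OF C1_map_continuous[OF C1g]])
    have Pg: "P (\<lambda>z. indicator \<Omega> z * g n z)" for n
      unfolding P_cong[symmetric] using test[OF C1g per supp] unfolding P_def rr_def \<Omega>_def by simp
    have "P (\<lambda>z. indicator \<Omega> z * indicator (box l u) z)"
    proof (rule closed[OF _ Pg])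
      show "integrable lborel (\<lambda>z. indicator \<Omega> z * g n z)" for n
        by (rule Bochner_Integration.integrable_bound[OF \<Omega>_int]) (use g01 in \<open>auto simp: indicator_def\<close>)
      show "AE z in lborel. (\<lambda>n. indicator \<Omega> z * g n z) \<longlonglongrightarrow> indicator \<Omega> z * indicator (box l u) z"
        using interior
      proof eventually_elim
        case (elim z)
        show ?case
        proof (cases "z \<in> \<Omega>")
          case True
          then have "z \<in> box l u \<longleftrightarrow> 0 < \<Phi> z"
          proof -
            have "0 < \<Phi> z \<longleftrightarrow> (\<forall>i. a $ i < fst z $ i \<and> fst z $ i < b $ i) \<and> \<alpha> < snd z \<and> snd z < \<beta>"
              unfolding \<Phi>_def using box_bump_pos_iff[of "fst z" a b \<alpha> \<beta> "snd z"] ab True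
              by (cases z) (auto simp: \<Omega>_def)
            moreover have "fst z $ i < 2 * pi" for i using True by (auto simp: \<Omega>_def Qcell_def)
            ultimately show ?thesis
              using elim True unfolding box by (auto simp: a_def b_def \<alpha>_def \<beta>_def)
          qed
          moreover have "(\<lambda>n. g n z) \<longlonglongrightarrow> (if 0 < \<Phi> z then 1 else 0)"
          proof (cases "0 < \<Phi> z")
            case True
            have "(\<lambda>n. 1 - exp (- \<Phi> z) ^ n) \<longlonglongrightarrow> 1 - 0"
              by (intro tendsto_diff tendsto_const LIMSEQ_power_zero) (use True in simp)
            then show ?thesis using True by (simp add: g_def exp_of_nat_mult[symmetric])
          next
            case False
            then have "\<Phi> z = 0" using \<Phi>0[of z] by simp
            then show ?thesis by (simp add: g_def)
          qed
          ultimately show ?thesis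
            using True by (cases "0 < \<Phi> z") (simp_all add: indicator_def)
        qed simp
      qed
      show "integrable lborel (\<lambda>z. indicator \<Omega> z :: real)" by (rule \<Omega>_int)
      show "AE z in lborel. \<bar>indicator \<Omega> z * g n z\<bar> \<le> indicator \<Omega> z" for n
        using g01 by (auto simp: indicator_def)
    qed auto
    then show ?thesis by (simp add: P_cong[symmetric])
  qed
  have P\<Omega>: "P (indicator UNIV)"
  proof -
    \<comment> \<open>On \<open>\<Omega>\<close> the constant density agrees with the indicator of
      one large box. Complements in the Dynkin argument are obtained by subtracting from it.\<close>
    obtain c where c: "\<Omega> \<subseteq> box (-c) c"
      using bounded_subset_box_symmetric[OF Qcell_strip_bounded[of 0 s]] unfolding \<Omega>_def by blast
    have eq: "indicator \<Omega> z * indicator (box (-c) c) z = (indicator \<Omega> z * indicator UNIV z :: real)" for z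
      using c by (auto simp: indicator_def)
    show ?thesis
      using boxes[of "-c" c] P_cong[of "indicator (box (-c) c)"] P_cong[of "indicator UNIV"] by (simp only: eq)
  qed
  have sets: "P (indicator A)" if A: "A \<in> sets borel" for A
  proof -
    let ?G = "range (\<lambda>(a, b). box a b :: ((real^'d) \<times> real) set)"
    have "Int_stable ?G" by (auto simp: Int_stable_def box_Int_box)
    moreover have "?G \<subseteq> Pow UNIV" by simp
    moreover have "A \<in> sigma_sets UNIV ?G"
      using A by (simp add: borel_eq_box)
    ultimately show ?thesis
    proof (induction rule: sigma_sets_induct_disjoint)
      case (basic A)
      then show ?case using boxes by auto
    next
      case empty
      show ?case by (simp add: P_def)
    next
      case (compl A)
      then have [measurable]: "A \<in> sets borel" by (simp add: borel_eq_box)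
      have i: "integrable lborel (\<lambda>z. indicator \<Omega> z * indicator B z :: real)" if "B \<in> sets borel" for B
        by (rule Bochner_Integration.integrable_bound[OF \<Omega>_int]) (use that in \<open>auto simp: indicator_def\<close>)
      have "(\<lambda>k. (LBINT z. rr k z * (indicator \<Omega> z * indicator UNIV z))
          - (LBINT z. rr k z * (indicator \<Omega> z * indicator A z))) \<longlonglongrightarrow> 0 - 0"
        using P\<Omega> compl.IH unfolding P_cong[of "indicator UNIV"] P_cong[of "indicator A"]
        unfolding P_def by (intro tendsto_diff)
      moreover have "(LBINT z. rr k z * (indicator \<Omega> z * indicator UNIV z))
          - (LBINT z. rr k z * (indicator \<Omega> z * indicator A z))
          = (LBINT z. rr k z * (indicator \<Omega> z * indicator (UNIV - A) z))" for k
      proof -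
        have "(LBINT z. rr k z * (indicator \<Omega> z * indicator (UNIV - A) z))
            = (LBINT z. rr k z * (indicator \<Omega> z * indicator UNIV z) - rr k z * (indicator \<Omega> z * indicator A z))"
          by (rule Bochner_Integration.integral_cong) (auto simp: indicator_def)
        also have "\<dots> = (LBINT z. rr k z * (indicator \<Omega> z * indicator UNIV z))
          - (LBINT z. rr k z * (indicator \<Omega> z * indicator A z))"
          by (rule Bochner_Integration.integral_diff[OF rr_int[OF i] rr_int[OF i]]) auto
        finally show ?thesis ..
      qed
      ultimately have "P (\<lambda>z. indicator \<Omega> z * indicator (UNIV - A) z)"
        unfolding P_def by simp
      then show ?case by (simp add: P_cong[symmetric])
    next
      case (union A)
      then have [measurable]: "A i \<in> sets borel" for i by (auto simp: borel_eq_box)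
      have i: "integrable lborel (\<lambda>z. indicator \<Omega> z * indicator (B i) z :: real)" if "\<And>i. B i \<in> sets borel" for i and B :: "nat \<Rightarrow> _"
        by (rule Bochner_Integration.integrable_bound[OF \<Omega>_int]) (use that in \<open>auto simp: indicator_def\<close>)
      have ind: "(\<Sum>i<n. indicator (A i) z) = (indicator (\<Union>i<n. A i) z :: real)" for n z
        using union(1) by (intro indicator_UN_disjoint[symmetric]) (auto intro: disjoint_family_on_mono)
      have fin: "P (\<lambda>z. indicator \<Omega> z * indicator (\<Union>i<n. A i) z)" for n
      proof -
        have "(\<lambda>k. \<Sum>i<n. LBINT z. rr k z * (indicator \<Omega> z * indicator (A i) z)) \<longlonglongrightarrow> (\<Sum>i<n. 0)"
          using union(3) unfolding P_cong[of "indicator (A _)"] unfolding P_def by (intro tendsto_sum)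
        moreover have "(\<Sum>i<n. LBINT z. rr k z * (indicator \<Omega> z * indicator (A i) z))
            = (LBINT z. rr k z * (indicator \<Omega> z * indicator (\<Union>i<n. A i) z))" for k
        proof -
          have "(\<Sum>i<n. LBINT z. rr k z * (indicator \<Omega> z * indicator (A i) z))
              = (LBINT z. (\<Sum>i<n. rr k z * (indicator \<Omega> z * indicator (A i) z)))"
            by (rule Bochner_Integration.integral_sum[OF rr_int[OF i], symmetric]) auto
          then show ?thesis by (simp only: ind[symmetric] sum_distrib_left)
        qed
        ultimately show ?thesis unfolding P_def by simp
      qed
      have "P (\<lambda>z. indicator \<Omega> z * indicator (\<Union>i. A i) z)"
      proof (rule closed[OF _ fin])
        show "integrable lborel (\<lambda>z. indicator \<Omega> z * indicator (\<Union>i<n. A i) z :: real)" for n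
          by (rule i) auto
        show "AE z in lborel. (\<lambda>n. indicator \<Omega> z * indicator (\<Union>i<n. A i) z) \<longlonglongrightarrow> (indicator \<Omega> z * indicator (\<Union>i. A i) z :: real)"
          by (intro AE_I2 tendsto_mult_left LIMSEQ_indicator_UN)
        show "AE z in lborel. \<bar>indicator \<Omega> z * indicator (\<Union>i<n. A i) z :: real\<bar> \<le> indicator \<Omega> z" for n
          by (auto simp: indicator_def)
      qed (use \<Omega>_int in auto)
      then show ?case by (simp add: P_cong[symmetric])
    qed
  qed
  have "P \<phi>"
    using \<phi>
  proof (induction rule: integrable_induct)
    case (base A c)
    then have "P (indicator A)" using sets by simp
    then have "(\<lambda>k. (LBINT z. rr k z * indicator A z) * c) \<longlonglongrightarrow> 0 * c"
      unfolding P_def by (rule tendsto_mult_right)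
    then show ?case unfolding P_def by (simp add: mult.assoc[symmetric])
  next
    case (add f g)
    then have "(\<lambda>k. (LBINT z. rr k z * f z) + (LBINT z. rr k z * g z)) \<longlonglongrightarrow> 0 + 0"
      unfolding P_def by (intro tendsto_add)
    then show ?case unfolding P_def using rr_int[OF add.hyps(1)] rr_int[OF add.hyps(2)] by (simp add: distrib_left)
  next
    case (lim f g)
    show ?case
    proof (rule closed[OF lim.hyps(1) lim.IH])
      show "AE z in lborel. (\<lambda>j. g j z) \<longlonglongrightarrow> f z" using lim.hyps(2) by simp
      show "integrable lborel (\<lambda>z. 2 * \<bar>f z\<bar>)" using lim.hyps(4) by simp
      show "AE z in lborel. \<bar>g j z\<bar> \<le> 2 * \<bar>f z\<bar>" for j using lim.hyps(3) by simp
      show "f \<in> borel_measurable lborel" using lim.hyps(4) by simp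
    qed
  qed
  then show ?thesis unfolding P_def rr_def \<Omega>_def .
qed

section \<open>Young measures and the entropy\<close>

text \<open>\<open>young_measure\<close> grants measurability for bounded continuous integrands
  only. Truncation at \<open>n\<close> and monotone convergence carry this over to nonnegative
  continuous ones.\<close>

lemma young_measure_nn_integral_min:
  fixes g :: "'b::euclidean_space \<Rightarrow> real"
  assumes \<nu>: "young_measure S \<nu>" and z: "z \<in> S" and g: "continuous_on UNIV g" "\<And>l. 0 \<le> g l"
  shows "(\<integral>\<^sup>+l. ennreal (min (g l) (real n)) \<partial>\<nu> z) = ennreal (\<integral>l. min (g l) (real n) \<partial>\<nu> z)"
    and "(\<integral>\<^sup>+l. ennreal (g l) \<partial>\<nu> z) = (SUP n. ennreal (\<integral>l. min (g l) (real n) \<partial>\<nu> z))"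
    and "0 \<le> (\<integral>l. min (g l) (real n) \<partial>\<nu> z)" "(\<integral>l. min (g l) (real n) \<partial>\<nu> z) \<le> real n"
proof -
  interpret prob_space "\<nu> z" using \<nu> z by (simp add: young_measure_def)
  have sets: "sets (\<nu> z) = sets borel" using \<nu> z by (simp add: young_measure_def)
  have [measurable]: "g \<in> borel_measurable (\<nu> z)"
    using borel_measurable_continuous_onI[OF g(1)] measurable_cong_sets[OF sets refl] by blast
  have int: "integrable (\<nu> z) (\<lambda>l. min (g l) (real n))" for n
    by (rule integrable_const_bound[of _ "real n"]) (use g in auto)
  show eq: "(\<integral>\<^sup>+l. ennreal (min (g l) (real n)) \<partial>\<nu> z) = ennreal (\<integral>l. min (g l) (real n) \<partial>\<nu> z)" for n
    by (rule nn_integral_eq_integral[OF int]) (use g in auto)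
  have "ennreal (g l) = (SUP n. ennreal (min (g l) (real n)))" for l
  proof (rule antisym)
    obtain N where "g l \<le> real N" using real_arch_simple by blast
    then have "ennreal (g l) = ennreal (min (g l) (real N))" by simp
    then show "ennreal (g l) \<le> (SUP n. ennreal (min (g l) (real n)))"
      by (metis SUP_upper UNIV_I)
  qed (auto intro!: SUP_least ennreal_leI)
  then have "(\<integral>\<^sup>+l. ennreal (g l) \<partial>\<nu> z) = (\<integral>\<^sup>+l. (SUP n. ennreal (min (g l) (real n))) \<partial>\<nu> z)"
    by simp
  also have "\<dots> = (SUP n. \<integral>\<^sup>+l. ennreal (min (g l) (real n)) \<partial>\<nu> z)"
    by (intro nn_integral_monotone_convergence_SUP)
       (auto simp: incseq_def le_fun_def intro!: ennreal_leI min.mono)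
  finally show "(\<integral>\<^sup>+l. ennreal (g l) \<partial>\<nu> z) = (SUP n. ennreal (\<integral>l. min (g l) (real n) \<partial>\<nu> z))"
    by (simp add: eq)
  show "0 \<le> (\<integral>l. min (g l) (real n) \<partial>\<nu> z)"
    by (rule Bochner_Integration.integral_nonneg) (use g in auto)
  show "(\<integral>l. min (g l) (real n) \<partial>\<nu> z) \<le> real n"
    using integral_mono[OF int, of "\<lambda>_. real n"] by (simp add: prob_space)
qed

lemma bounded_range_min:
  fixes g :: "'a \<Rightarrow> real"
  assumes "\<And>l. 0 \<le> g l"
  shows "bounded (range (\<lambda>l. min (g l) (real n)))"
  unfolding bounded_iff by (intro exI[of _ "real n"]) (use assms in auto)

lemma young_measure_nn_integral_measurable:
  fixes g :: "'b::euclidean_space \<Rightarrow> real"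
  assumes \<nu>: "young_measure S \<nu>" and g: "continuous_on UNIV g" "\<And>l. 0 \<le> g l"
  shows "(\<lambda>z. indicator S z * (\<integral>\<^sup>+l. ennreal (g l) \<partial>\<nu> z)) \<in> borel_measurable lborel"
proof -
  have m: "(\<lambda>z. indicator S z *\<^sub>R (\<integral>l. min (g l) (real n) \<partial>\<nu> z)) \<in> borel_measurable lborel" for n
  proof -
    have "continuous_on UNIV (\<lambda>l. min (g l) (real n))" by (intro continuous_intros g(1))
    with bounded_range_min[of g, OF g(2)] \<nu> show ?thesis
      unfolding young_measure_def set_borel_measurable_def by blast
  qed
  have "(\<lambda>z. SUP n. ennreal (indicator S z *\<^sub>R (\<integral>l. min (g l) (real n) \<partial>\<nu> z))) \<in> borel_measurable lborel"
    using m by measurable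
  also have "(\<lambda>z. SUP n. ennreal (indicator S z *\<^sub>R (\<integral>l. min (g l) (real n) \<partial>\<nu> z)))
    = (\<lambda>z. indicator S z * (\<integral>\<^sup>+l. ennreal (g l) \<partial>\<nu> z))"
    using young_measure_nn_integral_min(2)[OF \<nu> _ g] by (auto simp: fun_eq_iff indicator_def)
  finally show ?thesis .
qed

lemma young_measure_integral_measurable:
  fixes g :: "'b::euclidean_space \<Rightarrow> real"
  assumes \<nu>: "young_measure S \<nu>" and g: "continuous_on UNIV g"
  shows "(\<lambda>z. indicator S z * (\<integral>l. g l \<partial>\<nu> z)) \<in> borel_measurable lborel"
proof -
  define I where "I h z = indicator S z * (\<integral>\<^sup>+l. ennreal (h l) \<partial>\<nu> z)" for h :: "'b \<Rightarrow> real" and z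
  have [measurable]: "I (\<lambda>l. max 0 (g l)) \<in> borel_measurable lborel"
    "I (\<lambda>l. max 0 (- g l)) \<in> borel_measurable lborel" "I (\<lambda>l. \<bar>g l\<bar>) \<in> borel_measurable lborel"
    unfolding I_def by (intro young_measure_nn_integral_measurable[OF \<nu>] continuous_intros g; simp)+
  \<comment> \<open>Where \<open>g\<close> is not integrable the integral is zero by convention; the
    case distinction reproduces this default through measurable functions.\<close>
  have "indicator S z * (\<integral>l. g l \<partial>\<nu> z)
      = (if I (\<lambda>l. \<bar>g l\<bar>) z < \<infinity> then enn2real (I (\<lambda>l. max 0 (g l)) z) - enn2real (I (\<lambda>l. max 0 (- g l)) z) else 0)" for z
  proof (cases "z \<in> S")
    case True
    then have sets: "sets (\<nu> z) = sets borel" using \<nu> by (simp add: young_measure_def)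
    have m: "g \<in> borel_measurable (\<nu> z)"
      using borel_measurable_continuous_onI[OF g] measurable_cong_sets[OF sets refl] by blast
    have "integrable (\<nu> z) g \<longleftrightarrow> I (\<lambda>l. \<bar>g l\<bar>) z < \<infinity>"
      using m True by (simp add: integrable_iff_bounded I_def)
    moreover have "ennreal (max 0 y) = ennreal y" for y by (simp add: max_def ennreal_neg)
    ultimately show ?thesis
      using True not_integrable_integral_eq[of "\<nu> z" g] real_lebesgue_integral_def[of "\<nu> z" g]
      by (simp add: I_def)
  qed (simp add: I_def)
  then show ?thesis by simp
qed

text \<open>The bound on \<open>g\<close> transfers finiteness of the iterated integral of the
  entropy to that of \<open>\<bar>g\<bar>\<close>. A finite outer integral makes the inner one
  finite almost everywhere, which is the first claim.\<close>

lemma young_measure_integrable: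
  fixes g \<eta> :: "'b::euclidean_space \<Rightarrow> real"
  assumes \<nu>: "young_measure S \<nu>" and g: "continuous_on UNIV g" and \<eta>: "continuous_on UNIV \<eta>" "\<And>l. 0 \<le> \<eta> l"
    and \<Omega>: "\<Omega> \<subseteq> S" "\<Omega> \<in> sets borel" "emeasure lborel \<Omega> < \<infinity>"
    and fin: "(\<integral>\<^sup>+z. indicator \<Omega> z * (\<integral>\<^sup>+l. ennreal (\<eta> l) \<partial>\<nu> z) \<partial>lborel) < \<infinity>"
    and c: "\<And>l. \<bar>g l\<bar> \<le> c * (1 + \<eta> l)"
  shows "AE z in lborel. z \<in> \<Omega> \<longrightarrow> integrable (\<nu> z) g"
    and "integrable lborel (\<lambda>z. indicator \<Omega> z * (\<integral>l. g l \<partial>\<nu> z))"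
proof -
  note [measurable] = \<Omega>(2)
  define N where "N z = indicator S z * (\<integral>\<^sup>+l. ennreal \<bar>g l\<bar> \<partial>\<nu> z)" for z
  define H where "H z = indicator S z * (\<integral>\<^sup>+l. ennreal (\<eta> l) \<partial>\<nu> z)" for z
  have [measurable]: "N \<in> borel_measurable lborel" "H \<in> borel_measurable lborel"
    unfolding N_def H_def by (intro young_measure_nn_integral_measurable[OF \<nu>] continuous_intros g \<eta>; simp)+
  \<comment> \<open>The growth bound at any single point, here \<open>undefined\<close>, decides the
    sign of \<open>c\<close>.\<close>
  have "0 \<le> c"
    using order_trans[OF abs_ge_zero c[of undefined]] \<eta>(2)[of undefined] by (simp add: zero_le_mult_iff)
  have N: "N z \<le> ennreal c * (1 + H z)" if "z \<in> S" for z
  proof -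
    interpret prob_space "\<nu> z" using \<nu> that by (simp add: young_measure_def)
    have sets: "sets (\<nu> z) = sets borel" using \<nu> that by (simp add: young_measure_def)
    have [measurable]: "\<eta> \<in> borel_measurable (\<nu> z)"
      using borel_measurable_continuous_onI[OF \<eta>(1)] measurable_cong_sets[OF sets refl] by blast
    have "(\<integral>\<^sup>+l. ennreal \<bar>g l\<bar> \<partial>\<nu> z) \<le> (\<integral>\<^sup>+l. ennreal c * (1 + ennreal (\<eta> l)) \<partial>\<nu> z)"
    proof (rule nn_integral_mono)
      fix l
      have "ennreal \<bar>g l\<bar> \<le> ennreal (c * (1 + \<eta> l))" using c by (intro ennreal_leI)
      also have "\<dots> = ennreal c * (1 + ennreal (\<eta> l))"
        using \<open>0 \<le> c\<close> \<eta>(2)[of l] by (simp add: ennreal_mult ennreal_plus)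
      finally show "ennreal \<bar>g l\<bar> \<le> ennreal c * (1 + ennreal (\<eta> l))" .
    qed
    also have "\<dots> = ennreal c * (1 + (\<integral>\<^sup>+l. ennreal (\<eta> l) \<partial>\<nu> z))"
      by (simp add: nn_integral_cmult nn_integral_add emeasure_space_1)
    finally show ?thesis using that by (simp add: N_def H_def)
  qed
  have "(\<integral>\<^sup>+z. indicator \<Omega> z * N z \<partial>lborel) \<le> (\<integral>\<^sup>+z. ennreal c * (indicator \<Omega> z + indicator \<Omega> z * (\<integral>\<^sup>+l. ennreal (\<eta> l) \<partial>\<nu> z)) \<partial>lborel)"
  proof (rule nn_integral_mono)
    fix z show "indicator \<Omega> z * N z \<le> ennreal c * (indicator \<Omega> z + indicator \<Omega> z * (\<integral>\<^sup>+l. ennreal (\<eta> l) \<partial>\<nu> z))"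
      using N[of z] \<Omega>(1) by (auto simp: indicator_def H_def)
  qed
  also have "\<dots> = (\<integral>\<^sup>+z. ennreal c * (indicator \<Omega> z + indicator \<Omega> z * H z) \<partial>lborel)"
    using \<Omega>(1) by (intro nn_integral_cong) (auto simp: indicator_def H_def)
  also have "\<dots> = ennreal c * (emeasure lborel \<Omega> + (\<integral>\<^sup>+z. indicator \<Omega> z * H z \<partial>lborel))"
    by (simp add: nn_integral_cmult nn_integral_add)
  also have "(\<integral>\<^sup>+z. indicator \<Omega> z * H z \<partial>lborel) = (\<integral>\<^sup>+z. indicator \<Omega> z * (\<integral>\<^sup>+l. ennreal (\<eta> l) \<partial>\<nu> z) \<partial>lborel)"
    using \<Omega>(1) by (intro nn_integral_cong) (auto simp: indicator_def H_def)
  also have "ennreal c * (emeasure lborel \<Omega> + (\<integral>\<^sup>+z. indicator \<Omega> z * (\<integral>\<^sup>+l. ennreal (\<eta> l) \<partial>\<nu> z) \<partial>lborel)) < \<infinity>"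
    using \<Omega>(3) fin by (simp add: ennreal_mult_less_top less_top)
  finally have Nfin: "(\<integral>\<^sup>+z. indicator \<Omega> z * N z \<partial>lborel) < \<infinity>" .
  have "AE z in lborel. indicator \<Omega> z * N z \<noteq> \<infinity>"
    by (rule nn_integral_PInf_AE) (use Nfin in auto)
  then show "AE z in lborel. z \<in> \<Omega> \<longrightarrow> integrable (\<nu> z) g"
  proof eventually_elim
    case (elim z)
    show ?case
    proof
      assume z: "z \<in> \<Omega>"
      then have sets: "sets (\<nu> z) = sets borel" using \<nu> \<Omega>(1) by (auto simp: young_measure_def)
      have "g \<in> borel_measurable (\<nu> z)"
        using borel_measurable_continuous_onI[OF g] measurable_cong_sets[OF sets refl] by blast
      then show "integrable (\<nu> z) g"
        using elim z \<Omega>(1) by (auto simp: integrable_iff_bounded N_def less_top subset_eq)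
    qed
  qed
  show "integrable lborel (\<lambda>z. indicator \<Omega> z * (\<integral>l. g l \<partial>\<nu> z))"
  proof (rule integrableI_bounded)
    have "(\<lambda>z. indicator \<Omega> z * (indicator S z * (\<integral>l. g l \<partial>\<nu> z))) \<in> borel_measurable lborel"
      using young_measure_integral_measurable[OF \<nu> g] by measurable
    also have "(\<lambda>z. indicator \<Omega> z * (indicator S z * (\<integral>l. g l \<partial>\<nu> z))) = (\<lambda>z. indicator \<Omega> z * (\<integral>l. g l \<partial>\<nu> z))"
      using \<Omega>(1) by (auto simp: fun_eq_iff indicator_def)
    finally show "(\<lambda>z. indicator \<Omega> z * (\<integral>l. g l \<partial>\<nu> z)) \<in> borel_measurable lborel" .
    have "(\<integral>\<^sup>+z. ennreal (norm (indicator \<Omega> z * (\<integral>l. g l \<partial>\<nu> z))) \<partial>lborel) \<le> (\<integral>\<^sup>+z. indicator \<Omega> z * N z \<partial>lborel)"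
    proof (rule nn_integral_mono)
      fix z
      show "ennreal (norm (indicator \<Omega> z * (\<integral>l. g l \<partial>\<nu> z))) \<le> indicator \<Omega> z * N z"
      proof (cases "z \<in> \<Omega> \<and> integrable (\<nu> z) g")
        case True
        then have "ennreal \<bar>\<integral>l. g l \<partial>\<nu> z\<bar> \<le> (\<integral>\<^sup>+l. ennreal \<bar>g l\<bar> \<partial>\<nu> z)"
          using integral_norm_bound_ennreal[of "\<nu> z" g] by simp
        then show ?thesis using True \<Omega>(1) by (auto simp: N_def indicator_def)
      qed (auto simp: not_integrable_integral_eq)
    qed
    then show "(\<integral>\<^sup>+z. ennreal (norm (indicator \<Omega> z * (\<integral>l. g l \<partial>\<nu> z))) \<partial>lborel) < \<infinity>"
      using Nfin by (rule le_less_trans)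
  qed
qed

section \<open>Finite mean entropy of the Young measure\<close>

lemma QT_borel [measurable]: "(QT T :: ((real^'d) \<times> real) set) \<in> sets borel"
  unfolding QT_def by measurable

lemma emeasure_QT_finite: "emeasure lborel (QT T :: ((real^'d) \<times> real) set) < \<infinity>"
proof -
  have "emeasure lborel (QT T :: ((real^'d) \<times> real) set) \<le> emeasure lborel ((Qcell :: (real^'d) set) \<times> {0..T})"
    by (rule emeasure_mono) (auto simp: QT_def)
  then show ?thesis using emeasure_Qcell_strip_finite le_less_trans by blast
qed

text \<open>Tonelli with time as the outer variable: a bound for almost every time slice is
  integrated over an interval of finite length.\<close>

lemma nn_integral_QT_powr_finite:
  fixes v :: "(real^'d) \<times> real \<Rightarrow> 'b::euclidean_space"
  assumes [measurable]: "v \<in> borel_measurable lborel"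
    and M: "AE t in lborel. 0 \<le> t \<and> t < T \<longrightarrow>
      (\<integral>\<^sup>+ x\<in>Qcell. ennreal (norm (v (x, t)) powr p) \<partial>lborel) \<le> ennreal M"
  shows "(\<integral>\<^sup>+z. indicator (QT T) z * ennreal (norm (v z) powr p) \<partial>lborel) < \<infinity>"
proof -
  have [measurable]: "v \<in> borel_measurable (lborel \<Otimes>\<^sub>M lborel)" unfolding lborel_prod by fact
  have [measurable]: "(QT T :: ((real^'d) \<times> real) set) \<in> sets (lborel \<Otimes>\<^sub>M lborel)"
    unfolding lborel_prod by simp
  have "(\<integral>\<^sup>+z. indicator (QT T) z * ennreal (norm (v z) powr p) \<partial>lborel)
      = (\<integral>\<^sup>+t. (\<integral>\<^sup>+x. indicator (QT T) (x, t) * ennreal (norm (v (x, t)) powr p) \<partial>lborel) \<partial>lborel)"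
    unfolding lborel_prod[symmetric] by (rule lborel_pair.nn_integral_snd[symmetric]) measurable
  also have "\<dots> \<le> (\<integral>\<^sup>+t. ennreal M * indicator {0..<T} t \<partial>(lborel :: real measure))"
  proof (rule nn_integral_mono_AE)
    show "AE t in lborel. (\<integral>\<^sup>+x. indicator (QT T) (x, t) * ennreal (norm (v (x, t)) powr p) \<partial>lborel) \<le> ennreal M * indicator {0..<T} t"
      using M
    proof eventually_elim
      case (elim t)
      have "(\<integral>\<^sup>+x. indicator (QT T) (x, t) * ennreal (norm (v (x, t)) powr p) \<partial>lborel)
          = (if 0 \<le> t \<and> t < T then (\<integral>\<^sup>+ x\<in>Qcell. ennreal (norm (v (x, t)) powr p) \<partial>lborel) else 0)"
        by (auto simp: QT_def indicator_def intro!: nn_integral_cong)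
      then show ?case using elim by (auto simp: indicator_def)
    qed
  qed
  also have "\<dots> < \<infinity>"
    by (cases "0 \<le> T") (simp_all add: nn_integral_cmult_indicator ennreal_mult_less_top)
  finally show ?thesis .
qed

text \<open>A truncation of \<open>\<eta>\<close> is bounded while \<open>\<eta>\<close> tends to
  infinity, so the quotient tends to zero. For \<open>\<eta>\<close> itself the quotient is one
  wherever \<open>\<eta>\<close> is nonzero, which is why truncations are used.\<close>

lemma admissible_min:
  fixes \<eta> :: "'b::euclidean_space \<Rightarrow> real"
  assumes \<eta>: "continuous_on UNIV \<eta>" "\<And>l. 0 \<le> \<eta> l" "filterlim \<eta> at_top at_infinity"
  shows "admissible \<eta> (\<lambda>l. min (\<eta> l) (real n))"
  unfolding admissible_def
proof
  show "continuous_on UNIV (\<lambda>l. min (\<eta> l) (real n))" by (intro continuous_intros \<eta>(1))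
  have "((\<lambda>l. real n / \<eta> l) \<longlongrightarrow> 0) at_infinity"
    by (rule tendsto_divide_0[OF tendsto_const filterlim_at_top_imp_at_infinity[OF \<eta>(3)]])
  then show "((\<lambda>l. min (\<eta> l) (real n) / \<eta> l) \<longlongrightarrow> 0) at_infinity"
    by (rule Lim_null_comparison[rotated]) (intro always_eventually allI, simp add: \<eta>(2) divide_right_mono)
qed

lemma filterlim_at_top_of_powr_growth:
  fixes \<eta> :: "'b::euclidean_space \<Rightarrow> real"
  assumes "1 \<le> p" "0 < \<alpha>0" "\<And>l. \<alpha>0 * (norm l powr p + 1) - A \<le> \<eta> l"
  shows "filterlim \<eta> at_top at_infinity"
  unfolding filterlim_at_top
proof
  fix Z :: real
  show "\<forall>\<^sub>F l in at_infinity. Z \<le> \<eta> l"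
    unfolding eventually_at_infinity
  proof (intro exI allI impI)
    fix l :: 'b assume l: "max 1 ((\<bar>Z\<bar> + \<bar>A\<bar>) / \<alpha>0) \<le> norm l"
    have "norm l \<le> norm l powr p" using powr_mono[OF assms(1), of "norm l"] l by simp
    then have "(\<bar>Z\<bar> + \<bar>A\<bar>) / \<alpha>0 \<le> norm l powr p + 1" using l by simp
    then have "\<bar>Z\<bar> + \<bar>A\<bar> \<le> \<alpha>0 * (norm l powr p + 1)"
      using assms(2) by (simp add: pos_divide_le_eq mult.commute)
    then show "Z \<le> \<eta> l" using assms(3)[of l] by linarith
  qed
qed

text \<open>Each truncation of \<open>\<eta>\<close> is admissible and lies below
  \<open>\<eta>\<close>, so the mean of its truncation paired with a cut-off is at most the limit
  \<open>L\<close> of the pairings of \<open>\<eta> (v k)\<close>. This bound does not depend on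
  \<open>n\<close>, and monotone convergence removes the truncation. Any concentrated mass is
  contained in \<open>L\<close>, so only an inequality results.\<close>

lemma young_measure_entropy_finite:
  fixes \<eta> :: "'b::euclidean_space \<Rightarrow> real" and \<nu> :: "(real^'d) \<times> real \<Rightarrow> 'b measure"
  assumes \<nu>: "young_measure (QT T) \<nu>"
    and \<eta>: "continuous_on UNIV \<eta>" "\<And>l. 0 \<le> \<eta> l" "filterlim \<eta> at_top at_infinity"
    and C: "\<And>l. \<eta> l \<le> C * (norm l powr p + 1)"
    and v [measurable]: "\<And>k. v k \<in> borel_measurable lborel"
    and M: "\<And>k. AE t in lborel. 0 \<le> t \<and> t < T \<longrightarrow>
      (\<integral>\<^sup>+ x\<in>Qcell. ennreal (norm (v k (x, t)) powr p) \<partial>lborel) \<le> ennreal M"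
    and young: "\<And>g \<phi>. admissible \<eta> g \<Longrightarrow> Cc_QT T \<phi> \<Longrightarrow>
      (\<lambda>k. LINT z:QT T|lborel. g (v k z) * \<phi> z) \<longlonglongrightarrow> (LINT z:QT T|lborel. (\<integral>l. g l \<partial>(\<nu> z)) * \<phi> z)"
    and conc: "\<And>\<phi>. Cc_QT T \<phi> \<Longrightarrow> convergent (\<lambda>k. LINT z:QT T|lborel. \<eta> (v k z) * \<phi> z)"
    and s: "s < T"
  shows "(\<integral>\<^sup>+z. indicator (Qcell \<times> {0..s}) z * (\<integral>\<^sup>+l. ennreal (\<eta> l) \<partial>\<nu> z) \<partial>lborel) < \<infinity>"
proof -
  \<comment> \<open>The room between \<open>s\<close> and \<open>T\<close> lets the cut-off be one
    up to time \<open>s\<close> and zero from \<open>s'\<close> on.\<close>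
  define s' where "s' = (s + T) / 2"
  have s': "s < s'" "s' < T" using s by (auto simp: s'_def)
  define \<phi> where "\<phi> z = min 1 (max 0 ((s' - snd z) / (s' - s)))" for z :: "(real^'d) \<times> real"
  have \<phi>01: "0 \<le> \<phi> z" "\<phi> z \<le> 1" for z by (auto simp: \<phi>_def)
  have \<phi>c: "continuous_on UNIV \<phi>" unfolding \<phi>_def by (intro continuous_intros) (use s' in auto)
  then have [measurable]: "\<phi> \<in> borel_measurable borel" by (rule borel_measurable_continuous_onI)
  have \<phi>: "Cc_QT T \<phi>"
    unfolding Cc_QT_def periodic_x_def
    using \<phi>c s' by (auto simp: \<phi>_def divide_nonpos_pos intro!: exI[of _ s'])
  have \<phi>1: "\<phi> z = 1" if "snd z \<le> s" for z
    using that s' by (auto simp: \<phi>_def min_def max_def field_simps)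
  have [measurable]: "\<eta> \<in> borel_measurable borel" using \<eta>(1) by (rule borel_measurable_continuous_onI)
  have C0: "0 \<le> C" using order_trans[OF \<eta>(2) C[of 0]] by (simp add: zero_le_mult_iff)
  \<comment> \<open>An integrable majorant of \<open>\<eta> (v k z)\<close>. Without it the integral
    of the untruncated entropy might be the default value zero, and the comparison in
    \<open>le\<close> would be unjustified.\<close>
  define D where "D k z = indicator (QT T) z * (C * (norm (v k z) powr p + 1))" for k z
  have D: "integrable lborel (D k)" for k
  proof (rule integrableI_nonneg)
    show "D k \<in> borel_measurable lborel" unfolding D_def by measurable
    show "AE z in lborel. 0 \<le> D k z" using C0 by (auto simp: D_def)
    have "(\<integral>\<^sup>+z. ennreal (D k z) \<partial>lborel)
        = (\<integral>\<^sup>+z. ennreal C * (indicator (QT T) z * ennreal (norm (v k z) powr p) + indicator (QT T) z) \<partial>lborel)"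
      using C0 by (intro nn_integral_cong) (auto simp: D_def indicator_def ennreal_mult ennreal_plus)
    also have "\<dots> = ennreal C * ((\<integral>\<^sup>+z. indicator (QT T) z * ennreal (norm (v k z) powr p) \<partial>lborel) + emeasure lborel (QT T :: ((real^'d) \<times> real) set))"
      by (simp add: nn_integral_cmult nn_integral_add)
    also have "\<dots> < \<infinity>"
      using nn_integral_QT_powr_finite[OF v M, of k] emeasure_QT_finite[of T, where 'd = 'd]
      by (simp add: ennreal_mult_less_top less_top)
    finally show "(\<integral>\<^sup>+z. ennreal (D k z) \<partial>lborel) < \<infinity>" .
  qed
  have int: "integrable lborel (\<lambda>z. indicator (QT T) z *\<^sub>R (h (v k z) * \<phi> z))"
    if h: "\<And>l. 0 \<le> h l" "\<And>l. h l \<le> \<eta> l" "continuous_on UNIV h" for h k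
  proof (rule Bochner_Integration.integrable_bound[OF D[of k]])
    have [measurable]: "h \<in> borel_measurable borel" using h(3) by (rule borel_measurable_continuous_onI)
    show "(\<lambda>z. indicator (QT T) z *\<^sub>R (h (v k z) * \<phi> z)) \<in> borel_measurable lborel" by measurable
    show "AE z in lborel. norm (indicator (QT T) z *\<^sub>R (h (v k z) * \<phi> z)) \<le> norm (D k z)"
    proof (rule AE_I2)
      fix z
      have "h (v k z) * \<phi> z \<le> h (v k z)" using \<phi>01[of z] h(1)[of "v k z"] by (simp add: mult_left_le)
      also have "\<dots> \<le> C * (norm (v k z) powr p + 1)" using h(2) C order_trans by blast
      finally show "norm (indicator (QT T) z *\<^sub>R (h (v k z) * \<phi> z)) \<le> norm (D k z)"
        using h(1)[of "v k z"] \<phi>01[of z] C0 by (auto simp: D_def indicator_def)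
    qed
  qed
  obtain L where L: "(\<lambda>k. LINT z:QT T|lborel. \<eta> (v k z) * \<phi> z) \<longlonglongrightarrow> L"
    using conc[OF \<phi>] by (auto simp: convergent_def)
  define a where "a n z = (\<integral>l. min (\<eta> l) (real n) \<partial>\<nu> z)" for n z
  have a: "0 \<le> a n z" "a n z \<le> real n" if "z \<in> QT T" for n z
    using young_measure_nn_integral_min(3,4)[OF \<nu> that \<eta>(1,2)] by (auto simp: a_def)
  have a_meas: "(\<lambda>z. indicator (QT T) z * a n z) \<in> borel_measurable lborel" for n
    unfolding a_def by (intro young_measure_integral_measurable[OF \<nu>] continuous_intros \<eta>(1))
  have le: "(LINT z:QT T|lborel. a n z * \<phi> z) \<le> L" for n
  proof (rule LIMSEQ_le[OF young[OF admissible_min[OF \<eta>] \<phi>, of n, folded a_def] L])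
    show "\<exists>N. \<forall>k\<ge>N. (LINT z:QT T|lborel. min (\<eta> (v k z)) (real n) * \<phi> z) \<le> (LINT z:QT T|lborel. \<eta> (v k z) * \<phi> z)"
      unfolding set_lebesgue_integral_def
      using \<eta> \<phi>01
      by (intro exI allI impI integral_mono int) (auto intro!: continuous_intros mult_right_mono simp: indicator_def)
  qed
  have nle: "(\<integral>\<^sup>+z. ennreal (indicator (QT T) z * a n z * \<phi> z) \<partial>lborel) \<le> ennreal L" for n
  proof -
    have "integrable lborel (\<lambda>z. indicator (QT T) z * a n z * \<phi> z)"
    proof (rule Bochner_Integration.integrable_bound)
      show "integrable lborel (\<lambda>z :: (real^'d) \<times> real. indicator (QT T) z * real n :: real)"
        using emeasure_QT_finite[of T, where 'd = 'd]
        by (intro integrable_mult_left integrable_real_indicator) auto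
      show "(\<lambda>z. indicator (QT T) z * a n z * \<phi> z) \<in> borel_measurable lborel"
        using a_meas[of n] by measurable
      show "AE z in lborel. norm (indicator (QT T) z * a n z * \<phi> z) \<le> norm (indicator (QT T) z * real n)"
      proof (rule AE_I2)
        fix z show "norm (indicator (QT T) z * a n z * \<phi> z) \<le> norm (indicator (QT T) z * real n)"
          using a[of z n] \<phi>01[of z] mult_mono[of "a n z" "real n" "\<phi> z" 1] by (auto simp: indicator_def)
      qed
    qed
    then have "(\<integral>\<^sup>+z. ennreal (indicator (QT T) z * a n z * \<phi> z) \<partial>lborel) = ennreal (LBINT z. indicator (QT T) z * a n z * \<phi> z)"
      by (rule nn_integral_eq_integral) (use a \<phi>01 in \<open>auto simp: indicator_def\<close>)
    also have "\<dots> \<le> ennreal L"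
      using le[of n] by (intro ennreal_leI) (simp add: set_lebesgue_integral_def mult.assoc)
    finally show ?thesis .
  qed
  have mono: "a m z \<le> a n z" if "z \<in> QT T" "m \<le> n" for m n z
  proof -
    have "ennreal (a m z) \<le> ennreal (a n z)"
      unfolding a_def young_measure_nn_integral_min(1)[OF \<nu> that(1) \<eta>(1,2), symmetric]
      using that(2) by (intro nn_integral_mono ennreal_leI) auto
    then show ?thesis using a[OF that(1)] by simp
  qed
  have "(\<integral>\<^sup>+z. indicator (Qcell \<times> {0..s}) z * (\<integral>\<^sup>+l. ennreal (\<eta> l) \<partial>\<nu> z) \<partial>lborel)
      \<le> (\<integral>\<^sup>+z. (SUP n. ennreal (indicator (QT T) z * a n z * \<phi> z)) \<partial>lborel)"
  proof (rule nn_integral_mono)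
    fix z :: "(real^'d) \<times> real"
    show "indicator (Qcell \<times> {0..s}) z * (\<integral>\<^sup>+l. ennreal (\<eta> l) \<partial>\<nu> z) \<le> (SUP n. ennreal (indicator (QT T) z * a n z * \<phi> z))"
    proof (cases "z \<in> Qcell \<times> {0..s}")
      case True
      then have "z \<in> QT T" using s by (auto simp: QT_def)
      with True show ?thesis
        using young_measure_nn_integral_min(2)[OF \<nu> \<open>z \<in> QT T\<close> \<eta>(1,2)] \<phi>1[of z] by (auto simp: a_def)
    qed simp
  qed
  also have "\<dots> = (SUP n. \<integral>\<^sup>+z. ennreal (indicator (QT T) z * a n z * \<phi> z) \<partial>lborel)"
  proof (rule nn_integral_monotone_convergence_SUP)
    show "incseq (\<lambda>n z. ennreal (indicator (QT T) z * a n z * \<phi> z))"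
      using mono \<phi>01 by (auto simp: incseq_def le_fun_def indicator_def intro!: ennreal_leI mult_right_mono)
    show "(\<lambda>z. ennreal (indicator (QT T) z * a n z * \<phi> z)) \<in> borel_measurable lborel" for n
      using a_meas[of n] by measurable
  qed
  also have "\<dots> \<le> ennreal L" by (rule SUP_least) (rule nle)
  finally show ?thesis by (simp add: le_less_trans)
qed

section \<open>Symmetry of the entropy Hessian and the flux\<close>

lemma bounded_linear_column: "bounded_linear (column \<alpha> :: real^'d^'n \<Rightarrow> real^'n)"
  unfolding linear_conv_bounded_linear[symmetric]
  by (rule linearI) (simp_all add: column_def vec_eq_iff)

lemma blinfun_vec_expansion:
  fixes A :: "(real^'n) \<Rightarrow>\<^sub>L real"
  shows "blinfun_apply A w = (\<Sum>j\<in>UNIV. w $ j * blinfun_apply A (axis j 1))"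
proof -
  have "w = (\<Sum>j\<in>UNIV. w $ j *\<^sub>R axis j 1)"
    by (auto simp: vec_eq_iff axis_def if_distrib[of "\<lambda>a. _ * a"] cong: if_cong)
  then have "blinfun_apply A w = blinfun_apply A (\<Sum>j\<in>UNIV. w $ j *\<^sub>R axis j 1)" by simp
  also have "\<dots> = (\<Sum>j\<in>UNIV. w $ j * blinfun_apply A (axis j 1))"
    by (simp only: blinfun.sum_right blinfun.scaleR_right real_scaleR_def)
  finally show ?thesis .
qed

text \<open>Differentiating the compatibility relation between \<open>D\<eta>\<close>,
  \<open>Df\<close> and \<open>Dq\<close> expresses the left side as a component of
  \<open>D2q\<close> minus \<open>D\<eta>\<close> applied to a column of \<open>D2f\<close>. Both
  are symmetric in \<open>h\<close> and \<open>k\<close>.\<close>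

lemma entropy_hessian_symmetrizes_flux:
  fixes f :: "real^'n \<Rightarrow> real^'d^'n" and \<eta> :: "real^'n \<Rightarrow> real" and q :: "real^'n \<Rightarrow> real^'d"
  assumes f: "\<And>x. (f has_derivative blinfun_apply (Df x)) (at x)"
      "\<And>x. (Df has_derivative blinfun_apply (D2f x)) (at x)" "continuous_on UNIV D2f"
    and \<eta>: "\<And>x. (\<eta> has_derivative blinfun_apply (D\<eta> x)) (at x)"
      "\<And>x. (D\<eta> has_derivative blinfun_apply (D2\<eta> x)) (at x)"
    and q: "\<And>x. (q has_derivative blinfun_apply (Dq x)) (at x)"
      "\<And>x. (Dq has_derivative blinfun_apply (D2q x)) (at x)" "continuous_on UNIV D2q"
    and flux: "\<And>l i \<alpha>. frechet_derivative q (at l) (axis i 1) $ \<alpha> =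
      (\<Sum>j\<in>UNIV. frechet_derivative \<eta> (at l) (axis j 1) * frechet_derivative f (at l) (axis i 1) $ j $ \<alpha>)"
  shows "blinfun_apply (blinfun_apply (D2\<eta> l) h) (column \<alpha> (blinfun_apply (Df l) k))
       = blinfun_apply (blinfun_apply (D2\<eta> l) k) (column \<alpha> (blinfun_apply (Df l) h))"
proof -
  have compat: "blinfun_apply (Dq l) k $ \<alpha> = blinfun_apply (D\<eta> l) (column \<alpha> (blinfun_apply (Df l) k))" for l k
  proof -
    \<comment> \<open>The hypothesis \<open>flux\<close> states the relation for basis directions;
      both sides are linear in \<open>k\<close>.\<close>
    have "(\<lambda>k. blinfun_apply (Dq l) k $ \<alpha>) = (\<lambda>k. blinfun_apply (D\<eta> l) (column \<alpha> (blinfun_apply (Df l) k)))"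
    proof (rule linear_eq_stdbasis)
      show "linear (\<lambda>k. blinfun_apply (Dq l) k $ \<alpha>)"
        by (rule bounded_linear.linear[OF bounded_linear_compose[OF bounded_linear_vec_nth blinfun.bounded_linear_right]])
      show "linear (\<lambda>k. blinfun_apply (D\<eta> l) (column \<alpha> (blinfun_apply (Df l) k)))"
        by (rule bounded_linear.linear)
           (intro bounded_linear_compose[OF blinfun.bounded_linear_right] bounded_linear_compose[OF bounded_linear_column] blinfun.bounded_linear_right)
      fix b :: "real^'n" assume "b \<in> Basis"
      then obtain i where b: "b = axis i 1" by (auto simp: Basis_vec_def)
      show "blinfun_apply (Dq l) b $ \<alpha> = blinfun_apply (D\<eta> l) (column \<alpha> (blinfun_apply (Df l) b))"
        using flux[of l i \<alpha>] unfolding b blinfun_vec_expansion[of "D\<eta> l" "column _ _"]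
        by (simp add: frechet_derivative_at[OF f(1), symmetric] frechet_derivative_at[OF \<eta>(1), symmetric]
            frechet_derivative_at[OF q(1), symmetric] column_def mult.commute)
    qed
    then show ?thesis by meson
  qed
  have key: "blinfun_apply (blinfun_apply (D2\<eta> l) h) (column \<alpha> (blinfun_apply (Df l) k))
      = blinfun_apply (blinfun_apply (D2q l) h) k $ \<alpha>
        - blinfun_apply (D\<eta> l) (column \<alpha> (blinfun_apply (blinfun_apply (D2f l) h) k))" for h k
  proof -
    have Dfk: "((\<lambda>l. blinfun_apply (Df l) k) has_derivative (\<lambda>h. blinfun_apply (blinfun_apply (D2f l) h) k)) (at l)"
      by (rule bounded_linear.has_derivative[OF blinfun.bounded_linear_left f(2)])
    have 1: "((\<lambda>l. blinfun_apply (Dq l) k $ \<alpha>) has_derivative (\<lambda>h. blinfun_apply (blinfun_apply (D2q l) h) k $ \<alpha>)) (at l)"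
      by (rule bounded_linear.has_derivative[OF bounded_linear_vec_nth bounded_linear.has_derivative[OF blinfun.bounded_linear_left q(2)]])
    have 2: "((\<lambda>l. blinfun_apply (D\<eta> l) (column \<alpha> (blinfun_apply (Df l) k))) has_derivative
        (\<lambda>h. blinfun_apply (D\<eta> l) (column \<alpha> (blinfun_apply (blinfun_apply (D2f l) h) k))
           + blinfun_apply (blinfun_apply (D2\<eta> l) h) (column \<alpha> (blinfun_apply (Df l) k)))) (at l)"
      by (rule bounded_bilinear.FDERIV[OF bounded_bilinear_blinfun_apply \<eta>(2) bounded_linear.has_derivative[OF bounded_linear_column Dfk]])
    from has_derivative_unique[OF 1 2[folded compat]] show ?thesis
      by (simp add: fun_eq_iff)
  qed
  show ?thesis
    unfolding key using second_derivative_symmetric[OF f] second_derivative_symmetric[OF q] by simp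
qed

section \<open>Integration by parts on a time strip\<close>

lemma C1_map_vec_nth: "C1_map g \<Longrightarrow> C1_map (\<lambda>z. g z $ i)"
  by (rule C1_map_bounded_linear[OF bounded_linear_vec_nth])

lemma frechet_derivative_eq_0_outside:
  fixes w :: "(real^'d) \<times> real \<Rightarrow> real"
  assumes w: "\<And>x t. t \<notin> {0..s} \<Longrightarrow> w (x, t) = 0" and z: "snd z \<notin> {0..s}"
  shows "frechet_derivative w (at z) e = 0"
proof -
  have "open (UNIV \<times> - {0..s} :: ((real^'d) \<times> real) set)"
    by (intro open_Times open_Compl) auto
  then have "(w has_derivative (\<lambda>h. 0)) (at z)"
    by (rule has_derivative_transform_within_open[OF has_derivative_const]) (use w z in \<open>auto simp: mem_Times_iff\<close>)
  then show ?thesis by (simp add: frechet_derivative_at[symmetric])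
qed

lemma torus_strip_integral_derivative_eq_0:
  fixes w :: "(real^'d) \<times> real \<Rightarrow> real"
  assumes w: "C1_map w" "periodic_x w" and supp: "\<And>x t. t \<notin> {0..s} \<Longrightarrow> w (x, t) = 0"
  shows "(LBINT z. indicator (Qcell \<times> {0..s}) z * d_t w z) = 0"
    and "(LBINT z. indicator (Qcell \<times> {0..s}) z * d_x \<alpha> w z) = 0"
proof -
  have *: "(LBINT z. indicator (Qcell \<times> {0..s}) z * frechet_derivative w (at z) e)
      = (LINT z:Qcell \<times> UNIV|lborel. frechet_derivative w (at z) e)" for e
    unfolding set_lebesgue_integral_def
  proof (rule Bochner_Integration.integral_cong[OF refl])
    fix z :: "(real^'d) \<times> real"
    show "indicator (Qcell \<times> {0..s}) z * frechet_derivative w (at z) e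
        = indicator (Qcell \<times> UNIV) z *\<^sub>R frechet_derivative w (at z) e"
      using frechet_derivative_eq_0_outside[of s w z e, OF supp]
      by (cases "snd z \<in> {0..s}") (auto simp: indicator_def mem_Times_iff)
  qed
  show "(LBINT z. indicator (Qcell \<times> {0..s}) z * d_t w z) = 0"
    unfolding d_t_def * by (rule torus_integral_derivative_eq_0[OF w supp]) auto
  show "(LBINT z. indicator (Qcell \<times> {0..s}) z * d_x \<alpha> w z) = 0"
    unfolding d_x_def * by (rule torus_integral_derivative_eq_0[OF w supp]) auto
qed

lemma integrable_strip_mult_continuous:
  fixes g a :: "(real^'d) \<times> real \<Rightarrow> real"
  assumes g: "integrable lborel (\<lambda>z. indicator (Qcell \<times> {0..s}) z * g z)" and a: "continuous_on UNIV a"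
  shows "integrable lborel (\<lambda>z. indicator (Qcell \<times> {0..s}) z * (g z * a z))"
proof -
  obtain R where R: "\<And>z. z \<in> (Qcell :: (real^'d) set) \<times> {0..s} \<Longrightarrow> norm z \<le> R"
    using Qcell_strip_bounded[of 0 s] unfolding bounded_iff by blast
  obtain B where B: "0 \<le> B" "\<And>z. norm z \<le> R \<Longrightarrow> norm (a z) \<le> B"
    using continuous_on_bounded_cball[OF a] by blast
  have [measurable]: "a \<in> borel_measurable borel" using a by (rule borel_measurable_continuous_onI)
  have "integrable lborel (\<lambda>z. (indicator (Qcell \<times> {0..s}) z * g z) * a z)"
  proof (rule Bochner_Integration.integrable_bound[OF integrable_mult_right[OF g, of B]])
    show "AE z in lborel. norm (indicator (Qcell \<times> {0..s}) z * g z * a z) \<le> norm (B * (indicator (Qcell \<times> {0..s}) z * g z))"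
    proof (rule AE_I2)
      fix z :: "(real^'d) \<times> real"
      show "norm (indicator (Qcell \<times> {0..s}) z * g z * a z) \<le> norm (B * (indicator (Qcell \<times> {0..s}) z * g z))"
        using R[of z] B(1) B(2)[of z] mult_right_mono[of "\<bar>a z\<bar>" B "\<bar>g z\<bar>"]
        by (cases "z \<in> Qcell \<times> {0..s}") (auto simp: abs_mult mult.commute)
    qed
  qed (use borel_measurable_integrable[OF g] in measurable)
  then show ?thesis by (simp add: mult.assoc)
qed

lemma integrable_strip_continuous:
  fixes a :: "(real^'d) \<times> real \<Rightarrow> real"
  assumes a: "continuous_on UNIV a"
  shows "integrable lborel (\<lambda>z. indicator (Qcell \<times> {0..s}) z * a z)"
proof -
  have "integrable lborel (\<lambda>z :: (real^'d) \<times> real. indicator (Qcell \<times> {0..s}) z * 1 :: real)" 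
    using emeasure_Qcell_strip_finite[of 0 s, where 'd = 'd] by simp
  from integrable_strip_mult_continuous[OF this a] show ?thesis by simp
qed

section \<open>Smooth approximations of the Lipschitz solution\<close>

text \<open>\<open>v k\<close> plays the role of a mollification of \<open>vb\<close>, and \<open>vb\<close> that of the Lipschitz solution
  extended to all times by clamping the time variable to \<open>[0, T]\<close>.\<close>
locale lipschitz_solution =
  fixes f :: "real^'n \<Rightarrow> real^'d^'n" and Df D2f
    and \<eta> :: "real^'n \<Rightarrow> real" and D\<eta> D2\<eta>
    and T L M :: real
    and vb :: "(real^'d) \<times> real \<Rightarrow> real^'n" and v :: "nat \<Rightarrow> (real^'d) \<times> real \<Rightarrow> real^'n"
  assumes f_deriv: "\<And>x. (f has_derivative blinfun_apply (Df x)) (at x)"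
    and Df_deriv: "\<And>x. (Df has_derivative blinfun_apply (D2f x)) (at x)"
    and eta_deriv: "\<And>x. (\<eta> has_derivative blinfun_apply (D\<eta> x)) (at x)"
    and Deta_deriv: "\<And>x. (D\<eta> has_derivative blinfun_apply (D2\<eta> x)) (at x)"
    and D2eta_cont: "continuous_on UNIV D2\<eta>"
    and eta_sym: "\<And>l h k \<alpha>. blinfun_apply (blinfun_apply (D2\<eta> l) h) (column \<alpha> (blinfun_apply (Df l) k))
       = blinfun_apply (blinfun_apply (D2\<eta> l) k) (column \<alpha> (blinfun_apply (Df l) h))"
    and T_pos: "0 < T"
    and vb_lip: "L-lipschitz_on UNIV vb"
    and vb_weak: "\<And>\<psi> :: (real^'d) \<times> real \<Rightarrow> real^'n. C1c_QT T \<psi> \<Longrightarrow>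
          (LINT z:QT T|lborel. (\<Sum>i\<in>UNIV. d_t \<psi> z $ i * vb z $ i
               + (\<Sum>\<alpha>\<in>UNIV. d_x \<alpha> \<psi> z $ i * f (vb z) $ i $ \<alpha>)))
          + (LINT x:Qcell|lborel. (\<Sum>i\<in>UNIV. \<psi> (x, 0) $ i * vb (x, 0) $ i)) = 0"
    and v_C1: "\<And>k. C1_map (v k)"
    and v_per: "\<And>k. periodic_x (v k)"
    and v_lip: "\<And>k. L-lipschitz_on UNIV (v k)"
    and v_lim: "\<And>z. (\<lambda>k. v k z) \<longlonglongrightarrow> vb z"
    and v_bdd: "\<And>k z. z \<in> QT T \<Longrightarrow> norm (v k z) \<le> M"
    and vb_bdd: "\<And>z. z \<in> QT T \<Longrightarrow> norm (vb z) \<le> M"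
begin

lemma L_nonneg: "0 \<le> L"
  using vb_lip by (rule lipschitz_on_nonneg)

lemma conts: "continuous_on S f" "continuous_on S Df" "continuous_on S \<eta>" "continuous_on S D\<eta>"
  by (auto intro!: continuous_at_imp_continuous_on has_derivative_continuous[OF f_deriv]
      has_derivative_continuous[OF Df_deriv] has_derivative_continuous[OF eta_deriv]
      has_derivative_continuous[OF Deta_deriv])

lemma vb_cont: "continuous_on S vb"
  using lipschitz_on_continuous_on[OF vb_lip] by (rule continuous_on_subset) simp

lemma f_C1: "C1_map f"
  unfolding C1_map_def using f_deriv conts(2) by blast

lemma v_deriv_bound: "norm (d_t (v k) z) \<le> L" "norm (d_x \<alpha> (v k) z) \<le> L"
  unfolding d_t_def d_x_def
  using norm_derivative_le_lipschitz[OF C1_map_has_derivative[OF v_C1] v_lip, of k z "(0, 1)"]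
    norm_derivative_le_lipschitz[OF C1_map_has_derivative[OF v_C1] v_lip, of k z "(axis \<alpha> 1, 0)"]
  by (simp_all add: norm_Pair)

lemma d_cont: 
  assumes "C1_map \<psi>"
  shows "continuous_on S (d_t \<psi>)" "continuous_on S (d_x \<alpha> \<psi>)"
  unfolding d_t_def[abs_def] d_x_def[abs_def] by (rule C1_map_continuous_derivative[OF assms])+

text \<open>The defect of \<open>v k\<close> in the quasilinear form of the system. In this form
  \<open>Df\<close> appears explicitly and can be moved across \<open>D2\<eta>\<close> by
  \<open>eta_sym\<close>.\<close>

definition residual :: "nat \<Rightarrow> (real^'d) \<times> real \<Rightarrow> real^'n" where
  "residual k z = d_t (v k) z + (\<Sum>\<alpha>\<in>UNIV. column \<alpha> (Df (v k z) (d_x \<alpha> (v k) z)))"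

lemma residual_cont: "continuous_on S (residual k)"
  unfolding residual_def
  by (intro continuous_intros d_cont v_C1 bounded_linear.continuous_on[OF bounded_linear_column]
      continuous_on_compose2[OF conts(2)[of UNIV] C1_map_continuous[OF v_C1]]) auto

text \<open>The common Lipschitz constant bounds every derivative of every \<open>v k\<close>.
  Independence of \<open>k\<close> is what \<open>weak_null_L1\<close> and the dominated limits
  later rely on.\<close>

lemma residual_bounded:
  obtains K where "0 \<le> K" "\<And>k z. z \<in> QT T \<Longrightarrow> norm (residual k z) \<le> K"
proof -
  obtain a where a: "0 \<le> a" "\<And>x. norm x \<le> M \<Longrightarrow> norm (Df x) \<le> a"
    using continuous_on_bounded_cball[OF conts(2)] by blast
  have "\<forall>\<alpha>. \<exists>b. \<forall>F :: real^'d^'n. norm (column \<alpha> F) \<le> norm F * b"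
    using bounded_linear.bounded[OF bounded_linear_column] by blast
  then obtain b where b: "\<And>\<alpha> (F :: real^'d^'n). norm (column \<alpha> F) \<le> norm F * b \<alpha>" by metis
  show thesis
  proof (rule that)
    show "0 \<le> L + (\<Sum>\<alpha>\<in>(UNIV :: 'd set). a * L * \<bar>b \<alpha>\<bar>)"
      using a L_nonneg by (intro add_nonneg_nonneg sum_nonneg mult_nonneg_nonneg) auto
    fix k and z :: "(real^'d) \<times> real" assume z: "z \<in> QT T"
    have "norm (column \<alpha> (Df (v k z) (d_x \<alpha> (v k) z))) \<le> a * L * \<bar>b \<alpha>\<bar>" for \<alpha>
    proof -
      have "norm (Df (v k z) (d_x \<alpha> (v k) z)) \<le> a * L"
        by (rule order_trans[OF norm_blinfun mult_mono]) (use a v_bdd[OF z] v_deriv_bound in auto)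
      then have "norm (Df (v k z) (d_x \<alpha> (v k) z)) * \<bar>b \<alpha>\<bar> \<le> a * L * \<bar>b \<alpha>\<bar>"
        by (rule mult_right_mono) simp
      moreover have "norm (Df (v k z) (d_x \<alpha> (v k) z)) * b \<alpha> \<le> norm (Df (v k z) (d_x \<alpha> (v k) z)) * \<bar>b \<alpha>\<bar>"
        by (rule mult_left_mono) auto
      ultimately show ?thesis
        using b[of \<alpha> "Df (v k z) (d_x \<alpha> (v k) z)"] by linarith
    qed
    then show "norm (residual k z) \<le> L + (\<Sum>\<alpha>\<in>(UNIV :: 'd set). a * L * \<bar>b \<alpha>\<bar>)"
      unfolding residual_def by (intro norm_triangle_mono v_deriv_bound order_trans[OF norm_sum sum_mono])
  qed
qed

text \<open>The tested residual equals exact derivatives minus the integrand of the weak formulation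
  at \<open>v k\<close>. The former integrate to zero over the torus; the latter contains no
  derivative of \<open>v k\<close>.\<close>

lemma residual_product_rule:
  assumes \<Phi>: "C1_map \<Phi>"
  shows "residual k z $ i * \<Phi> z
     = d_t (\<lambda>z. v k z $ i * \<Phi> z) z + (\<Sum>\<alpha>\<in>UNIV. d_x \<alpha> (\<lambda>z. f (v k z) $ i $ \<alpha> * \<Phi> z) z)
       - (v k z $ i * d_t \<Phi> z + (\<Sum>\<alpha>\<in>UNIV. f (v k z) $ i $ \<alpha> * d_x \<alpha> \<Phi> z))"
proof -
  let ?Dv = "frechet_derivative (v k) (at z)" and ?D\<Phi> = "frechet_derivative \<Phi> (at z)"
  have Dv: "(v k has_derivative ?Dv) (at z)" and D\<Phi>: "(\<Phi> has_derivative ?D\<Phi>) (at z)"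
    by (rule C1_map_has_derivative[OF v_C1] C1_map_has_derivative[OF \<Phi>])+
  have "((\<lambda>z. v k z $ i * \<Phi> z) has_derivative (\<lambda>h. v k z $ i * ?D\<Phi> h + ?Dv h $ i * \<Phi> z)) (at z)"
    by (rule has_derivative_mult[OF bounded_linear.has_derivative[OF bounded_linear_vec_nth Dv] D\<Phi>])
  then have 1: "d_t (\<lambda>z. v k z $ i * \<Phi> z) z = v k z $ i * d_t \<Phi> z + d_t (v k) z $ i * \<Phi> z"
    unfolding d_t_def by (simp add: frechet_derivative_at[symmetric])
  have Df: "((\<lambda>z. f (v k z)) has_derivative (\<lambda>h. Df (v k z) (?Dv h))) (at z)"
    by (rule has_derivative_compose[OF Dv f_deriv])
  have Df\<alpha>: "((\<lambda>z. f (v k z) $ i $ \<alpha> * \<Phi> z) has_derivative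
      (\<lambda>h. f (v k z) $ i $ \<alpha> * ?D\<Phi> h + Df (v k z) (?Dv h) $ i $ \<alpha> * \<Phi> z)) (at z)" for \<alpha>
    by (rule has_derivative_mult[OF bounded_linear.has_derivative[OF bounded_linear_vec_nth
          bounded_linear.has_derivative[OF bounded_linear_vec_nth Df]] D\<Phi>])
  have 2: "d_x \<alpha> (\<lambda>z. f (v k z) $ i $ \<alpha> * \<Phi> z) z
      = f (v k z) $ i $ \<alpha> * d_x \<alpha> \<Phi> z + Df (v k z) (d_x \<alpha> (v k) z) $ i $ \<alpha> * \<Phi> z" for \<alpha>
    unfolding d_x_def by (simp add: frechet_derivative_at[OF Df\<alpha>, symmetric])
  show ?thesis
    unfolding 1 2 residual_def
    by (simp add: sum.distrib column_def distrib_right sum_distrib_right)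
qed

text \<open>Testing with \<open>\<Phi>\<close> times one basis vector isolates a single equation.
  The initial term drops out because \<open>\<Phi>\<close> vanishes at time zero.\<close>

lemma vb_weak_scalar:
  assumes s: "s < T" and \<Phi>: "C1_map \<Phi>" "periodic_x \<Phi>" "\<And>x t. t \<le> 0 \<or> s \<le> t \<Longrightarrow> \<Phi> (x, t) = 0"
  shows "(LBINT z. indicator (Qcell \<times> {0..s}) z *
      (vb z $ i * d_t \<Phi> z + (\<Sum>\<alpha>\<in>UNIV. f (vb z) $ i $ \<alpha> * d_x \<alpha> \<Phi> z))) = 0"
proof -
  define \<psi> :: "(real^'d) \<times> real \<Rightarrow> real^'n" where "\<psi> z = \<Phi> z *\<^sub>R axis i 1" for z
  have \<psi>: "C1c_QT T \<psi>"
    unfolding C1c_QT_def \<psi>_def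
    using \<Phi> s by (auto intro!: C1_map_scaleR C1_map_const exI[of _ s] simp: periodic_x_def)
  have D: "frechet_derivative \<psi> (at z) h = frechet_derivative \<Phi> (at z) h *\<^sub>R axis i 1" for z h
  proof -
    have "(\<psi> has_derivative (\<lambda>h. frechet_derivative \<Phi> (at z) h *\<^sub>R axis i 1)) (at z)"
      unfolding \<psi>_def by (rule bounded_linear.has_derivative[OF bounded_linear_scaleR_left C1_map_has_derivative[OF \<Phi>(1)]])
    then show ?thesis by (simp add: frechet_derivative_at[symmetric])
  qed
  have zero: "frechet_derivative \<Phi> (at z) h = 0" if "snd z \<notin> {0..s}" for z h
    by (rule frechet_derivative_eq_0_outside[OF _ that]) (use \<Phi>(3) in auto)
  have sum: "(\<Sum>j\<in>UNIV. (a *\<^sub>R axis i 1 :: real^'n) $ j * g j + (\<Sum>\<alpha>\<in>UNIV. (b \<alpha> *\<^sub>R axis i 1 :: real^'n) $ j * h j \<alpha>))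
      = g i * a + (\<Sum>\<alpha>\<in>UNIV. h i \<alpha> * b \<alpha>)" for a b g and h :: "'n \<Rightarrow> 'd \<Rightarrow> real"
  proof -
    have "(a *\<^sub>R axis i 1 :: real^'n) $ j * g j + (\<Sum>\<alpha>\<in>UNIV. (b \<alpha> *\<^sub>R axis i 1 :: real^'n) $ j * h j \<alpha>)
        = (if j = i then g i * a + (\<Sum>\<alpha>\<in>UNIV. h i \<alpha> * b \<alpha>) else 0)" for j
      by (auto simp: axis_def mult.commute)
    then show ?thesis by simp
  qed
  have "(LINT z:QT T|lborel. (\<Sum>j\<in>UNIV. d_t \<psi> z $ j * vb z $ j + (\<Sum>\<alpha>\<in>UNIV. d_x \<alpha> \<psi> z $ j * f (vb z) $ j $ \<alpha>))) = 0"
    using vb_weak[OF \<psi>] \<Phi>(3)[of 0] by (simp add: \<psi>_def[of "(_, 0)"])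
  also have "(LINT z:QT T|lborel. (\<Sum>j\<in>UNIV. d_t \<psi> z $ j * vb z $ j + (\<Sum>\<alpha>\<in>UNIV. d_x \<alpha> \<psi> z $ j * f (vb z) $ j $ \<alpha>)))
    = (LBINT z. indicator (Qcell \<times> {0..s}) z *
      (vb z $ i * d_t \<Phi> z + (\<Sum>\<alpha>\<in>UNIV. f (vb z) $ i $ \<alpha> * d_x \<alpha> \<Phi> z)))"
    unfolding set_lebesgue_integral_def d_t_def d_x_def D sum
  proof (rule Bochner_Integration.integral_cong[OF refl])
    fix z :: "(real^'d) \<times> real"
    show "indicator (QT T) z *\<^sub>R (vb z $ i * frechet_derivative \<Phi> (at z) (0, 1)
          + (\<Sum>\<alpha>\<in>UNIV. f (vb z) $ i $ \<alpha> * frechet_derivative \<Phi> (at z) (axis \<alpha> 1, 0)))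
        = indicator (Qcell \<times> {0..s}) z * (vb z $ i * frechet_derivative \<Phi> (at z) (0, 1)
          + (\<Sum>\<alpha>\<in>UNIV. f (vb z) $ i $ \<alpha> * frechet_derivative \<Phi> (at z) (axis \<alpha> 1, 0)))"
      using zero[of z] s by (cases "snd z \<in> {0..s}") (auto simp: QT_def indicator_def mem_Times_iff)
  qed
  finally show ?thesis .
qed

lemma f_bounded:
  obtains a where "0 \<le> a" "\<And>k z i \<alpha>. z \<in> QT T \<Longrightarrow> \<bar>f (v k z) $ i $ \<alpha>\<bar> \<le> a"
proof -
  obtain a where a: "0 \<le> a" "\<And>x. norm x \<le> M \<Longrightarrow> norm (f x) \<le> a"
    using continuous_on_bounded_cball[OF conts(1)] by blast
  have comp: "\<bar>F $ i $ \<alpha>\<bar> \<le> norm F" for F :: "real^'d^'n" and i \<alpha>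
    using component_le_norm_cart[of "F $ i" \<alpha>] Finite_Cartesian_Product.norm_nth_le[of F i] by linarith
  show thesis
    by (rule that[OF a(1)], rule order_trans[OF comp a(2)[OF v_bdd]])
qed

text \<open>Integration by parts moves all derivatives onto \<open>\<Phi>\<close>. The remaining
  integrand is continuous in the values of \<open>v k\<close>, so pointwise convergence with a
  common bound leads to the weak formulation at \<open>vb\<close>, which is zero.\<close>

lemma residual_test_null:
  assumes s: "s < T" and \<Phi>: "C1_map \<Phi>" "periodic_x \<Phi>" "\<And>x t. t \<le> 0 \<or> s \<le> t \<Longrightarrow> \<Phi> (x, t) = 0"
  shows "(\<lambda>k. LBINT z. indicator (Qcell \<times> {0..s}) z * residual k z $ i * \<Phi> z) \<longlonglongrightarrow> 0"
proof -
  let ?I = "indicator (Qcell \<times> {0..s}) :: (real^'d) \<times> real \<Rightarrow> real"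
  define F where "F w z = w z $ i * d_t \<Phi> z + (\<Sum>\<alpha>\<in>UNIV. f (w z) $ i $ \<alpha> * d_x \<alpha> \<Phi> z)" for w :: "(real^'d) \<times> real \<Rightarrow> real^'n" and z
  have C1v: "C1_map (\<lambda>z. v k z $ i * \<Phi> z)" for k
    by (intro C1_map_mult C1_map_vec_nth v_C1 \<Phi>(1))
  have C1f: "C1_map (\<lambda>z. f (v k z) $ i $ \<alpha> * \<Phi> z)" for k \<alpha>
    by (intro C1_map_mult C1_map_vec_nth C1_map_compose[OF f_C1] v_C1 \<Phi>(1))
  have F_cont: "continuous_on UNIV (F w)" if "continuous_on UNIV w" for w
    unfolding F_def
    by (intro continuous_intros d_cont \<Phi>(1) that continuous_on_compose2[OF conts(1)[of UNIV] that]) auto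
  have supp: "\<Phi> (x, t) = 0" if "t \<notin> {0..s}" for x t using \<Phi>(3) that by auto
  have eq: "(LBINT z. ?I z * residual k z $ i * \<Phi> z) = - (LBINT z. ?I z * F (v k) z)" for k
  proof -
    have ibp_t: "(LBINT z. ?I z * d_t (\<lambda>z. v k z $ i * \<Phi> z) z) = 0"
      by (rule torus_strip_integral_derivative_eq_0(1)[OF C1v])
         (use \<Phi>(2) v_per supp in \<open>auto simp: periodic_x_def\<close>)
    have ibp_x: "(LBINT z. ?I z * d_x \<alpha> (\<lambda>z. f (v k z) $ i $ \<alpha> * \<Phi> z) z) = 0" for \<alpha>
      by (rule torus_strip_integral_derivative_eq_0(2)[OF C1f])
         (use \<Phi>(2) v_per supp in \<open>auto simp: periodic_x_def\<close>)
    have it: "integrable lborel (\<lambda>z. ?I z * d_t (\<lambda>z. v k z $ i * \<Phi> z) z)"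
      "integrable lborel (\<lambda>z. ?I z * d_x \<alpha> (\<lambda>z. f (v k z) $ i $ \<alpha> * \<Phi> z) z)"
      "integrable lborel (\<lambda>z. ?I z * F (v k) z)" for \<alpha>
      by (intro integrable_strip_continuous d_cont C1v C1f F_cont C1_map_continuous v_C1)+
    have "(LBINT z. ?I z * residual k z $ i * \<Phi> z) = (LBINT z. ?I z * d_t (\<lambda>z. v k z $ i * \<Phi> z) z
        + (\<Sum>\<alpha>\<in>UNIV. ?I z * d_x \<alpha> (\<lambda>z. f (v k z) $ i $ \<alpha> * \<Phi> z) z) - ?I z * F (v k) z)"
      using residual_product_rule[OF \<Phi>(1)]
      by (intro Bochner_Integration.integral_cong) (simp_all add: F_def mult.assoc indicator_def)
    also have "\<dots> = (LBINT z. ?I z * d_t (\<lambda>z. v k z $ i * \<Phi> z) z)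
        + (\<Sum>\<alpha>\<in>UNIV. LBINT z. ?I z * d_x \<alpha> (\<lambda>z. f (v k z) $ i $ \<alpha> * \<Phi> z) z) - (LBINT z. ?I z * F (v k) z)"
      by (subst Bochner_Integration.integral_diff Bochner_Integration.integral_add Bochner_Integration.integral_sum;
          (intro Bochner_Integration.integrable_add Bochner_Integration.integrable_sum it)?)+ (rule refl)
    finally show ?thesis by (simp add: ibp_t ibp_x)
  qed
  obtain a where a: "0 \<le> a" "\<And>k z i \<alpha>. z \<in> QT T \<Longrightarrow> \<bar>f (v k z) $ i $ \<alpha>\<bar> \<le> a"
    using f_bounded by blast
  define G where "G z = M * \<bar>d_t \<Phi> z\<bar> + (\<Sum>\<alpha>\<in>UNIV. a * \<bar>d_x \<alpha> \<Phi> z\<bar>)" for z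
  have "(\<lambda>k. LBINT z. ?I z * F (v k) z) \<longlonglongrightarrow> (LBINT z. ?I z * F vb z)"
  proof (rule integral_dominated_convergence[where w = "\<lambda>z. ?I z * G z"])
    show "(\<lambda>z. ?I z * F vb z) \<in> borel_measurable lborel"
      by (rule borel_measurable_integrable[OF integrable_strip_continuous[OF F_cont[OF vb_cont]]])
    show "(\<lambda>z. ?I z * F (v k) z) \<in> borel_measurable lborel" for k
      by (rule borel_measurable_integrable[OF integrable_strip_continuous[OF F_cont[OF C1_map_continuous[OF v_C1]]]])
    show "integrable lborel (\<lambda>z. ?I z * G z)"
      unfolding G_def by (intro integrable_strip_continuous continuous_intros d_cont \<Phi>(1))
    have f_at: "isCont f l" for l using conts(1)[of UNIV] by (simp add: continuous_on_eq_continuous_at)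
    show "AE z in lborel. (\<lambda>k. ?I z * F (v k) z) \<longlonglongrightarrow> ?I z * F vb z"
      unfolding F_def
      by (intro AE_I2 tendsto_intros v_lim isCont_tendsto_compose[OF f_at])
    show "AE z in lborel. norm (?I z * F (v k) z) \<le> ?I z * G z" for k
    proof (rule AE_I2)
      fix z :: "(real^'d) \<times> real"
      show "norm (?I z * F (v k) z) \<le> ?I z * G z"
      proof (cases "z \<in> Qcell \<times> {0..s}")
        case True
        then have z: "z \<in> QT T" using s by (auto simp: QT_def)
        have "\<bar>v k z $ i\<bar> \<le> M" using component_le_norm_cart[of "v k z" i] v_bdd[OF z, of k] by linarith
        then have "\<bar>F (v k) z\<bar> \<le> G z"
          unfolding F_def G_def
          using a(2)[OF z]
          by (intro order_trans[OF abs_triangle_ineq add_mono] order_trans[OF sum_abs sum_mono])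
             (auto simp: abs_mult intro!: mult_right_mono)
        then show ?thesis using True by simp
      qed simp
    qed
  qed
  also have "(LBINT z. ?I z * F vb z) = 0"
    unfolding F_def by (rule vb_weak_scalar[OF s \<Phi>])
  finally show ?thesis unfolding eq using tendsto_minus[of _ 0] by simp
qed

lemma residual_weak_null:
  assumes s: "0 < s" "s < T" and \<phi>: "integrable lborel \<phi>"
  shows "(\<lambda>k. LBINT z. indicator (Qcell \<times> {0..s}) z * residual k z $ i * \<phi> z) \<longlonglongrightarrow> 0"
proof -
  obtain K where K: "0 \<le> K" "\<And>k z. z \<in> QT T \<Longrightarrow> norm (residual k z) \<le> K"
    using residual_bounded by blast
  show ?thesis
  proof (rule weak_null_L1[OF s(1)])
    show "(\<lambda>z. residual k z $ i) \<in> borel_measurable lborel" for k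
      using borel_measurable_continuous_onI[OF continuous_on_component[OF residual_cont]] by simp
    show "\<bar>residual k z $ i\<bar> \<le> K" if "z \<in> Qcell \<times> {0..s}" for k z
    proof -
      have "z \<in> QT T" using that s by (auto simp: QT_def)
      then show ?thesis using K(2)[of z k] component_le_norm_cart[of "residual k z" i] by linarith
    qed
    show "(\<lambda>k. LBINT z. indicator (Qcell \<times> {0..s}) z * residual k z $ i * \<Phi> z) \<longlonglongrightarrow> 0"
      if "C1_map \<Phi>" "periodic_x \<Phi>" "\<And>x t. t \<le> 0 \<or> s \<le> t \<Longrightarrow> \<Phi> (x, t) = 0" for \<Phi>
      by (rule residual_test_null[OF s(2) that])
  qed (rule \<phi>)
qed

end

section \<open>Relative entropy estimate\<close>

lemma bounded_linear_axis: "bounded_linear (axis i :: 'b::euclidean_space \<Rightarrow> 'b^'n)"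
  unfolding linear_conv_bounded_linear[symmetric]
  by (rule linearI) (auto simp: axis_def vec_eq_iff)

lemma integrable_vecI:
  fixes X :: "'a \<Rightarrow> 'b::euclidean_space^'n"
  assumes "\<And>i. integrable M (\<lambda>z. X z $ i)"
  shows "integrable M X"
proof -
  have "X z = (\<Sum>i\<in>UNIV. axis i (X z $ i))" for z
    by (simp add: vec_eq_iff axis_def)
  then have "integrable M X \<longleftrightarrow> integrable M (\<lambda>z. \<Sum>i\<in>UNIV. axis i (X z $ i) :: 'b^'n)" by simp
  then show ?thesis
    using assms by (auto intro!: integrable_bounded_linear[OF bounded_linear_axis])
qed

lemma measurable_blinfun_apply:
  fixes A :: "'a::euclidean_space \<Rightarrow> 'b::euclidean_space \<Rightarrow>\<^sub>L 'c::euclidean_space"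
  assumes A: "continuous_on UNIV A" and w: "w \<in> borel_measurable M" and y: "y \<in> borel_measurable M"
  shows "(\<lambda>z. blinfun_apply (A (w z)) (y z)) \<in> borel_measurable M"
  by (rule borel_measurable_continuous_Pair[OF w y])
     (intro continuous_intros continuous_on_compose2[OF A], auto)

lemma measurable_blinfun_apply2:
  fixes A :: "'a::euclidean_space \<Rightarrow> 'b::euclidean_space \<Rightarrow>\<^sub>L 'b \<Rightarrow>\<^sub>L real"
  assumes A: "continuous_on UNIV A" and w: "w \<in> borel_measurable M"
    and r: "r \<in> borel_measurable M" and y: "y \<in> borel_measurable M"
  shows "(\<lambda>z. blinfun_apply (blinfun_apply (A (w z)) (r z)) (y z)) \<in> borel_measurable M"
proof -
  have "(\<lambda>z. (r z, y z)) \<in> borel_measurable M" using r y by (rule borel_measurable_Pair)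
  moreover have "continuous_on UNIV (\<lambda>x. blinfun_apply (blinfun_apply (A (fst x)) (fst (snd x))) (snd (snd x)))"
    by (intro continuous_intros continuous_on_compose2[OF A]) auto
  ultimately show ?thesis
    using borel_measurable_continuous_Pair[OF w, of "\<lambda>z. (r z, y z)"
        "\<lambda>l ry. blinfun_apply (blinfun_apply (A l) (fst ry)) (snd ry)"] by simp
qed

text \<open>The concentration measure is absent from \<open>mv_entropy\<close>: for nonincreasing \<open>\<theta>\<close> its contribution
  is nonpositive and can be discarded. The initial data of both solutions are already identified.\<close>
locale measure_valued_comparison = lipschitz_solution f Df D2f \<eta> D\<eta> D2\<eta> T L M vb v
  for f :: "real^'n \<Rightarrow> real^'d^'n" and Df D2f
    and \<eta> :: "real^'n \<Rightarrow> real" and D\<eta> D2\<eta>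
    and T L M :: real
    and vb :: "(real^'d) \<times> real \<Rightarrow> real^'n" and v :: "nat \<Rightarrow> (real^'d) \<times> real \<Rightarrow> real^'n" +
  fixes \<nu> :: "(real^'d) \<times> real \<Rightarrow> (real^'n) measure" and c0 B :: real
  assumes D2f_cont: "continuous_on UNIV D2f"
    and c0_pos: "0 < c0"
    and eta_quad: "\<And>x y. c0 * (norm (y - x))\<^sup>2 \<le> \<eta> y - \<eta> x - blinfun_apply (D\<eta> x) (y - x)"
    and eta_nonneg: "\<And>l. 0 \<le> \<eta> l"
    and f_growth: "\<And>l. norm (f l) \<le> B + \<eta> l"
    and id_growth: "\<And>l. norm l \<le> B * (1 + \<eta> l)"
    and nu_young: "young_measure (QT T) \<nu>"
    and eta_finite: "\<And>s. s < T \<Longrightarrow>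
      (\<integral>\<^sup>+z. indicator (Qcell \<times> {0..s}) z * (\<integral>\<^sup>+l. ennreal (\<eta> l) \<partial>\<nu> z) \<partial>lborel) < \<infinity>"
    and mv_weak: "\<And>\<psi> :: (real^'d) \<times> real \<Rightarrow> real^'n. C1c_QT T \<psi> \<Longrightarrow>
          (LINT z:QT T|lborel. (\<Sum>i\<in>UNIV. (\<integral>l. l $ i \<partial>(\<nu> z)) * d_t \<psi> z $ i
               + (\<Sum>\<alpha>\<in>UNIV. d_x \<alpha> \<psi> z $ i * (\<integral>l. f l $ i $ \<alpha> \<partial>(\<nu> z)))))
          + (LINT x:Qcell|lborel. (\<Sum>i\<in>UNIV. \<psi> (x, 0) $ i * vb (x, 0) $ i)) = 0"
    and mv_entropy: "\<And>\<theta>. C1c_T T \<theta> \<Longrightarrow> (\<And>t. 0 \<le> \<theta> t) \<Longrightarrow> (\<And>t. deriv \<theta> t \<le> 0) \<Longrightarrow>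
          0 \<le> (LINT z:QT T|lborel. deriv \<theta> (snd z) * (\<integral>l. \<eta> l \<partial>(\<nu> z)))
          + (LINT x:Qcell|lborel. \<theta> 0 * \<eta> (vb (x, 0)))"
    and vb_entropy: "\<And>\<theta>. C1c_T T \<theta> \<Longrightarrow> (\<And>t. 0 \<le> \<theta> t) \<Longrightarrow>
          (LINT z:QT T|lborel. deriv \<theta> (snd z) * \<eta> (vb z))
          + (LINT x:Qcell|lborel. \<theta> 0 * \<eta> (vb (x, 0))) = 0"
begin

text \<open>Componentwise, to match the integrals in the weak formulation. At points where
  \<open>\<eta>\<close> is integrable it is the vector-valued mean, see
  \<open>integrable_point\<close>.\<close>

definition mean_v :: "(real^'d) \<times> real \<Rightarrow> real^'n" where
  "mean_v z = (\<chi> i. \<integral>l. l $ i \<partial>(\<nu> z))"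

definition mean_f :: "(real^'d) \<times> real \<Rightarrow> real^'d^'n" where
  "mean_f z = (\<chi> i \<alpha>. \<integral>l. f l $ i $ \<alpha> \<partial>(\<nu> z))"

definition strip :: "real \<Rightarrow> (real^'d) \<times> real \<Rightarrow> real" where
  "strip s z = indicator (Qcell \<times> {0..s}) z"

text \<open>With the cut-off built in, the differences are integrable on the whole space and can
  serve directly as densities for the weak limit.\<close>

definition dv :: "real \<Rightarrow> (real^'d) \<times> real \<Rightarrow> real^'n" where
  "dv s z = strip s z *\<^sub>R (mean_v z - vb z)"

definition df :: "real \<Rightarrow> (real^'d) \<times> real \<Rightarrow> real^'d^'n" where
  "df s z = strip s z *\<^sub>R (mean_f z - f (vb z))"

definition d\<eta> :: "real \<Rightarrow> (real^'d) \<times> real \<Rightarrow> real" where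
  "d\<eta> s z = strip s z * ((\<integral>l. \<eta> l \<partial>(\<nu> z)) - \<eta> (vb z))"

definition rel_entropy :: "real^'n \<Rightarrow> real^'n \<Rightarrow> real" where
  "rel_entropy l x = \<eta> l - \<eta> x - D\<eta> x (l - x)"

section \<open>Integrability of the means and averaged inequalities\<close>

lemma B_nonneg: "0 \<le> B"
  using order_trans[OF norm_ge_zero id_growth[of 0]] eta_nonneg[of 0] by (simp add: zero_le_mult_iff)

lemma component2_le_norm: "\<bar>F $ i $ \<alpha>\<bar> \<le> norm (F :: real^'d^'n)"
  using component_le_norm_cart[of "F $ i" \<alpha>] Finite_Cartesian_Product.norm_nth_le[of F i] by linarith

text \<open>One constant, \<open>B + 1\<close>, brings all integrands into the form that
  \<open>young_measure_integrable\<close> asks for.\<close>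

lemma growth_bounds:
  "\<bar>l $ i\<bar> \<le> (B + 1) * (1 + \<eta> l)" "\<bar>f l $ i $ \<alpha>\<bar> \<le> (B + 1) * (1 + \<eta> l)" "\<bar>\<eta> l\<bar> \<le> (B + 1) * (1 + \<eta> l)"
  "norm l \<le> (B + 1) * (1 + \<eta> l)" "norm (f l) \<le> (B + 1) * (1 + \<eta> l)"
proof -
  have "0 \<le> B * \<eta> l" using B_nonneg eta_nonneg by simp
  then have *: "(B + 1) * (1 + \<eta> l) = B * (1 + \<eta> l) + 1 + \<eta> l" "B + \<eta> l \<le> (B + 1) * (1 + \<eta> l)"
    "B * (1 + \<eta> l) \<le> (B + 1) * (1 + \<eta> l)" "0 \<le> B * (1 + \<eta> l)"
    using eta_nonneg[of l] B_nonneg by (simp_all add: algebra_simps)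
  show "norm l \<le> (B + 1) * (1 + \<eta> l)" "norm (f l) \<le> (B + 1) * (1 + \<eta> l)"
    using * id_growth[of l] f_growth[of l] by linarith+
  then show "\<bar>l $ i\<bar> \<le> (B + 1) * (1 + \<eta> l)" "\<bar>f l $ i $ \<alpha>\<bar> \<le> (B + 1) * (1 + \<eta> l)"
    using component_le_norm_cart[of l i] component2_le_norm[of "f l" i \<alpha>] by linarith+
  show "\<bar>\<eta> l\<bar> \<le> (B + 1) * (1 + \<eta> l)" using *(1,4) eta_nonneg[of l] by linarith
qed

lemma strip_subset: "s < T \<Longrightarrow> (Qcell :: (real^'d) set) \<times> {0..s} \<subseteq> QT T"
  by (auto simp: QT_def)

lemma strip_integrable:
  assumes s: "s < T" and g: "continuous_on UNIV g" "\<And>l. \<bar>g l\<bar> \<le> (B + 1) * (1 + \<eta> l)"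
  shows "AE z in lborel. z \<in> Qcell \<times> {0..s} \<longrightarrow> integrable (\<nu> z) g"
    and "integrable lborel (\<lambda>z. strip s z * (\<integral>l. g l \<partial>\<nu> z))"
  unfolding strip_def
  using young_measure_integrable[OF nu_young g(1) conts(3) eta_nonneg strip_subset[OF s] _ _ eta_finite[OF s] g(2)]
    emeasure_Qcell_strip_finite[of 0 s, where 'd = 'd] by auto

lemma strip_integrable_continuous:
  "continuous_on UNIV a \<Longrightarrow> integrable lborel (\<lambda>z. strip s z * a z)"
  unfolding strip_def by (rule integrable_strip_continuous)

lemma mean_component_integrable:
  assumes s: "s < T"
  shows "integrable lborel (\<lambda>z. strip s z * mean_v z $ i)"
    "integrable lborel (\<lambda>z. strip s z * mean_f z $ i $ \<alpha>)"
proof -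
  have "continuous_on UNIV (\<lambda>l. f l $ i $ \<alpha>)" by (intro continuous_intros conts)
  from strip_integrable(2)[OF s this growth_bounds(2)]
  show "integrable lborel (\<lambda>z. strip s z * mean_f z $ i $ \<alpha>)" by (simp add: mean_f_def)
  have "continuous_on UNIV (\<lambda>l :: real^'n. l $ i)" by (intro continuous_intros)
  from strip_integrable(2)[OF s this growth_bounds(1)]
  show "integrable lborel (\<lambda>z. strip s z * mean_v z $ i)" by (simp add: mean_v_def)
qed

lemma vb_comp_cont: "continuous_on S (\<lambda>z. f (vb z))" "continuous_on S (\<lambda>z. \<eta> (vb z))"
  by (rule continuous_on_compose2[OF conts(1)[of UNIV] vb_cont] continuous_on_compose2[OF conts(3)[of UNIV] vb_cont]; simp)+

lemma difference_integrable:
  assumes s: "s < T"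
  shows "integrable lborel (dv s)" "integrable lborel (df s)" "integrable lborel (d\<eta> s)"
proof -
  show "integrable lborel (dv s)"
  proof (rule integrable_vecI)
    fix i
    have "integrable lborel (\<lambda>z. strip s z * mean_v z $ i - strip s z * vb z $ i)"
      by (intro Bochner_Integration.integrable_diff mean_component_integrable s
          strip_integrable_continuous continuous_intros vb_cont)
    then show "integrable lborel (\<lambda>z. dv s z $ i)" by (simp add: dv_def right_diff_distrib)
  qed
  show "integrable lborel (df s)"
  proof (rule integrable_vecI, rule integrable_vecI)
    fix i \<alpha>
    have "integrable lborel (\<lambda>z. strip s z * mean_f z $ i $ \<alpha> - strip s z * f (vb z) $ i $ \<alpha>)"
      by (intro Bochner_Integration.integrable_diff mean_component_integrable s
          strip_integrable_continuous continuous_intros vb_comp_cont)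
    then show "integrable lborel (\<lambda>z. df s z $ i $ \<alpha>)" by (simp add: df_def right_diff_distrib)
  qed
  have "integrable lborel (\<lambda>z. strip s z * (\<integral>l. \<eta> l \<partial>\<nu> z) - strip s z * \<eta> (vb z))"
    by (intro Bochner_Integration.integrable_diff strip_integrable s conts growth_bounds(3)
        strip_integrable_continuous vb_comp_cont)
  then show "integrable lborel (d\<eta> s)" by (simp add: d\<eta>_def[abs_def] right_diff_distrib)
qed

lemma differences_vanish:
  assumes "z \<notin> Qcell \<times> {0..s}"
  shows "dv s z = 0" "df s z = 0" "d\<eta> s z = 0"
  using assms by (auto simp: dv_def df_def d\<eta>_def strip_def)

lemma integrable_point:
  assumes z: "z \<in> QT T" and int: "integrable (\<nu> z) \<eta>"
  shows "integrable (\<nu> z) (\<lambda>l. l)" "integrable (\<nu> z) f"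
    "mean_v z = (\<integral>l. l \<partial>\<nu> z)" "mean_f z = (\<integral>l. f l \<partial>\<nu> z)"
proof -
  interpret prob_space "\<nu> z" using nu_young z by (simp add: young_measure_def)
  have sets: "sets (\<nu> z) = sets borel" using nu_young z by (simp add: young_measure_def)
  have meas: "g \<in> borel_measurable (\<nu> z)" if "continuous_on UNIV g" for g :: "real^'n \<Rightarrow> 'b::topological_space"
    using borel_measurable_continuous_onI[OF that] measurable_cong_sets[OF sets refl] by blast
  have dom: "integrable (\<nu> z) (\<lambda>l. (B + 1) * (1 + \<eta> l))" using int by simp
  have nn: "0 \<le> (B + 1) * (1 + \<eta> l)" for l using B_nonneg eta_nonneg[of l] by simp
  show 1: "integrable (\<nu> z) (\<lambda>l. l)"
    by (rule Bochner_Integration.integrable_bound[OF dom meas]) (use growth_bounds(4) nn in auto)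
  show 2: "integrable (\<nu> z) f"
    by (rule Bochner_Integration.integrable_bound[OF dom meas]) (use growth_bounds(5) nn conts in auto)
  show "mean_v z = (\<integral>l. l \<partial>\<nu> z)"
    using integral_bounded_linear[OF bounded_linear_vec_nth 1] by (simp add: mean_v_def vec_eq_iff)
  have "(\<integral>l. f l $ i $ \<alpha> \<partial>\<nu> z) = (\<integral>l. f l \<partial>\<nu> z) $ i $ \<alpha>" for i \<alpha>
    by (rule integral_bounded_linear[OF bounded_linear_compose[OF bounded_linear_vec_nth bounded_linear_vec_nth] 2])
  then show "mean_f z = (\<integral>l. f l \<partial>\<nu> z)" by (simp add: mean_f_def vec_eq_iff)
qed

text \<open>The relative entropy is \<open>\<eta>\<close> plus an affine function of
  \<open>l\<close>, so only the means of \<open>\<eta>\<close> and of the identity enter.\<close>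

lemma rel_entropy_mean:
  assumes z: "z \<in> QT T" and int: "integrable (\<nu> z) \<eta>"
  shows "integrable (\<nu> z) (\<lambda>l. rel_entropy l x)"
    "(\<integral>l. rel_entropy l x \<partial>\<nu> z) = (\<integral>l. \<eta> l \<partial>\<nu> z) - \<eta> x - D\<eta> x (mean_v z - x)"
proof -
  interpret prob_space "\<nu> z" using nu_young z by (simp add: young_measure_def)
  note ip = integrable_point[OF z int]
  have D: "integrable (\<nu> z) (\<lambda>l. D\<eta> x l)"
    "(\<integral>l. D\<eta> x l \<partial>\<nu> z) = D\<eta> x (mean_v z)"
    using integrable_bounded_linear[OF blinfun.bounded_linear_right ip(1)]
      integral_bounded_linear[OF blinfun.bounded_linear_right ip(1)] ip(3) by simp_all
  show "integrable (\<nu> z) (\<lambda>l. rel_entropy l x)"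
    unfolding rel_entropy_def using int D by (simp add: blinfun.diff_right)
  show "(\<integral>l. rel_entropy l x \<partial>\<nu> z) = (\<integral>l. \<eta> l \<partial>\<nu> z) - \<eta> x - D\<eta> x (mean_v z - x)"
    unfolding rel_entropy_def using int D by (simp add: blinfun.diff_right prob_space)
qed

text \<open>Averaging over a probability measure commutes with the affine part of the relative flux.
  The norm of an average is at most the average of the norms, and
  \<open>relative_flux_le_relative_entropy\<close> applies to each of these.\<close>

lemma rel_flux_mean:
  obtains K where "0 \<le> K" "\<And>z. z \<in> QT T \<Longrightarrow> integrable (\<nu> z) \<eta> \<Longrightarrow>
    norm (mean_f z - f (vb z) - Df (vb z) (mean_v z - vb z)) \<le> K * (\<integral>l. rel_entropy l (vb z) \<partial>\<nu> z)"
proof -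
  obtain K where K: "0 \<le> K" "\<And>x y. norm x \<le> M \<Longrightarrow>
    norm (f y - f x - Df x (y - x)) \<le> K * (\<eta> y - \<eta> x - D\<eta> x (y - x))"
    using relative_flux_le_relative_entropy[OF f_deriv Df_deriv D2f_cont conts(3,4) eta_quad c0_pos f_growth] by blast
  show thesis
  proof (rule that[OF K(1)])
    fix z assume z: "z \<in> QT T" and int: "integrable (\<nu> z) \<eta>"
    interpret prob_space "\<nu> z" using nu_young z by (simp add: young_measure_def)
    note ip = integrable_point[OF z int]
    let ?x = "vb z"
    have D: "integrable (\<nu> z) (\<lambda>l. Df ?x l)"
      "(\<integral>l. Df ?x l \<partial>\<nu> z) = Df ?x (mean_v z)"
      using integrable_bounded_linear[OF blinfun.bounded_linear_right ip(1)]
        integral_bounded_linear[OF blinfun.bounded_linear_right ip(1)] ip(3) by simp_all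
    have "integrable (\<nu> z) (\<lambda>l. f l - f ?x - Df ?x (l - ?x))"
      using ip D by (simp add: blinfun.diff_right)
    moreover have "mean_f z - f ?x - Df ?x (mean_v z - ?x)
        = (\<integral>l. f l - f ?x - Df ?x (l - ?x) \<partial>\<nu> z)"
      using ip D by (simp add: blinfun.diff_right prob_space)
    moreover have "norm (f l - f ?x - Df ?x (l - ?x)) \<le> K * rel_entropy l ?x" for l
      unfolding rel_entropy_def by (rule K(2)[OF vb_bdd[OF z]])
    ultimately have "norm (mean_f z - f ?x - Df ?x (mean_v z - ?x)) \<le> (\<integral>l. K * rel_entropy l ?x \<partial>\<nu> z)"
      using norm_integral_le_integral[of "\<nu> z" "\<lambda>l. f l - f ?x - Df ?x (l - ?x)" "\<lambda>l. K * rel_entropy l ?x"]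
        rel_entropy_mean(1)[OF z int] by simp
    then show "norm (mean_f z - f ?x - Df ?x (mean_v z - ?x)) \<le> K * (\<integral>l. rel_entropy l ?x \<partial>\<nu> z)"
      by simp
  qed
qed

text \<open>The relative entropy dominates the squared distance to \<open>x\<close>. If its mean is
  zero, almost every point equals \<open>x\<close>, and a probability measure with that property is
  the point mass.\<close>

lemma dirac_of_rel_entropy_eq_0:
  assumes z: "z \<in> QT T" and int: "integrable (\<nu> z) \<eta>" and 0: "(\<integral>l. rel_entropy l x \<partial>\<nu> z) \<le> 0"
  shows "\<nu> z = return borel x"
proof -
  interpret prob_space "\<nu> z" using nu_young z by (simp add: young_measure_def)
  have sets: "sets (\<nu> z) = sets borel" using nu_young z by (simp add: young_measure_def)
  have quad: "c0 * (norm (l - x))\<^sup>2 \<le> rel_entropy l x" for l unfolding rel_entropy_def by (rule eta_quad)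
  have nn: "0 \<le> rel_entropy l x" for l using order_trans[OF _ quad[of l]] c0_pos by simp
  then have "(\<integral>l. rel_entropy l x \<partial>\<nu> z) = 0"
    using 0 Bochner_Integration.integral_nonneg[of "\<nu> z" "\<lambda>l. rel_entropy l x", OF nn] by linarith
  then have "AE l in \<nu> z. rel_entropy l x = 0"
    using integral_nonneg_eq_0_iff_AE[OF rel_entropy_mean(1)[OF z int]] nn by simp
  then have "AE l in \<nu> z. l = x"
  proof eventually_elim
    case (elim l)
    then have "(norm (l - x))\<^sup>2 \<le> 0" using quad[of l] c0_pos by (simp add: mult_le_0_iff)
    then show ?case by simp
  qed
  from AE_eq_constD(1)[OF this] show ?thesis
    using return_cong[OF sets] by simp
qed

section \<open>Testing with the entropy variables of the approximations\<close>

lemma D2eta_sym: "D2\<eta> l a b = D2\<eta> l b a"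
  by (rule second_derivative_symmetric[OF eta_deriv Deta_deriv D2eta_cont])

text \<open>The only trace of the spatial gradient that survives the limit is the constant
  \<open>c\<close>, which is independent of \<open>k\<close> and becomes a factor of the exponential
  rate.\<close>

lemma flux_term_bound:
  obtains c where "0 \<le> c" "\<And>k z X. z \<in> QT T \<Longrightarrow>
    \<bar>\<Sum>\<alpha>\<in>UNIV. D2\<eta> (v k z) (d_x \<alpha> (v k) z) (column \<alpha> X)\<bar> \<le> c * norm X"
proof -
  obtain a where a: "0 \<le> a" "\<And>x. norm x \<le> M \<Longrightarrow> norm (D2\<eta> x) \<le> a"
    using continuous_on_bounded_cball[OF D2eta_cont] by blast
  have "\<forall>\<alpha>. \<exists>b. \<forall>X :: real^'d^'n. norm (column \<alpha> X) \<le> norm X * b"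
    using bounded_linear.bounded[OF bounded_linear_column] by blast
  then obtain b where b: "\<And>\<alpha> (X :: real^'d^'n). norm (column \<alpha> X) \<le> norm X * b \<alpha>" by metis
  show thesis
  proof (rule that)
    show "0 \<le> (\<Sum>\<alpha>\<in>(UNIV :: 'd set). a * L * \<bar>b \<alpha>\<bar>)"
      using a L_nonneg by (intro sum_nonneg mult_nonneg_nonneg) auto
    fix k and z :: "(real^'d) \<times> real" and X :: "real^'d^'n" assume z: "z \<in> QT T"
    have "\<bar>D2\<eta> (v k z) (d_x \<alpha> (v k) z) (column \<alpha> X)\<bar> \<le> a * L * \<bar>b \<alpha>\<bar> * norm X" for \<alpha>
    proof -
      have 1: "norm (D2\<eta> (v k z) (d_x \<alpha> (v k) z)) \<le> a * L"
        by (rule order_trans[OF norm_blinfun mult_mono]) (use a v_bdd[OF z] v_deriv_bound in auto)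
      have 2: "norm (column \<alpha> X) \<le> \<bar>b \<alpha>\<bar> * norm X"
        using order_trans[OF b[of \<alpha> X] mult_left_mono[of "b \<alpha>" "\<bar>b \<alpha>\<bar>" "norm X"]] by (simp add: mult.commute)
      have "norm (D2\<eta> (v k z) (d_x \<alpha> (v k) z) (column \<alpha> X)) \<le> (a * L) * (\<bar>b \<alpha>\<bar> * norm X)"
        by (rule order_trans[OF norm_blinfun mult_mono[OF 1 2]]) (use a L_nonneg in auto)
      then show ?thesis by (simp add: mult.assoc)
    qed
    then show "\<bar>\<Sum>\<alpha>\<in>UNIV. D2\<eta> (v k z) (d_x \<alpha> (v k) z) (column \<alpha> X)\<bar>
        \<le> (\<Sum>\<alpha>\<in>(UNIV :: 'd set). a * L * \<bar>b \<alpha>\<bar>) * norm X"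
      unfolding sum_distrib_right by (intro order_trans[OF sum_abs sum_mono])
  qed
qed

text \<open>The gradient of \<open>\<eta>\<close> at \<open>v k\<close> with a weight in time. It is
  C1 because \<open>\<eta>\<close> is C2 and \<open>v k\<close> is C1; a merely Lipschitz
  \<open>vb\<close> in place of \<open>v k\<close> would not ensure this.\<close>

definition test_fun :: "(real \<Rightarrow> real) \<Rightarrow> nat \<Rightarrow> (real^'d) \<times> real \<Rightarrow> real^'n" where
  "test_fun \<theta> k z = \<theta> (snd z) *\<^sub>R (\<chi> i. D\<eta> (v k z) (axis i 1))"

context
  fixes s :: real and \<theta> \<theta>' :: "real \<Rightarrow> real"
  assumes s: "0 < s" "s < T"
    and theta_deriv: "\<And>t. (\<theta> has_real_derivative \<theta>' t) (at t)" and theta'_cont: "continuous_on UNIV \<theta>'"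
    and theta_0: "\<And>t. s \<le> t \<Longrightarrow> \<theta> t = 0" and theta'_0: "\<And>t. s \<le> t \<Longrightarrow> \<theta>' t = 0"
begin

lemma theta_C1: "C1_map \<theta>"
  by (rule C1_map_DERIV[OF theta_deriv theta'_cont])

lemma test_fun_C1: "C1_map (test_fun \<theta> k)"
proof -
  have D: "C1_map (\<lambda>x. D\<eta> x (axis i 1))" for i
  proof (rule C1_mapI)
    show "((\<lambda>x. D\<eta> x (axis i 1)) has_derivative (\<lambda>h. D2\<eta> x h (axis i 1))) (at x)" for x
      by (rule bounded_linear.has_derivative[OF blinfun.bounded_linear_left Deta_deriv])
    show "continuous_on UNIV (\<lambda>x. D2\<eta> x h (axis i 1))" for h
      by (intro continuous_intros D2eta_cont)
  qed
  have "C1_map (\<lambda>z :: (real^'d) \<times> real. \<theta> (snd z))"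
    by (rule C1_map_compose[OF theta_C1 C1_map_linear[OF bounded_linear_snd]])
  then show ?thesis
    unfolding test_fun_def
    by (intro C1_map_scaleR C1_map_vecI, assumption) (simp only: vec_lambda_beta, rule C1_map_compose[OF D v_C1])
qed

lemma test_fun_C1c: "C1c_QT T (test_fun \<theta> k)"
  unfolding C1c_QT_def
proof (intro conjI exI[of _ s] allI impI)
  show "periodic_x (test_fun \<theta> k)"
    using v_per[of k] by (simp add: periodic_x_def test_fun_def)
qed (use s in \<open>auto simp: test_fun_C1 test_fun_def theta_0\<close>)

lemma test_fun_derivative:
  "frechet_derivative (test_fun \<theta> k) (at z) h $ i =
     \<theta>' (snd z) * snd h * D\<eta> (v k z) (axis i 1)
     + \<theta> (snd z) * D2\<eta> (v k z) (frechet_derivative (v k) (at z) h) (axis i 1)"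
proof -
  have 1: "((\<lambda>z. test_fun \<theta> k z $ i) has_derivative (\<lambda>h. frechet_derivative (test_fun \<theta> k) (at z) h $ i)) (at z)"
    by (rule bounded_linear.has_derivative[OF bounded_linear_vec_nth C1_map_has_derivative[OF test_fun_C1]])
  have 2: "((\<lambda>z. \<theta> (snd z) * D\<eta> (v k z) (axis i 1)) has_derivative
      (\<lambda>h. \<theta> (snd z) * D2\<eta> (v k z) (frechet_derivative (v k) (at z) h) (axis i 1)
         + \<theta>' (snd z) * snd h * D\<eta> (v k z) (axis i 1))) (at z)"
  proof (rule has_derivative_mult)
    have "(\<theta> has_derivative (\<lambda>h. \<theta>' (snd z) * h)) (at (snd z))"
      using theta_deriv[of "snd z"] by (simp add: has_field_derivative_def)
    from has_derivative_compose[OF bounded_linear_imp_has_derivative[OF bounded_linear_snd] this]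
    show "((\<lambda>z :: (real^'d) \<times> real. \<theta> (snd z)) has_derivative (\<lambda>h. \<theta>' (snd z) * snd h)) (at z)" .
    show "((\<lambda>z. D\<eta> (v k z) (axis i 1)) has_derivative
       (\<lambda>h. D2\<eta> (v k z) (frechet_derivative (v k) (at z) h) (axis i 1))) (at z)"
      by (rule has_derivative_compose[OF C1_map_has_derivative[OF v_C1]
            bounded_linear.has_derivative[OF blinfun.bounded_linear_left Deta_deriv]])
  qed
  have "(\<lambda>z. test_fun \<theta> k z $ i) = (\<lambda>z. \<theta> (snd z) * D\<eta> (v k z) (axis i 1))"
    by (simp add: test_fun_def fun_eq_iff)
  from has_derivative_unique[OF 1[unfolded this] 2]
  have "(\<lambda>h. frechet_derivative (test_fun \<theta> k) (at z) h $ i)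
     = (\<lambda>h. \<theta> (snd z) * D2\<eta> (v k z) (frechet_derivative (v k) (at z) h) (axis i 1)
         + \<theta>' (snd z) * snd h * D\<eta> (v k z) (axis i 1))"
    .
  from fun_cong[OF this, of h] show ?thesis by simp
qed

text \<open>The integrand of the weak formulation with state \<open>a\<close> and flux
  \<open>X\<close> kept free: the means, the values at \<open>vb\<close> and their differences can
  all be inserted, and it is linear in the pair.\<close>

definition pairing :: "nat \<Rightarrow> (real^'n) \<Rightarrow> (real^'d^'n) \<Rightarrow> (real^'d) \<times> real \<Rightarrow> real" where
  "pairing k a X z = (\<Sum>i\<in>UNIV. a $ i * d_t (test_fun \<theta> k) z $ i
      + (\<Sum>\<alpha>\<in>UNIV. X $ i $ \<alpha> * d_x \<alpha> (test_fun \<theta> k) z $ i))"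

lemma pairing_eq:
  "pairing k a X z = \<theta>' (snd z) * D\<eta> (v k z) a
    + \<theta> (snd z) * (D2\<eta> (v k z) (d_t (v k) z) a
       + (\<Sum>\<alpha>\<in>UNIV. D2\<eta> (v k z) (d_x \<alpha> (v k) z) (column \<alpha> X)))"
proof -
  have "(\<Sum>i\<in>UNIV. \<Sum>\<alpha>\<in>UNIV. X $ i $ \<alpha> * d_x \<alpha> (test_fun \<theta> k) z $ i)
     = (\<Sum>\<alpha>\<in>UNIV. \<Sum>i\<in>UNIV. X $ i $ \<alpha> * d_x \<alpha> (test_fun \<theta> k) z $ i)"
    by (rule sum.swap)
  then show ?thesis
    unfolding pairing_def d_t_def d_x_def test_fun_derivative sum.distrib
    by (subst (1 2 3) blinfun_vec_expansion)
       (simp add: column_def algebra_simps sum.distrib sum_distrib_left)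
qed

lemma pairing_integrable:
  assumes "\<And>i. integrable lborel (\<lambda>z. strip s z * a z $ i)"
    "\<And>i \<alpha>. integrable lborel (\<lambda>z. strip s z * X z $ i $ \<alpha>)"
  shows "integrable lborel (\<lambda>z. strip s z * pairing k (a z) (X z) z)"
proof -
  have "integrable lborel (\<lambda>z. strip s z * (a z $ i * d_t (test_fun \<theta> k) z $ i))"
    "integrable lborel (\<lambda>z. strip s z * (X z $ i $ \<alpha> * d_x \<alpha> (test_fun \<theta> k) z $ i))" for i \<alpha>
    using assms unfolding strip_def
    by (auto intro!: integrable_strip_mult_continuous continuous_on_component d_cont test_fun_C1)
  then show ?thesis
    unfolding pairing_def by (simp add: sum_distrib_left distrib_left)
qed

lemma pairing_QT:
  "(LINT z:QT T|lborel. pairing k (a z) (X z) z) = (LBINT z. strip s z * pairing k (a z) (X z) z)"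
  unfolding set_lebesgue_integral_def
proof (rule Bochner_Integration.integral_cong[OF refl])
  fix z :: "(real^'d) \<times> real"
  show "indicator (QT T) z *\<^sub>R pairing k (a z) (X z) z = strip s z * pairing k (a z) (X z) z"
    using s by (cases "snd z < s") (auto simp: pairing_eq theta_0 theta'_0 strip_def QT_def indicator_def mem_Times_iff)
qed

text \<open>Both formulations carry the same initial term, as the initial data agree, so it cancels
  in the difference.\<close>

lemma pairing_difference_integral:
  "(LBINT z. pairing k (dv s z) (df s z) z) = 0"
proof -
  define c where "c = (LINT x:Qcell|lborel. (\<Sum>i\<in>UNIV. test_fun \<theta> k (x, 0) $ i * vb (x, 0) $ i))"
  have "(LINT z:QT T|lborel. pairing k (mean_v z) (mean_f z) z) + c = 0"
    using mv_weak[OF test_fun_C1c] by (simp add: pairing_def mean_v_def mean_f_def c_def mult.commute)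
  moreover have "(LINT z:QT T|lborel. pairing k (vb z) (f (vb z)) z) + c = 0"
    using vb_weak[OF test_fun_C1c] by (simp add: pairing_def c_def mult.commute)
  ultimately have "(LBINT z. strip s z * pairing k (mean_v z) (mean_f z) z)
      - (LBINT z. strip s z * pairing k (vb z) (f (vb z)) z) = 0"
    unfolding pairing_QT by simp
  moreover have "integrable lborel (\<lambda>z. strip s z * pairing k (mean_v z) (mean_f z) z)"
    by (rule pairing_integrable) (rule mean_component_integrable[OF s(2)])+
  moreover have "integrable lborel (\<lambda>z. strip s z * pairing k (vb z) (f (vb z)) z)"
    by (rule pairing_integrable; intro strip_integrable_continuous continuous_on_component vb_cont vb_comp_cont)
  ultimately have "(LBINT z. strip s z * pairing k (mean_v z) (mean_f z) z - strip s z * pairing k (vb z) (f (vb z)) z) = 0"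
    by simp
  also have "(\<lambda>z. strip s z * pairing k (mean_v z) (mean_f z) z - strip s z * pairing k (vb z) (f (vb z)) z)
      = (\<lambda>z. pairing k (dv s z) (df s z) z)"
    unfolding pairing_def dv_def df_def
    by (simp add: fun_eq_iff sum.distrib sum_subtractf sum_distrib_left right_diff_distrib
        left_diff_distrib distrib_left mult.assoc)
  finally show ?thesis .
qed

text \<open>The initial entropies cancel between the inequality for \<open>\<nu>\<close> and the
  equality for \<open>vb\<close>.\<close>

lemma entropy_difference_integral:
  assumes nn: "\<And>t. 0 \<le> \<theta> t" and noninc: "\<And>t. \<theta>' t \<le> 0"
  shows "0 \<le> (LBINT z. \<theta>' (snd z) * d\<eta> s z)"
proof -
  have d: "deriv \<theta> t = \<theta>' t" for t by (rule DERIV_imp_deriv[OF theta_deriv])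
  have C1c: "C1c_T T \<theta>" unfolding C1c_T_def using theta_C1 s theta_0 by blast
  have QT: "(LINT z:QT T|lborel. \<theta>' (snd z) * g z) = (LBINT z. strip s z * (g z * \<theta>' (snd z)))" for g
    unfolding set_lebesgue_integral_def
  proof (rule Bochner_Integration.integral_cong[OF refl])
    fix z :: "(real^'d) \<times> real"
    show "indicator (QT T) z *\<^sub>R (\<theta>' (snd z) * g z) = strip s z * (g z * \<theta>' (snd z))"
      using s by (cases "snd z < s") (auto simp: theta'_0 strip_def QT_def indicator_def mem_Times_iff)
  qed
  have c: "continuous_on UNIV (\<lambda>z :: (real^'d) \<times> real. \<theta>' (snd z))"
    by (intro continuous_on_compose2[OF theta'_cont] continuous_intros) auto
  have i1: "integrable lborel (\<lambda>z. strip s z * ((\<integral>l. \<eta> l \<partial>\<nu> z) * \<theta>' (snd z)))"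
    using strip_integrable(2)[OF s(2) conts(3) growth_bounds(3)] unfolding strip_def
    by (rule integrable_strip_mult_continuous[OF _ c])
  have i2: "integrable lborel (\<lambda>z. strip s z * (\<eta> (vb z) * \<theta>' (snd z)))"
    by (intro strip_integrable_continuous continuous_intros vb_comp_cont c)
  have "0 \<le> (LBINT z. strip s z * ((\<integral>l. \<eta> l \<partial>\<nu> z) * \<theta>' (snd z))) - (LBINT z. strip s z * (\<eta> (vb z) * \<theta>' (snd z)))"
    using mv_entropy[OF C1c nn] vb_entropy[OF C1c nn] noninc unfolding d QT by simp
  also have "\<dots> = (LBINT z. strip s z * ((\<integral>l. \<eta> l \<partial>\<nu> z) * \<theta>' (snd z)) - strip s z * (\<eta> (vb z) * \<theta>' (snd z)))"
    by (rule Bochner_Integration.integral_diff[OF i1 i2, symmetric])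
  also have "\<dots> = (LBINT z. \<theta>' (snd z) * d\<eta> s z)"
    by (rule Bochner_Integration.integral_cong) (auto simp: d\<eta>_def algebra_simps)
  finally show ?thesis .
qed

text \<open>Inserting \<open>Df (v k z) a\<close> into the spatial term and moving it across the
  Hessian by symmetry completes the time derivative to the residual. What remains is
  \<open>X - Df (v k z) a\<close>, which for the differences is close to the mean relative
  flux.\<close>

lemma pairing_residual:
  "pairing k a X z = \<theta>' (snd z) * D\<eta> (v k z) a
    + \<theta> (snd z) * D2\<eta> (v k z) (residual k z) a
    + \<theta> (snd z) * (\<Sum>\<alpha>\<in>UNIV. blinfun_apply (D2\<eta> (v k z) (d_x \<alpha> (v k) z))
        (column \<alpha> (X - Df (v k z) a)))"
proof -
  let ?D = "\<lambda>a b. D2\<eta> (v k z) a b"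
  have swap: "?D (column \<alpha> (Df (v k z) h)) a = ?D h (column \<alpha> (Df (v k z) a))" for \<alpha> h
    by (subst D2eta_sym) (rule eta_sym)
  have 1: "?D (residual k z) a = ?D (d_t (v k) z) a
      + (\<Sum>\<alpha>\<in>UNIV. ?D (d_x \<alpha> (v k) z) (column \<alpha> (Df (v k z) a)))"
    unfolding residual_def by (simp only: blinfun.add_left blinfun.add_right blinfun.sum_left blinfun.sum_right swap)
  have 2: "(\<Sum>\<alpha>\<in>UNIV. ?D (d_x \<alpha> (v k) z) (column \<alpha> (X - Df (v k z) a)))
      = (\<Sum>\<alpha>\<in>UNIV. ?D (d_x \<alpha> (v k) z) (column \<alpha> X))
        - (\<Sum>\<alpha>\<in>UNIV. ?D (d_x \<alpha> (v k) z) (column \<alpha> (Df (v k z) a)))"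
    by (simp add: linear_simps(2)[OF bounded_linear_column] blinfun.diff_right sum_subtractf)
  show ?thesis unfolding pairing_eq 1 2 by (simp add: algebra_simps)
qed

lemma theta_bounds:
  "\<exists>t0 t1. 0 \<le> t0 \<and> 0 \<le> t1 \<and> (\<forall>t\<in>{0..s}. \<bar>\<theta> t\<bar> \<le> t0) \<and> (\<forall>t\<in>{0..s}. \<bar>\<theta>' t\<bar> \<le> t1)"
proof -
  obtain t0 where t0: "0 \<le> t0" "\<And>t. norm t \<le> s \<Longrightarrow> norm (\<theta> t) \<le> t0"
    using continuous_on_bounded_cball[OF C1_map_continuous[OF theta_C1]] by blast
  obtain t1 where t1: "0 \<le> t1" "\<And>t. norm t \<le> s \<Longrightarrow> norm (\<theta>' t) \<le> t1"
    using continuous_on_bounded_cball[OF theta'_cont] by blast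
  show ?thesis
    using t0 t1 by (intro exI[of _ t0] exI[of _ t1]) auto
qed

lemma theta_measurable:
  "(\<lambda>z :: (real^'d) \<times> real. \<theta> (snd z)) \<in> borel_measurable lborel"
  "(\<lambda>z :: (real^'d) \<times> real. \<theta>' (snd z)) \<in> borel_measurable lborel"
  using borel_measurable_continuous_onI[OF continuous_on_compose2[OF theta'_cont continuous_on_snd[OF continuous_on_id[of UNIV]]]]
    borel_measurable_continuous_onI[OF continuous_on_compose2[OF C1_map_continuous[OF theta_C1, of UNIV] continuous_on_snd[OF continuous_on_id[of UNIV]]]]
  by (simp_all add: id_def)

lemma difference_measurable:
  "dv s \<in> borel_measurable lborel" "df s \<in> borel_measurable lborel" "d\<eta> s \<in> borel_measurable lborel"
  using difference_integrable[OF s(2)] by (auto intro: borel_measurable_integrable)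

lemma approx_measurable: "v k \<in> borel_measurable lborel" "vb \<in> borel_measurable lborel" "residual k \<in> borel_measurable lborel"
  using borel_measurable_continuous_onI[OF C1_map_continuous[OF v_C1]]
    borel_measurable_continuous_onI[OF vb_cont] borel_measurable_continuous_onI[OF residual_cont] by auto

text \<open>A product of a weakly vanishing factor and a pointwise convergent one. The coefficient
  is frozen at its limit first; then the bounded residual meets fixed integrable densities.\<close>

lemma residual_term_null:
  "integrable lborel (\<lambda>z. \<theta> (snd z) * D2\<eta> (v k z) (residual k z) (dv s z))"
  "(\<lambda>k. LBINT z. \<theta> (snd z) * D2\<eta> (v k z) (residual k z) (dv s z)) \<longlonglongrightarrow> 0"
proof -
  note [measurable] = theta_measurable difference_measurable approx_measurable
    measurable_blinfun_apply2[OF D2eta_cont] 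
  obtain a where a: "0 \<le> a" "\<And>x. norm x \<le> M \<Longrightarrow> norm (D2\<eta> x) \<le> a"
    using continuous_on_bounded_cball[OF D2eta_cont] by blast
  obtain K where K: "0 \<le> K" "\<And>k z. z \<in> QT T \<Longrightarrow> norm (residual k z) \<le> K"
    using residual_bounded by blast
  obtain t0 where t0: "0 \<le> t0" "\<forall>t\<in>{0..s}. \<bar>\<theta> t\<bar> \<le> t0"
    using theta_bounds by blast
  have W: "integrable lborel (\<lambda>z. C * norm (dv s z))" for C :: real
    using difference_integrable(1)[OF s(2)] by simp
  have tbound: "\<bar>\<theta> (snd z) * A r (dv s z)\<bar> \<le> t0 * (C * K') * norm (dv s z)"
    if "norm A \<le> C" "0 \<le> C" "norm r \<le> K'" "z \<in> Qcell \<times> {0..s}" for A :: "(real^'n) \<Rightarrow>\<^sub>L (real^'n) \<Rightarrow>\<^sub>L real" and C r K' z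
  proof -
    have "norm (A r) \<le> C * K'"
      by (rule order_trans[OF norm_blinfun mult_mono]) (use that in auto)
    then have "\<bar>A r (dv s z)\<bar> \<le> (C * K') * norm (dv s z)"
      using order_trans[OF norm_blinfun[of "A r" "dv s z"] mult_right_mono] by simp
    moreover have "\<bar>\<theta> (snd z)\<bar> \<le> t0" using that(4) t0(2) by auto
    ultimately have "\<bar>\<theta> (snd z)\<bar> * \<bar>A r (dv s z)\<bar> \<le> t0 * ((C * K') * norm (dv s z))"
      using t0 by (intro mult_mono) auto
    then show ?thesis by (simp add: abs_mult mult.assoc)
  qed
  have inQT: "z \<in> QT T" if "z \<in> Qcell \<times> {0..s}" for z :: "(real^'d) \<times> real"
    using that strip_subset[OF s(2)] by blast
  have bound: "\<bar>\<theta> (snd z) * D2\<eta> (w z) (r z) (dv s z)\<bar> \<le> t0 * (a * K') * norm (dv s z)"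
    if "\<And>z. z \<in> QT T \<Longrightarrow> norm (w z) \<le> M" "\<And>z. z \<in> QT T \<Longrightarrow> norm (r z) \<le> K'" for w r K' z
  proof (cases "z \<in> Qcell \<times> {0..s}")
    case True
    show ?thesis using tbound[OF a(2)[OF that(1)[OF inQT[OF True]]] a(1) that(2)[OF inQT[OF True]] True] .
  qed (simp add: differences_vanish)
  have intg: "integrable lborel (\<lambda>z. \<theta> (snd z) * D2\<eta> (w z) (r z) (dv s z))"
    if [measurable]: "w \<in> borel_measurable lborel" "r \<in> borel_measurable lborel"
      and "\<And>z. z \<in> QT T \<Longrightarrow> norm (w z) \<le> M" "\<And>z. z \<in> QT T \<Longrightarrow> norm (r z) \<le> K'" for w r K'
  proof (rule Bochner_Integration.integrable_bound[OF W[of "t0 * (a * K')"]])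
    show "(\<lambda>z. \<theta> (snd z) * D2\<eta> (w z) (r z) (dv s z)) \<in> borel_measurable lborel"
      by measurable
    show "AE z in lborel. norm (\<theta> (snd z) * D2\<eta> (w z) (r z) (dv s z)) \<le> norm (t0 * (a * K') * norm (dv s z))"
      using order_trans[OF bound[OF that(3,4)] abs_ge_self] by (intro AE_I2) simp
  qed
  show i1: "integrable lborel (\<lambda>z. \<theta> (snd z) * D2\<eta> (v k z) (residual k z) (dv s z))" for k
    by (rule intg[OF approx_measurable(1,3) v_bdd K(2)])
  have i2: "integrable lborel (\<lambda>z. \<theta> (snd z) * D2\<eta> (vb z) (residual k z) (dv s z))" for k
    by (rule intg[OF approx_measurable(2,3) vb_bdd K(2)])
  have i3: "integrable lborel (\<lambda>z. \<theta> (snd z) * D2\<eta> (vb z) (axis i 1) (dv s z))" for i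
    by (rule intg[OF approx_measurable(2) _ vb_bdd, of _ 1]) auto
  have D2: "isCont D2\<eta> l" for l using D2eta_cont by (simp add: continuous_on_eq_continuous_at)
  \<comment> \<open>Freezing the coefficient: \<open>D2\<eta> (v k z)\<close> tends to
    \<open>D2\<eta> (vb z)\<close> in norm at each point, while the residual is bounded by
    \<open>K\<close>.\<close>
  have lim1: "(\<lambda>k. LBINT z. \<theta> (snd z) * D2\<eta> (v k z) (residual k z) (dv s z)
       - \<theta> (snd z) * D2\<eta> (vb z) (residual k z) (dv s z)) \<longlonglongrightarrow> (\<integral>z. 0 \<partial>(lborel :: ((real^'d) \<times> real) measure))"
  proof (rule integral_dominated_convergence[where w = "\<lambda>z. (2 * (t0 * (a * K))) * norm (dv s z)"])
    show "AE z in lborel. (\<lambda>k. \<theta> (snd z) * D2\<eta> (v k z) (residual k z) (dv s z)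
       - \<theta> (snd z) * D2\<eta> (vb z) (residual k z) (dv s z)) \<longlonglongrightarrow> 0"
    proof (rule AE_I2)
      fix z
      have "(\<lambda>k. norm (D2\<eta> (v k z) - D2\<eta> (vb z))) \<longlonglongrightarrow> 0"
        using isCont_tendsto_compose[OF D2 v_lim] by (intro tendsto_norm_zero LIM_zero)
      then have "(\<lambda>k. t0 * (norm (D2\<eta> (v k z) - D2\<eta> (vb z)) * K) * norm (dv s z)) \<longlonglongrightarrow> t0 * (0 * K) * norm (dv s z)"
        by (intro tendsto_intros)
      then have lim: "(\<lambda>k. t0 * (norm (D2\<eta> (v k z) - D2\<eta> (vb z)) * K) * norm (dv s z)) \<longlonglongrightarrow> 0" by simp
      show "(\<lambda>k. \<theta> (snd z) * D2\<eta> (v k z) (residual k z) (dv s z)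
         - \<theta> (snd z) * D2\<eta> (vb z) (residual k z) (dv s z)) \<longlonglongrightarrow> 0"
      proof (rule Lim_null_comparison[OF always_eventually lim], rule allI)
        fix k
        show "norm (\<theta> (snd z) * D2\<eta> (v k z) (residual k z) (dv s z)
           - \<theta> (snd z) * D2\<eta> (vb z) (residual k z) (dv s z))
           \<le> t0 * (norm (D2\<eta> (v k z) - D2\<eta> (vb z)) * K) * norm (dv s z)"
        proof (cases "z \<in> Qcell \<times> {0..s}")
          case True
          have "\<bar>\<theta> (snd z) * (D2\<eta> (v k z) - D2\<eta> (vb z)) (residual k z) (dv s z)\<bar>
            \<le> t0 * (norm (D2\<eta> (v k z) - D2\<eta> (vb z)) * K) * norm (dv s z)"
            by (rule tbound[OF order_refl norm_ge_zero K(2)[OF inQT[OF True]] True])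
          then show ?thesis by (simp add: blinfun.diff_left right_diff_distrib)
        qed (simp add: differences_vanish)
      qed
    qed
    show "AE z in lborel. norm (\<theta> (snd z) * D2\<eta> (v k z) (residual k z) (dv s z)
       - \<theta> (snd z) * D2\<eta> (vb z) (residual k z) (dv s z)) \<le> 2 * (t0 * (a * K)) * norm (dv s z)" for k
    proof (rule AE_I2)
      fix z
      show "norm (\<theta> (snd z) * D2\<eta> (v k z) (residual k z) (dv s z)
       - \<theta> (snd z) * D2\<eta> (vb z) (residual k z) (dv s z)) \<le> 2 * (t0 * (a * K)) * norm (dv s z)"
        using bound[of "v k" "residual k" K z] bound[of vb "residual k" K z] v_bdd vb_bdd K(2) by simp
    qed
    show "integrable lborel (\<lambda>z. 2 * (t0 * (a * K)) * norm (dv s z))" by (rule W)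
  qed measurable
  \<comment> \<open>In coordinates each component of the residual multiplies a density that no
    longer depends on \<open>k\<close>, the form \<open>residual_weak_null\<close> handles.\<close>
  have expand: "\<theta> (snd z) * D2\<eta> (vb z) (residual k z) (dv s z)
      = (\<Sum>i\<in>UNIV. indicator (Qcell \<times> {0..s}) z * residual k z $ i
          * (\<theta> (snd z) * D2\<eta> (vb z) (axis i 1) (dv s z)))" for k z
  proof (cases "z \<in> Qcell \<times> {0..s}")
    case True
    have "D2\<eta> (vb z) (residual k z) (dv s z)
        = (\<Sum>i\<in>UNIV. residual k z $ i * D2\<eta> (vb z) (dv s z) (axis i 1))"
      by (subst D2eta_sym) (rule blinfun_vec_expansion)
    also have "\<dots> = (\<Sum>i\<in>UNIV. residual k z $ i * D2\<eta> (vb z) (axis i 1) (dv s z))"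
      by (subst D2eta_sym) (rule refl)
    finally show ?thesis using True by (simp add: sum_distrib_left mult_ac)
  qed (simp add: differences_vanish)
  have i4: "integrable lborel (\<lambda>z. indicator (Qcell \<times> {0..s}) z * residual k z $ i
          * (\<theta> (snd z) * D2\<eta> (vb z) (axis i 1) (dv s z)))" for k i
  proof (rule Bochner_Integration.integrable_bound[OF integrable_mult_right[OF i3[of i], of K]])
    have "(\<lambda>z. residual k z $ i) \<in> borel_measurable lborel"
      using borel_measurable_continuous_onI[OF continuous_on_component[OF residual_cont]] by simp
    then show "(\<lambda>z. indicator (Qcell \<times> {0..s}) z * residual k z $ i
          * (\<theta> (snd z) * D2\<eta> (vb z) (axis i 1) (dv s z))) \<in> borel_measurable lborel"
      using borel_measurable_integrable[OF i3[of i]] by measurable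
    show "AE z in lborel. norm (indicator (Qcell \<times> {0..s}) z * residual k z $ i
          * (\<theta> (snd z) * D2\<eta> (vb z) (axis i 1) (dv s z)))
        \<le> norm (K * (\<theta> (snd z) * D2\<eta> (vb z) (axis i 1) (dv s z)))"
    proof (rule AE_I2)
      fix z :: "(real^'d) \<times> real"
      have "\<bar>indicator (Qcell \<times> {0..s}) z * residual k z $ i\<bar> \<le> \<bar>K\<bar>"
        using component_le_norm_cart[of "residual k z" i] K(1) K(2)[of z k] inQT[of z]
        by (cases "z \<in> Qcell \<times> {0..s}") auto
      then show "norm (indicator (Qcell \<times> {0..s}) z * residual k z $ i
          * (\<theta> (snd z) * D2\<eta> (vb z) (axis i 1) (dv s z)))
        \<le> norm (K * (\<theta> (snd z) * D2\<eta> (vb z) (axis i 1) (dv s z)))"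
        unfolding real_norm_def abs_mult by (intro mult_right_mono) auto
    qed
  qed
  have "(\<lambda>k. \<Sum>i\<in>UNIV. LBINT z. indicator (Qcell \<times> {0..s}) z * residual k z $ i
          * (\<theta> (snd z) * D2\<eta> (vb z) (axis i 1) (dv s z))) \<longlonglongrightarrow> (\<Sum>i\<in>(UNIV :: 'n set). 0)"
    by (intro tendsto_sum residual_weak_null s i3)
  then have "(\<lambda>k. LBINT z. \<theta> (snd z) * D2\<eta> (vb z) (residual k z) (dv s z)) \<longlonglongrightarrow> 0"
    unfolding expand Bochner_Integration.integral_sum[OF i4] by simp
  from tendsto_add[OF lim1 this]
  show "(\<lambda>k. LBINT z. \<theta> (snd z) * D2\<eta> (v k z) (residual k z) (dv s z)) \<longlonglongrightarrow> 0"
    unfolding Bochner_Integration.integral_diff[OF i1 i2] by simp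
qed

text \<open>The part of the estimate without derivatives of \<open>w\<close>, so that
  \<open>v k\<close> can be replaced by \<open>vb\<close> in the limit. At \<open>w = vb\<close> the
  first two terms combine, on the strip, to \<open>- \<theta>'\<close> times the mean relative
  entropy; the last one is the penalty for the flux.\<close>

definition entropy_balance :: "real \<Rightarrow> ((real^'d) \<times> real \<Rightarrow> real^'n) \<Rightarrow> (real^'d) \<times> real \<Rightarrow> real" where
  "entropy_balance c w z = \<theta>' (snd z) * D\<eta> (w z) (dv s z) - \<theta>' (snd z) * d\<eta> s z
     - c * \<theta> (snd z) * norm (df s z - Df (w z) (dv s z))"

text \<open>For each \<open>k\<close>, the balance plus the residual term lies below the tested
  difference of the weak formulations minus the tested entropy difference. The former has integral
  zero, the latter a nonnegative one, and the residual term disappears as \<open>k\<close>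
  grows.\<close>

lemma entropy_balance_limit:
  assumes nn: "\<And>t. 0 \<le> \<theta> t" and noninc: "\<And>t. \<theta>' t \<le> 0"
    and c: "0 \<le> c" "\<And>k z X. z \<in> QT T \<Longrightarrow>
      \<bar>\<Sum>\<alpha>\<in>UNIV. D2\<eta> (v k z) (d_x \<alpha> (v k) z) (column \<alpha> X)\<bar> \<le> c * norm X"
  shows "integrable lborel (entropy_balance c vb)" "(LBINT z. entropy_balance c vb z) \<le> 0"
proof -
  note [measurable] = theta_measurable difference_measurable approx_measurable
    measurable_blinfun_apply[OF conts(4)[of UNIV]] measurable_blinfun_apply[OF conts(2)[of UNIV]]
  obtain a1 where a1: "0 \<le> a1" "\<And>x. norm x \<le> M \<Longrightarrow> norm (D\<eta> x) \<le> a1"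
    using continuous_on_bounded_cball[OF conts(4)] by blast
  obtain a2 where a2: "0 \<le> a2" "\<And>x. norm x \<le> M \<Longrightarrow> norm (Df x) \<le> a2"
    using continuous_on_bounded_cball[OF conts(2)] by blast
  obtain t0 t1 where t: "0 \<le> t0" "0 \<le> t1" "\<forall>t\<in>{0..s}. \<bar>\<theta> t\<bar> \<le> t0" "\<forall>t\<in>{0..s}. \<bar>\<theta>' t\<bar> \<le> t1"
    using theta_bounds by blast
  \<comment> \<open>One majorant for all \<open>w\<close> bounded by \<open>M\<close> on
    \<open>QT T\<close>, hence for every \<open>v k\<close> and for \<open>vb\<close>.\<close>
  define W where "W z = t1 * (a1 * norm (dv s z)) + t1 * \<bar>d\<eta> s z\<bar> + c * t0 * (norm (df s z) + a2 * norm (dv s z))" for z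
  have W: "integrable lborel W"
    unfolding W_def using difference_integrable[OF s(2)] by simp
  have bound: "\<bar>entropy_balance c w z\<bar> \<le> W z" if w: "\<And>z. z \<in> QT T \<Longrightarrow> norm (w z) \<le> M" for w z
  proof (cases "z \<in> Qcell \<times> {0..s}")
    case True
    then have zQ: "z \<in> QT T" using strip_subset[OF s(2)] by blast
    have th: "\<bar>\<theta> (snd z)\<bar> \<le> t0" "\<bar>\<theta>' (snd z)\<bar> \<le> t1" using True t(3,4) by (auto simp: mem_Times_iff)
    have 1: "\<bar>\<theta>' (snd z) * D\<eta> (w z) (dv s z)\<bar> \<le> t1 * (a1 * norm (dv s z))"
      unfolding abs_mult
      using order_trans[OF norm_blinfun mult_right_mono[OF a1(2)[OF w[OF zQ]] norm_ge_zero], of "dv s z"] th(2) t(2)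
      by (intro mult_mono) auto
    have 2: "\<bar>\<theta>' (snd z) * d\<eta> s z\<bar> \<le> t1 * \<bar>d\<eta> s z\<bar>"
      unfolding abs_mult by (intro mult_right_mono th) auto
    have "norm (df s z - Df (w z) (dv s z)) \<le> norm (df s z) + a2 * norm (dv s z)"
      using order_trans[OF norm_blinfun mult_right_mono[OF a2(2)[OF w[OF zQ]] norm_ge_zero], of "dv s z"]
        norm_triangle_ineq4[of "df s z" "Df (w z) (dv s z)"] by linarith
    then have 3: "\<bar>c * \<theta> (snd z) * norm (df s z - Df (w z) (dv s z))\<bar> \<le> c * t0 * (norm (df s z) + a2 * norm (dv s z))"
      unfolding abs_mult using th(1) c(1) t(1) by (intro mult_mono) auto
    show ?thesis unfolding entropy_balance_def W_def using 1 2 3 by linarith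
  next
    case False
    then show ?thesis by (simp add: entropy_balance_def W_def differences_vanish)
  qed
  have meas: "entropy_balance c w \<in> borel_measurable lborel" if [measurable]: "w \<in> borel_measurable lborel" for w
    unfolding entropy_balance_def by measurable
  have int: "integrable lborel (entropy_balance c w)"
    if "w \<in> borel_measurable lborel" and "\<And>z. z \<in> QT T \<Longrightarrow> norm (w z) \<le> M" for w
  proof (rule Bochner_Integration.integrable_bound[OF W meas[OF that(1)]])
    show "AE z in lborel. norm (entropy_balance c w z) \<le> norm (W z)"
      using order_trans[OF bound[OF that(2)] abs_ge_self] by (intro AE_I2) simp
  qed
  show "integrable lborel (entropy_balance c vb)"
    by (rule int[OF approx_measurable(2) vb_bdd])
  have lim: "(\<lambda>k. LBINT z. entropy_balance c (v k) z) \<longlonglongrightarrow> (LBINT z. entropy_balance c vb z)"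
  proof (rule integral_dominated_convergence[OF meas[OF approx_measurable(2)] meas[OF approx_measurable(1)] W])
    have D: "isCont D\<eta> l" "isCont Df l" for l using conts(2,4)[of UNIV] by (simp_all add: continuous_on_eq_continuous_at)
    have D\<eta>: "(\<lambda>k. D\<eta> (v k z)) \<longlonglongrightarrow> D\<eta> (vb z)" and Df: "(\<lambda>k. Df (v k z)) \<longlonglongrightarrow> Df (vb z)" for z
      using isCont_tendsto_compose[OF D(1) v_lim] isCont_tendsto_compose[OF D(2) v_lim] by auto
    show "AE z in lborel. (\<lambda>k. entropy_balance c (v k) z) \<longlonglongrightarrow> entropy_balance c vb z"
      unfolding entropy_balance_def by (intro AE_I2 tendsto_intros D\<eta> Df)
    show "AE z in lborel. norm (entropy_balance c (v k) z) \<le> W z" for k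
      using bound[of "v k"] v_bdd by simp
  qed
  define R where "R k z = \<theta> (snd z) * D2\<eta> (v k z) (residual k z) (dv s z)" for k z
  have R: "integrable lborel (R k)" "(\<lambda>k. LBINT z. R k z) \<longlonglongrightarrow> 0" for k
    unfolding R_def by (rule residual_term_null)+
  have le: "(LBINT z. entropy_balance c (v k) z) + (LBINT z. R k z) \<le> 0" for k
  proof -
    have p: "integrable lborel (\<lambda>z. pairing k (dv s z) (df s z) z)"
    proof -
      have eq: "strip s z * dv s z $ i = dv s z $ i" "strip s z * df s z $ i $ \<alpha> = df s z $ i $ \<alpha>" for z i \<alpha>
        by (auto simp: strip_def dv_def df_def indicator_def)
      have "integrable lborel (\<lambda>z. dv s z $ i)" "integrable lborel (\<lambda>z. df s z $ i $ \<alpha>)" for i \<alpha>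
        by (rule integrable_bounded_linear[OF bounded_linear_vec_nth difference_integrable(1)[OF s(2)]]
            integrable_bounded_linear[OF bounded_linear_compose[OF bounded_linear_vec_nth bounded_linear_vec_nth]
              difference_integrable(2)[OF s(2)]])+
      then have "integrable lborel (\<lambda>z. strip s z * pairing k (dv s z) (df s z) z)"
        by (intro pairing_integrable) (simp_all only: eq)
      moreover have "strip s z * pairing k (dv s z) (df s z) z = pairing k (dv s z) (df s z) z" for z
        by (cases "z \<in> Qcell \<times> {0..s}") (auto simp: strip_def pairing_def differences_vanish)
      ultimately show ?thesis by simp
    qed
    have e: "integrable lborel (\<lambda>z. \<theta>' (snd z) * d\<eta> s z)"
    proof (rule Bochner_Integration.integrable_bound[OF integrable_mult_right[OF difference_integrable(3)[OF s(2)], of t1]])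
      show "AE z in lborel. norm (\<theta>' (snd z) * d\<eta> s z) \<le> norm (t1 * d\<eta> s z)"
      proof (rule AE_I2)
        fix z show "norm (\<theta>' (snd z) * d\<eta> s z) \<le> norm (t1 * d\<eta> s z)"
          using t(2,4) by (cases "z \<in> Qcell \<times> {0..s}")
            (auto simp: abs_mult differences_vanish mem_Times_iff intro!: mult_right_mono)
      qed
    qed measurable
    have "(LBINT z. entropy_balance c (v k) z) + (LBINT z. R k z)
        = (LBINT z. entropy_balance c (v k) z + R k z)"
      using int[OF approx_measurable(1) v_bdd] R(1) by simp
    also have "\<dots> \<le> (LBINT z. pairing k (dv s z) (df s z) z - \<theta>' (snd z) * d\<eta> s z)"
    proof (rule integral_mono)
      show "integrable lborel (\<lambda>z. entropy_balance c (v k) z + R k z)"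
        using int[OF approx_measurable(1) v_bdd] R(1) by simp
      show "integrable lborel (\<lambda>z. pairing k (dv s z) (df s z) z - \<theta>' (snd z) * d\<eta> s z)"
        using p e by simp
      fix z :: "(real^'d) \<times> real"
      show "entropy_balance c (v k) z + R k z \<le> pairing k (dv s z) (df s z) z - \<theta>' (snd z) * d\<eta> s z"
      proof (cases "z \<in> Qcell \<times> {0..s}")
        case True
        then have zQ: "z \<in> QT T" using strip_subset[OF s(2)] by blast
        let ?X = "df s z - Df (v k z) (dv s z)"
        let ?S = "\<Sum>\<alpha>\<in>UNIV. D2\<eta> (v k z) (d_x \<alpha> (v k) z) (column \<alpha> ?X)"
        \<comment> \<open>Here the gradient is given up for its bound; multiplication by
          \<open>\<theta>\<close> keeps the direction since \<open>\<theta>\<close> is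
          nonnegative.\<close>
        have "- (c * norm ?X) \<le> ?S" using c(2)[OF zQ, of k ?X] by linarith
        then have "\<theta> (snd z) * - (c * norm ?X) \<le> \<theta> (snd z) * ?S" by (rule mult_left_mono[OF _ nn])
        then show ?thesis unfolding pairing_residual entropy_balance_def R_def by (simp add: mult_ac)
      next
        case False
        then show ?thesis by (simp add: entropy_balance_def R_def pairing_def differences_vanish)
      qed
    qed
    also have "\<dots> = - (LBINT z. \<theta>' (snd z) * d\<eta> s z)"
      using p e pairing_difference_integral by simp
    also have "\<dots> \<le> 0" using entropy_difference_integral[OF nn noninc] by simp
    finally show ?thesis .
  qed
  have "(\<lambda>k. (LBINT z. entropy_balance c (v k) z) + (LBINT z. R k z)) \<longlonglongrightarrow> (LBINT z. entropy_balance c vb z) + 0"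
    by (rule tendsto_add[OF lim R(2)])
  then have "(LBINT z. entropy_balance c vb z) + 0 \<le> 0"
    by (rule LIMSEQ_le_const2) (use le in auto)
  then show "(LBINT z. entropy_balance c vb z) \<le> 0" by simp
qed

end

text \<open>The penalty costs at most \<open>K * \<theta>\<close> times the mean relative entropy,
  while the weight supplies \<open>- \<theta>'\<close> times it. The surplus is positive before
  \<open>s\<close>, so an integral that is at most zero forces the mean relative entropy to vanish
  there.\<close>

lemma dirac_before:
  assumes s: "0 < s" "s < T"
  shows "AE z in lborel. z \<in> Qcell \<times> {0..<s} \<longrightarrow> \<nu> z = return borel (vb z)"
proof -
  obtain c where c: "0 \<le> c" "\<And>k z X. z \<in> QT T \<Longrightarrow>
      \<bar>\<Sum>\<alpha>\<in>UNIV. D2\<eta> (v k z) (d_x \<alpha> (v k) z) (column \<alpha> X)\<bar> \<le> c * norm X"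
    using flux_term_bound by blast
  obtain K1 where K1: "0 \<le> K1" "\<And>z. z \<in> QT T \<Longrightarrow> integrable (\<nu> z) \<eta> \<Longrightarrow>
    norm (mean_f z - f (vb z) - Df (vb z) (mean_v z - vb z)) \<le> K1 * (\<integral>l. rel_entropy l (vb z) \<partial>\<nu> z)"
    using rel_flux_mean by blast
  \<comment> \<open>\<open>c\<close> bounds the gradient term and \<open>K1\<close> converts
    relative flux into relative entropy; their product is the rate in Gronwall's inequality.\<close>
  define K where "K = c * K1"
  have K: "0 \<le> K" using c(1) K1(1) by (simp add: K_def)
  define \<theta> where "\<theta> t = exp (- K * t) * posq (s - t)" for t
  \<comment> \<open>The second term is the surplus of \<open>- \<theta>'\<close> over
    \<open>K * \<theta>\<close>. It tends to zero at \<open>s\<close>, which keeps the weight C1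
    there.\<close>
  define \<theta>' where "\<theta>' t = - K * \<theta> t - exp (- K * t) * (2 * max 0 (s - t))" for t
  have th: "(\<theta> has_real_derivative \<theta>' t) (at t)" for t
  proof -
    have "((\<lambda>t. posq (s - t)) has_real_derivative 2 * max 0 (s - t) * (0 - 1)) (at t)"
      by (rule DERIV_chain2[OF posq_has_real_derivative]) (auto intro!: derivative_eq_intros)
    moreover have "((\<lambda>t. exp (- K * t)) has_real_derivative exp (- K * t) * (- K)) (at t)"
      by (auto intro!: derivative_eq_intros)
    ultimately have "(\<theta> has_real_derivative exp (- K * t) * (- K) * posq (s - t) + 2 * max 0 (s - t) * (0 - 1) * exp (- K * t)) (at t)"
      unfolding \<theta>_def by (intro DERIV_mult)
    then show ?thesis by (simp add: \<theta>'_def \<theta>_def algebra_simps)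
  qed
  have th'_cont: "continuous_on UNIV \<theta>'"
  proof -
    have "continuous_on UNIV \<theta>"
      using th DERIV_isCont by (blast intro: continuous_at_imp_continuous_on)
    then show ?thesis unfolding \<theta>'_def by (intro continuous_intros)
  qed
  have th_0: "\<theta> t = 0" "\<theta>' t = 0" if "s \<le> t" for t
    using that by (auto simp: \<theta>_def \<theta>'_def)
  have nn: "0 \<le> \<theta> t" for t by (simp add: \<theta>_def)
  have noninc: "\<theta>' t \<le> 0" for t
  proof -
    have "0 \<le> K * \<theta> t" "0 \<le> exp (- K * t) * (2 * max 0 (s - t))" using K nn[of t] by simp_all
    then show ?thesis unfolding \<theta>'_def by linarith
  qed
  define J where "J = entropy_balance s \<theta> \<theta>' c vb"
  have J: "integrable lborel J" "(LBINT z. J z) \<le> 0"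
    unfolding J_def by (rule entropy_balance_limit[OF s th th'_cont th_0 nn noninc c]; assumption)+
  have good: "AE z in lborel. z \<in> Qcell \<times> {0..s} \<longrightarrow> integrable (\<nu> z) \<eta>"
    by (rule strip_integrable(1)[OF s(2) conts(3) growth_bounds(3)])
  have lower: "exp (- K * snd z) * (2 * max 0 (s - snd z)) * (\<integral>l. rel_entropy l (vb z) \<partial>\<nu> z) \<le> J z"
    if z: "z \<in> Qcell \<times> {0..s}" and int: "integrable (\<nu> z) \<eta>" for z
  proof -
    have zQ: "z \<in> QT T" using z strip_subset[OF s(2)] by blast
    let ?H = "\<integral>l. rel_entropy l (vb z) \<partial>\<nu> z"
    have "d\<eta> s z = ?H + D\<eta> (vb z) (dv s z)"
      using rel_entropy_mean(2)[OF zQ int] z by (simp add: d\<eta>_def dv_def strip_def)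
    then have "J z = - \<theta>' (snd z) * ?H - c * \<theta> (snd z) * norm (df s z - Df (vb z) (dv s z))"
      by (simp add: J_def entropy_balance_def[OF s th th'_cont th_0] algebra_simps)
    moreover have "c * \<theta> (snd z) * norm (df s z - Df (vb z) (dv s z)) \<le> c * \<theta> (snd z) * (K1 * ?H)"
      using K1(2)[OF zQ int] z c(1) nn by (intro mult_left_mono) (auto simp: df_def dv_def strip_def)
    ultimately show ?thesis by (simp add: \<theta>'_def K_def algebra_simps)
  qed
  \<comment> \<open>The integrand is nonnegative everywhere, so this also covers points where the
    integral takes its default value.\<close>
  have H_nn: "0 \<le> (\<integral>l. rel_entropy l (vb z) \<partial>\<nu> z)" for z
  proof (rule Bochner_Integration.integral_nonneg)
    fix l
    have "0 \<le> c0 * (norm (l - vb z))\<^sup>2" using c0_pos by simp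
    also have "\<dots> \<le> rel_entropy l (vb z)" unfolding rel_entropy_def by (rule eta_quad)
    finally show "0 \<le> rel_entropy l (vb z)" .
  qed
  have J_nn: "AE z in lborel. 0 \<le> J z"
    using good
  proof eventually_elim
    case (elim z)
    show ?case
    proof (cases "z \<in> Qcell \<times> {0..s}")
      case True
      have "0 \<le> exp (- K * snd z) * (2 * max 0 (s - snd z)) * (\<integral>l. rel_entropy l (vb z) \<partial>\<nu> z)"
        using H_nn by simp
      also have "\<dots> \<le> J z" using lower True elim by blast
      finally show ?thesis .
    next
      case False
      then show ?thesis by (simp add: J_def entropy_balance_def[OF s th th'_cont th_0] differences_vanish)
    qed
  qed
  \<comment> \<open>Nonnegative almost everywhere and integral at most zero: this replaces the
    differential inequality.\<close>
  have "(LBINT z. J z) = 0" using J(2) integral_nonneg_AE[OF J_nn] by simp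
  then have "AE z in lborel. J z = 0" using integral_nonneg_eq_0_iff_AE[OF J(1) J_nn] by simp
  then show ?thesis using good
  proof eventually_elim
    case (elim z)
    show ?case
    proof
      assume z: "z \<in> Qcell \<times> {0..<s}"
      then have z': "z \<in> Qcell \<times> {0..s}" and int: "integrable (\<nu> z) \<eta>" using elim(2) by auto
      have zQ: "z \<in> QT T" using z' strip_subset[OF s(2)] by blast
      have "exp (- K * snd z) * (2 * max 0 (s - snd z)) * (\<integral>l. rel_entropy l (vb z) \<partial>\<nu> z) \<le> 0"
        using lower[OF z' int] elim(1) by simp
      moreover have "0 < exp (- K * snd z) * (2 * max 0 (s - snd z))" using z by auto
      ultimately have "(\<integral>l. rel_entropy l (vb z) \<partial>\<nu> z) \<le> 0" by (metis mult_pos_pos not_le)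
      then show "\<nu> z = return borel (vb z)" by (rule dirac_of_rel_entropy_eq_0[OF zQ int])
    qed
  qed
qed

theorem young_measure_dirac:
  "AE z in lborel. z \<in> QT T \<longrightarrow> \<nu> z = return borel (vb z)"
proof -
  \<comment> \<open>The shift by two keeps every \<open>s n\<close> strictly between zero and
    \<open>T\<close>; a shift by one would give \<open>s 0 = 0\<close>. Countably many strips keep
    the exceptional set null.\<close>
  define s where "s n = T * (1 - 1 / real (n + 2))" for n
  have s: "0 < s n" "s n < T" for n
    using T_pos mult_strict_left_mono[of "1 - 1 / real (n + 2)" 1 T] by (simp_all add: s_def)
  have "AE z in lborel. \<forall>n. z \<in> Qcell \<times> {0..<s n} \<longrightarrow> \<nu> z = return borel (vb z)"
    unfolding AE_all_countable using dirac_before[OF s] by blast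
  then show ?thesis
  proof eventually_elim
    case (elim z)
    show ?case
    proof
      assume z: "z \<in> QT T"
      have "(\<lambda>n. T * (1 - 1 / real (n + 2))) \<longlonglongrightarrow> T * (1 - 0)"
        by (intro tendsto_intros LIMSEQ_ignore_initial_segment[OF lim_1_over_n])
      then have "s \<longlonglongrightarrow> T" by (simp add: s_def[abs_def])
      moreover have "snd z < T" using z by (auto simp: QT_def)
      ultimately have "eventually (\<lambda>n. snd z < s n) sequentially" by (rule order_tendstoD)
      then obtain n where "snd z < s n" using eventually_happens'[OF sequentially_bot] by blast
      then have "z \<in> Qcell \<times> {0..<s n}" using z by (auto simp: QT_def)
      then show "\<nu> z = return borel (vb z)" using elim by blast
    qed
  qed
qed

end

section \<open>Reduction of the theorem to the comparison setting\<close>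

lemma norm_le_of_ratio_tendsto_0:
  fixes f :: "'a::euclidean_space \<Rightarrow> 'b::real_normed_vector"
  assumes lim: "((\<lambda>l. norm (f l) / \<eta> l) \<longlongrightarrow> 0) at_infinity" and f: "continuous_on UNIV f" and \<eta>: "\<And>l. 0 < \<eta> l"
  obtains a where "0 \<le> a" "\<And>l. norm (f l) \<le> a + \<eta> l"
proof -
  have "eventually (\<lambda>l. norm (f l) / \<eta> l < 1) at_infinity"
    by (rule order_tendstoD(2)[OF lim]) simp
  then obtain b where b: "\<And>l. b \<le> norm l \<Longrightarrow> norm (f l) / \<eta> l < 1"
    unfolding eventually_at_infinity by blast
  obtain a where a: "0 \<le> a" "\<And>l. norm l \<le> b \<Longrightarrow> norm (f l) \<le> a"
    using continuous_on_bounded_cball[OF f] by blast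
  show thesis
  proof (rule that[OF a(1)])
    fix l
    show "norm (f l) \<le> a + \<eta> l"
    proof (cases "norm l \<le> b")
      case True
      then show ?thesis using a(2)[OF True] \<eta>[of l] by linarith
    next
      case False
      then show ?thesis using b[of l] \<eta>[of l] a(1) by (simp add: pos_divide_less_eq)
    qed
  qed
qed

text \<open>Clamping time to \<open>[0, T]\<close> does not increase distances, so the extension
  keeps the constant \<open>L\<close>.\<close>

lemma lipschitz_clamp_time:
  fixes w :: "'a::metric_space \<times> real \<Rightarrow> 'b::metric_space"
  assumes w: "L-lipschitz_on (UNIV \<times> {0..T}) w" and T: "0 \<le> T"
  shows "L-lipschitz_on UNIV (\<lambda>z. w (fst z, max 0 (min (snd z) T)))"
proof (rule lipschitz_onI)
  fix y z :: "'a \<times> real"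
  let ?c = "\<lambda>t::real. max 0 (min t T)"
  have "dist (w (fst y, ?c (snd y))) (w (fst z, ?c (snd z))) \<le> L * dist (fst y, ?c (snd y)) (fst z, ?c (snd z))"
    by (rule lipschitz_onD[OF w]) (use T in auto)
  also have "\<dots> \<le> L * dist y z"
  proof (rule mult_left_mono[OF _ lipschitz_on_nonneg[OF w]])
    have "dist (?c (snd y)) (?c (snd z)) \<le> dist (snd y) (snd z)" by (auto simp: dist_real_def)
    then show "dist (fst y, ?c (snd y)) (fst z, ?c (snd z)) \<le> dist y z"
      by (cases y; cases z) (auto simp: dist_Pair_Pair intro!: real_sqrt_le_mono power_mono)
  qed
  finally show "dist (w (fst y, ?c (snd y))) (w (fst z, ?c (snd z))) \<le> L * dist y z" .
qed (rule lipschitz_on_nonneg[OF w])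

theorem theorem4p2:
  fixes f :: "real^'n \<Rightarrow> real^'d^'n"
    and \<eta> :: "real^'n \<Rightarrow> real"
    and q :: "real^'n \<Rightarrow> real^'d"
    and p \<gamma>0 \<alpha>0 A C T :: real
    and vk :: "nat \<Rightarrow> (real^'d) \<times> real \<Rightarrow> real^'n"
    and v0k :: "nat \<Rightarrow> real^'d \<Rightarrow> real^'n"
    and \<nu> :: "(real^'d) \<times> real \<Rightarrow> (real^'n) measure"
    and \<mu> :: "real^'d \<Rightarrow> (real^'n) measure"
    and \<gamma> :: "((real^'d) \<times> real) measure"
    and \<zeta> :: "(real^'d) measure"
    and vb :: "(real^'d) \<times> real \<Rightarrow> real^'n"
  assumes T_pos: "T > 0"
    (* the system and the entropy pair *)
    and f_C2: "C2_map f"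
    and eta_C2: "C2_map \<eta>" and q_C2: "C2_map q"
    and entropy_flux: "\<forall>l i \<alpha>. frechet_derivative q (at l) (axis i 1) $ \<alpha> =
          (\<Sum>j\<in>UNIV. frechet_derivative \<eta> (at l) (axis j 1) *
                      frechet_derivative f (at l) (axis i 1) $ j $ \<alpha>)"
    and eta_pos: "\<forall>l. \<eta> l > 0"
    and eta_strict_convex: "strictly_convex \<eta>"
    and gamma0_pos: "\<gamma>0 > 0"
    and eta_hess: "\<forall>l h. frechet_derivative (\<lambda>m. frechet_derivative \<eta> (at m) h) (at l) h
                         \<ge> \<gamma>0 * (norm h)\<^sup>2"
    and p_ge: "2 \<le> p"
    and consts_pos: "\<alpha>0 > 0" "A > 0" "C > 0"
    and eta_growth: "\<forall>l. \<alpha>0 * (norm l powr p + 1) - A \<le> \<eta> l \<and> \<eta> l \<le> C * (norm l powr p + 1)"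
    and f_eta: "((\<lambda>l. norm (f l) / \<eta> l) \<longlongrightarrow> 0) at_infinity"
    (* Young measures and concentration measures *)
    and nu_young: "young_measure (QT T) \<nu>"
    and mu_young: "young_measure Qcell \<mu>"
    and gamma_sets: "sets \<gamma> = sets borel"
    and gamma_supp: "emeasure \<gamma> (UNIV - QT T) = 0"
    and gamma_radon: "\<forall>s<T. emeasure \<gamma> (Qcell \<times> {0..s}) < \<infinity>"
    and zeta_sets: "sets \<zeta> = sets borel"
    (* generating sequences *)
    and vk_meas: "\<forall>k. vk k \<in> borel_measurable lborel"
    and vk_bdd: "\<exists>M. \<forall>k. AE t in lborel. 0 \<le> t \<and> t < T \<longrightarrow>
          (\<integral>\<^sup>+ x\<in>Qcell. ennreal (norm (vk k (x, t)) powr p) \<partial>lborel) \<le> ennreal M"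
    and v0k_meas: "\<forall>k. v0k k \<in> borel_measurable lborel"
    and v0k_int: "\<forall>k. set_integrable lborel Qcell (\<lambda>x. \<eta> (v0k k x))"
    and young_conv: "\<forall>g \<phi>. admissible \<eta> g \<and> Cc_QT T \<phi> \<longrightarrow>
          (\<lambda>k. LINT z:QT T|lborel. g (vk k z) * \<phi> z)
            \<longlonglongrightarrow> (LINT z:QT T|lborel. (\<integral>l. g l \<partial>(\<nu> z)) * \<phi> z)"
    and young_conv0: "\<forall>g \<phi>. admissible \<eta> g \<and> continuous_on UNIV \<phi> \<and> periodic_sp \<phi> \<longrightarrow>
          (\<lambda>k. LINT x:Qcell|lborel. g (v0k k x) * \<phi> x)
            \<longlonglongrightarrow> (LINT x:Qcell|lborel. (\<integral>l. g l \<partial>(\<mu> x)) * \<phi> x)"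
    and conc_conv: "\<forall>\<phi>. Cc_QT T \<phi> \<longrightarrow>
          (\<lambda>k. LINT z:QT T|lborel. \<eta> (vk k z) * \<phi> z)
            \<longlonglongrightarrow> (LINT z:QT T|lborel. (\<integral>l. \<eta> l \<partial>(\<nu> z)) * \<phi> z) + (\<integral>z. \<phi> z \<partial>\<gamma>)"
    and conc_conv0: "\<forall>\<phi>. continuous_on UNIV \<phi> \<and> periodic_sp \<phi> \<longrightarrow>
          (\<lambda>k. LINT x:Qcell|lborel. \<eta> (v0k k x) * \<phi> x)
            \<longlonglongrightarrow> (LINT x:Qcell|lborel. (\<integral>l. \<eta> l \<partial>(\<mu> x)) * \<phi> x) + (\<integral>x. \<phi> x \<partial>\<zeta>)"
    (* v = <nu, lambda> in L^infty(L^p) *)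
    and v_meas: "set_borel_measurable lborel (QT T) (\<lambda>z. \<integral>l. l \<partial>(\<nu> z))"
    and v_bdd: "\<exists>M. AE t in lborel. 0 \<le> t \<and> t < T \<longrightarrow>
          (\<integral>\<^sup>+ x\<in>Qcell. ennreal (norm (\<integral>l. l \<partial>(\<nu> (x, t))) powr p) \<partial>lborel) \<le> ennreal M"
    (* measure-valued weak formulation *)
    and mv_weak: "\<forall>\<psi>::(real^'d) \<times> real \<Rightarrow> real^'n. C1c_QT T \<psi> \<longrightarrow>
          (LINT z:QT T|lborel. (\<Sum>i\<in>UNIV. (\<integral>l. l $ i \<partial>(\<nu> z)) * d_t \<psi> z $ i
               + (\<Sum>\<alpha>\<in>UNIV. d_x \<alpha> \<psi> z $ i * (\<integral>l. f l $ i $ \<alpha> \<partial>(\<nu> z)))))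
          + (LINT x:Qcell|lborel. (\<Sum>i\<in>UNIV. (\<integral>l. l $ i \<partial>(\<mu> x)) * \<psi> (x, 0) $ i)) = 0"
    (* averaged entropy inequality *)
    and mv_entropy: "\<forall>\<theta>. C1c_T T \<theta> \<and> (\<forall>t\<in>{0..<T}. \<theta> t \<ge> 0) \<longrightarrow>
          (LINT z:QT T|lborel. deriv \<theta> (snd z) * (\<integral>l. \<eta> l \<partial>(\<nu> z)))
          + (\<integral>z. deriv \<theta> (snd z) \<partial>\<gamma>)
          + (LINT x:Qcell|lborel. \<theta> 0 * (\<integral>l. \<eta> l \<partial>(\<mu> x)))
          + (\<integral>x. \<theta> 0 \<partial>\<zeta>) \<ge> 0"
    (* the Lipschitz (W^{1,infty}) solution *)
    and vb_periodic: "periodic_x vb"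
    and vb_lip: "\<exists>L. L-lipschitz_on (UNIV \<times> {0..T}) vb"
    and vb_weak: "\<forall>\<psi>::(real^'d) \<times> real \<Rightarrow> real^'n. C1c_QT T \<psi> \<longrightarrow>
          (LINT z:QT T|lborel. (\<Sum>i\<in>UNIV. d_t \<psi> z $ i * vb z $ i
               + (\<Sum>\<alpha>\<in>UNIV. d_x \<alpha> \<psi> z $ i * f (vb z) $ i $ \<alpha>)))
          + (LINT x:Qcell|lborel. (\<Sum>i\<in>UNIV. \<psi> (x, 0) $ i * vb (x, 0) $ i)) = 0"
    and vb_entropy: "\<forall>\<theta>. C1c_T T \<theta> \<and> (\<forall>t\<in>{0..<T}. \<theta> t \<ge> 0) \<longrightarrow>
          (LINT z:QT T|lborel. deriv \<theta> (snd z) * \<eta> (vb z))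
          + (LINT x:Qcell|lborel. \<theta> 0 * \<eta> (vb (x, 0))) = 0"
    (* the hypotheses of the theorem *)
    and zeta_zero: "\<forall>B. emeasure \<zeta> B = 0"
    and mu_dirac: "\<forall>x\<in>Qcell. \<mu> x = return borel (vb (x, 0))"
  shows "(AE z in lborel. z \<in> QT T \<longrightarrow> \<nu> z = return borel (vb z))
       \<and> (AE z in lborel. z \<in> QT T \<longrightarrow> (\<integral>l. l \<partial>(\<nu> z)) = vb z)"
proof -
  obtain Df D2f where f: "\<And>x. (f has_derivative blinfun_apply (Df x)) (at x)"
      "\<And>x. (Df has_derivative blinfun_apply (D2f x)) (at x)" "continuous_on UNIV D2f"
    using f_C2 unfolding C2_map_def by blast
  obtain D\<eta> D2\<eta> where \<eta>: "\<And>x. (\<eta> has_derivative blinfun_apply (D\<eta> x)) (at x)"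
      "\<And>x. (D\<eta> has_derivative blinfun_apply (D2\<eta> x)) (at x)" "continuous_on UNIV D2\<eta>"
    using eta_C2 unfolding C2_map_def by blast
  obtain Dq D2q where q: "\<And>x. (q has_derivative blinfun_apply (Dq x)) (at x)"
      "\<And>x. (Dq has_derivative blinfun_apply (D2q x)) (at x)" "continuous_on UNIV D2q"
    using q_C2 unfolding C2_map_def by blast
  have sym: "blinfun_apply (blinfun_apply (D2\<eta> l) h) (column \<alpha> (blinfun_apply (Df l) k))
       = blinfun_apply (blinfun_apply (D2\<eta> l) k) (column \<alpha> (blinfun_apply (Df l) h))" for l h k \<alpha>
    by (rule entropy_hessian_symmetrizes_flux[OF f \<eta>(1,2) q]) (use entropy_flux in blast)
  have f_cont: "continuous_on UNIV f" and \<eta>_cont: "continuous_on UNIV \<eta>"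
    by (auto intro!: continuous_at_imp_continuous_on has_derivative_continuous[OF f(1)]
        has_derivative_continuous[OF \<eta>(1)])
  \<comment> \<open>The hypothesis differentiates the derivative in a fixed direction
    \<open>h\<close>, which is evaluation of \<open>D2\<eta>\<close> at \<open>h\<close>.\<close>
  have hess: "\<gamma>0 * (norm h)\<^sup>2 \<le> blinfun_apply (blinfun_apply (D2\<eta> l) h) h" for l h
  proof -
    have "((\<lambda>m. blinfun_apply (D\<eta> m) h) has_derivative (\<lambda>k. blinfun_apply (blinfun_apply (D2\<eta> l) k) h)) (at l)"
      by (rule bounded_linear.has_derivative[OF blinfun.bounded_linear_left \<eta>(2)])
    then show ?thesis
      using eta_hess[rule_format, where l = l and h = h]
      by (simp add: frechet_derivative_at[OF \<eta>(1), symmetric] frechet_derivative_at[symmetric])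
  qed
  have quad: "\<gamma>0 / 2 * (norm (y - x))\<^sup>2 \<le> \<eta> y - \<eta> x - blinfun_apply (D\<eta> x) (y - x)" for x y
    by (rule quadratic_lower_bound_of_hessian[OF \<eta>(1,2) hess])
  have \<eta>_nn: "0 \<le> \<eta> l" for l using eta_pos by (simp add: less_imp_le)
  obtain L where L: "L-lipschitz_on (UNIV \<times> {0..T}) vb" using vb_lip by blast
  \<comment> \<open>The mollifier reaches across both ends of the time interval, so a function
    Lipschitz for all times is required. \<open>u\<close> agrees with \<open>vb\<close> on
    \<open>QT T\<close>, in particular at time zero.\<close>
  define u where "u z = vb (fst z, max 0 (min (snd z) T))" for z
  have u_lip: "L-lipschitz_on UNIV u"
    unfolding u_def by (rule lipschitz_clamp_time[OF L]) (use T_pos in simp)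
  have L0: "0 \<le> L" using L by (rule lipschitz_on_nonneg)
  have u_vb: "u z = vb z" if "z \<in> QT T" for z
    using that by (cases z) (auto simp: u_def QT_def)
  have u_0: "u (x, 0) = vb (x, 0)" for x using T_pos by (simp add: u_def)
  have u_per: "u ((x, t) + (axis i (2 * pi), 0)) = u (x, t)" for x t i
    using vb_periodic by (simp add: u_def periodic_x_def)
  \<comment> \<open>Widths at most one, so that \<open>M + L\<close> bounds all \<open>v k\<close>
    on \<open>QT T\<close> at once.\<close>
  define \<delta> where "\<delta> k = inverse (real (Suc k))" for k
  have \<delta>: "0 < \<delta> k" "\<delta> k \<le> 1" for k by (simp_all add: \<delta>_def inverse_le_1_iff)
  have \<delta>_lim: "\<delta> \<longlonglongrightarrow> 0" unfolding \<delta>_def by (rule LIMSEQ_inverse_real_of_nat)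
  have "\<forall>k. \<exists>g. C1_map g \<and> L-lipschitz_on UNIV g \<and> (\<forall>z. norm (g z - u z) \<le> L * \<delta> k) \<and> periodic_x g"
  proof
    fix k
    obtain g where g: "C1_map g" "L-lipschitz_on UNIV g" "\<And>z. norm (g z - u z) \<le> L * \<delta> k"
      "\<And>z h. (\<And>z. u (z + h) = u z) \<Longrightarrow> g (z + h) = g z"
      using lipschitz_C1_approximation[OF u_lip \<delta>(1)[of k]] by metis
    have "g (x + axis i (2 * pi), t) = g (x, t)" for x t i
      using g(4)[of "(axis i (2 * pi), 0)" "(x, t)"] u_per by (metis add_Pair add.right_neutral prod.collapse)
    then show "\<exists>g. C1_map g \<and> L-lipschitz_on UNIV g \<and> (\<forall>z. norm (g z - u z) \<le> L * \<delta> k) \<and> periodic_x g"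
      using g(1-3) by (intro exI[of _ g]) (simp add: periodic_x_def)
  qed
  then obtain v where v: "\<And>k. C1_map (v k)" "\<And>k. L-lipschitz_on UNIV (v k)"
    "\<And>k z. norm (v k z - u z) \<le> L * \<delta> k" "\<And>k. periodic_x (v k)" by metis
  have v_lim: "(\<lambda>k. v k z) \<longlonglongrightarrow> u z" for z
  proof (rule LIM_zero_cancel, rule Lim_null_comparison)
    show "\<forall>\<^sub>F k in sequentially. norm (v k z - u z) \<le> L * \<delta> k" using v(3) by simp
    show "(\<lambda>k. L * \<delta> k) \<longlonglongrightarrow> 0" using tendsto_mult_left[OF \<delta>_lim, of L] by simp
  qed
  obtain R where R: "\<And>z. z \<in> (Qcell :: (real^'d) set) \<times> {0..T} \<Longrightarrow> norm z \<le> R"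
    using Qcell_strip_bounded[of 0 T] unfolding bounded_iff by blast
  obtain M where M: "0 \<le> M" "\<And>z. norm z \<le> R \<Longrightarrow> norm (u z) \<le> M"
    using continuous_on_bounded_cball[OF lipschitz_on_continuous_on[OF u_lip]] by blast
  have u_bdd: "norm (u z) \<le> M" if "z \<in> QT T" for z
    using that by (intro M(2) R) (auto simp: QT_def)
  have v_bdd: "norm (v k z) \<le> M + L" if "z \<in> QT T" for k z
  proof -
    have "norm (v k z) \<le> norm (u z) + norm (v k z - u z)" by (rule norm_triangle_sub)
    also have "\<dots> \<le> M + L * \<delta> k" by (intro add_mono u_bdd that v(3))
    also have "\<dots> \<le> M + L" using mult_left_mono[OF \<delta>(2) L0, of k] by simp
    finally show ?thesis .
  qed
  obtain a where a: "0 \<le> a" "\<And>l. norm (f l) \<le> a + \<eta> l"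
    using norm_le_of_ratio_tendsto_0[OF f_eta f_cont] eta_pos by blast
  \<comment> \<open>One constant for two growth bounds: \<open>a\<close> comes from the flux, and
    \<open>(1 + A) / \<alpha>0\<close> from the lower growth of \<open>\<eta>\<close> together with
    \<open>\<eta> l + A \<le> (1 + A) * (1 + \<eta> l)\<close>.\<close>
  define B where "B = a + (1 + A) / \<alpha>0"
  have id_growth: "norm l \<le> B * (1 + \<eta> l)" for l
  proof -
    have "norm l \<le> norm l powr p + 1"
    proof (cases "1 \<le> norm l")
      case True
      then show ?thesis using powr_mono[of 1 p "norm l"] p_ge by simp
    next
      case False
      then show ?thesis by (simp add: add_increasing)
    qed
    also have "\<dots> \<le> (\<eta> l + A) / \<alpha>0"
      using eta_growth[rule_format, of l] consts_pos by (simp add: pos_le_divide_eq mult.commute algebra_simps)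
    also have "\<dots> \<le> (1 + A) / \<alpha>0 * (1 + \<eta> l)"
    proof -
      have "\<eta> l + A \<le> (1 + A) * (1 + \<eta> l)" using \<eta>_nn[of l] consts_pos by (simp add: algebra_simps)
      then show ?thesis using consts_pos by (simp add: divide_right_mono)
    qed
    also have "\<dots> \<le> B * (1 + \<eta> l)"
      unfolding B_def using a(1) \<eta>_nn[of l] by (intro mult_right_mono) auto
    finally show ?thesis .
  qed
  have f_growth: "norm (f l) \<le> B + \<eta> l" for l
  proof -
    have "0 \<le> (1 + A) / \<alpha>0" using consts_pos by simp
    then show ?thesis using a(2)[of l] unfolding B_def by linarith
  qed
  have \<eta>_inf: "filterlim \<eta> at_top at_infinity"
    by (rule filterlim_at_top_of_powr_growth[of p \<alpha>0 A]) (use p_ge consts_pos eta_growth in auto)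
  obtain Mk where Mk: "\<And>k. AE t in lborel. 0 \<le> t \<and> t < T \<longrightarrow>
      (\<integral>\<^sup>+ x\<in>Qcell. ennreal (norm (vk k (x, t)) powr p) \<partial>lborel) \<le> ennreal Mk"
    using vk_bdd by blast
  have eta_fin: "(\<integral>\<^sup>+z. indicator (Qcell \<times> {0..s}) z * (\<integral>\<^sup>+l. ennreal (\<eta> l) \<partial>\<nu> z) \<partial>lborel) < \<infinity>" if "s < T" for s
  proof (rule young_measure_entropy_finite[OF nu_young \<eta>_cont \<eta>_nn \<eta>_inf _ _ Mk _ _ that])
    show "\<eta> l \<le> C * (norm l powr p + 1)" for l using eta_growth by blast
    show "vk k \<in> borel_measurable lborel" for k using vk_meas by blast
  qed (use young_conv conc_conv in \<open>auto simp: convergent_def\<close>)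
  \<comment> \<open>A point mass turns every \<open>\<mu>\<close>-mean into an evaluation, so both
    solutions acquire identical initial terms.\<close>
  have mu_int: "(\<integral>l. g l \<partial>\<mu> x) = g (vb (x, 0))"
    if "x \<in> Qcell" "continuous_on UNIV g" for x and g :: "real^'n \<Rightarrow> real"
    using that mu_dirac borel_measurable_continuous_onI[OF that(2)] by (simp add: integral_return)
  have weak0: "(LINT x:Qcell|lborel. (\<Sum>i\<in>UNIV. (\<integral>l. l $ i \<partial>(\<mu> x)) * \<psi> (x, 0) $ i))
      = (LINT x:Qcell|lborel. (\<Sum>i\<in>UNIV. \<psi> (x, 0) $ i * u (x, 0) $ i))"
    for \<psi> :: "(real^'d) \<times> real \<Rightarrow> real^'n"
    by (rule set_lebesgue_integral_cong)
       (auto simp: mu_int u_0 mult.commute continuous_on_component intro!: sum.cong Qcell_borel)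
  have entropy0: "(LINT x:Qcell|lborel. \<theta> 0 * (\<integral>l. \<eta> l \<partial>(\<mu> x))) = (LINT x:Qcell|lborel. \<theta> 0 * \<eta> (u (x, 0)))"
    for \<theta> :: "real \<Rightarrow> real"
    by (rule set_lebesgue_integral_cong) (auto simp: mu_int u_0 \<eta>_cont intro!: Qcell_borel)
  interpret measure_valued_comparison f Df D2f \<eta> D\<eta> D2\<eta> T L "M + L" u v \<nu> "\<gamma>0 / 2" B
  proof unfold_locales
    fix \<psi> :: "(real^'d) \<times> real \<Rightarrow> real^'n" assume \<psi>: "C1c_QT T \<psi>"
    have "(LINT z:QT T|lborel. (\<Sum>i\<in>UNIV. d_t \<psi> z $ i * u z $ i + (\<Sum>\<alpha>\<in>UNIV. d_x \<alpha> \<psi> z $ i * f (u z) $ i $ \<alpha>)))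
      = (LINT z:QT T|lborel. (\<Sum>i\<in>UNIV. d_t \<psi> z $ i * vb z $ i + (\<Sum>\<alpha>\<in>UNIV. d_x \<alpha> \<psi> z $ i * f (vb z) $ i $ \<alpha>)))"
      by (rule set_lebesgue_integral_cong) (auto simp: u_vb intro!: QT_borel)
    then show "(LINT z:QT T|lborel. (\<Sum>i\<in>UNIV. d_t \<psi> z $ i * u z $ i + (\<Sum>\<alpha>\<in>UNIV. d_x \<alpha> \<psi> z $ i * f (u z) $ i $ \<alpha>)))
        + (LINT x:Qcell|lborel. (\<Sum>i\<in>UNIV. \<psi> (x, 0) $ i * u (x, 0) $ i)) = 0"
      using vb_weak[rule_format, OF \<psi>] by (simp add: u_0)
    show "(LINT z:QT T|lborel. (\<Sum>i\<in>UNIV. (\<integral>l. l $ i \<partial>(\<nu> z)) * d_t \<psi> z $ i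
               + (\<Sum>\<alpha>\<in>UNIV. d_x \<alpha> \<psi> z $ i * (\<integral>l. f l $ i $ \<alpha> \<partial>(\<nu> z)))))
          + (LINT x:Qcell|lborel. (\<Sum>i\<in>UNIV. \<psi> (x, 0) $ i * u (x, 0) $ i)) = 0"
      using mv_weak[rule_format, OF \<psi>] unfolding weak0 .
  next
    fix \<theta> :: "real \<Rightarrow> real" assume \<theta>: "C1c_T T \<theta>" "\<And>t. 0 \<le> \<theta> t"
    have "(LINT z:QT T|lborel. deriv \<theta> (snd z) * \<eta> (u z)) = (LINT z:QT T|lborel. deriv \<theta> (snd z) * \<eta> (vb z))"
      by (rule set_lebesgue_integral_cong) (auto simp: u_vb intro!: QT_borel)
    then show "(LINT z:QT T|lborel. deriv \<theta> (snd z) * \<eta> (u z)) + (LINT x:Qcell|lborel. \<theta> 0 * \<eta> (u (x, 0))) = 0"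
      using vb_entropy[rule_format, of \<theta>] \<theta> by (simp add: u_0)
    assume noninc: "\<And>t. deriv \<theta> t \<le> 0"
    \<comment> \<open>The favourable sign of the concentration term. It persists even if the
      integral takes its default value zero.\<close>
    have "0 \<le> (\<integral>z. - deriv \<theta> (snd z) \<partial>\<gamma>)"
      by (rule Bochner_Integration.integral_nonneg) (use noninc in simp)
    then have "(\<integral>z. deriv \<theta> (snd z) \<partial>\<gamma>) \<le> 0" by simp
    \<comment> \<open>The integral of a constant is a multiple of the total mass, which is zero for
      \<open>\<zeta>\<close>.\<close>
    moreover have "(\<integral>x. \<theta> 0 \<partial>\<zeta>) = 0"
      using zeta_zero by (simp add: measure_def)
    moreover have "C1c_T T \<theta> \<and> (\<forall>t\<in>{0..<T}. 0 \<le> \<theta> t)" using \<theta> by simp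
    note mv_entropy[THEN spec, THEN mp, OF this, unfolded entropy0]
    ultimately show "0 \<le> (LINT z:QT T|lborel. deriv \<theta> (snd z) * (\<integral>l. \<eta> l \<partial>(\<nu> z)))
          + (LINT x:Qcell|lborel. \<theta> 0 * \<eta> (u (x, 0)))"
      by linarith
  qed (use f \<eta> sym T_pos u_lip v v_lim v_bdd u_bdd L0 gamma0_pos quad \<eta>_nn f_growth id_growth nu_young eta_fin
       in \<open>auto intro: add_increasing2\<close>)
  have dirac: "AE z in lborel. z \<in> QT T \<longrightarrow> \<nu> z = return borel (vb z)"
    using young_measure_dirac by eventually_elim (simp add: u_vb)
  moreover have "AE z in lborel. z \<in> QT T \<longrightarrow> (\<integral>l. l \<partial>(\<nu> z)) = vb z"
    using dirac by eventually_elim (simp add: integral_return)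
  ultimately show ?thesis by blast
qed

end
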